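(* Let $\boldsymbol\mu(u)=(\mu_i(u))_{1\le i\le\kappa}$ with $\mu_i(u)\in\varepsilon_i+u^{-1}\mathbb C[[u^{-1}]]$. The Verma module $M(\boldsymbol\mu(u))$ over $\mathscr B_{\mathbf s,\boldsymbol\varepsilon}$ is nontrivial if and only if $\mu_\kappa(u)\mu_\kappa(-u)=1$ and, for every $1\le i<\kappa$, $$\tilde\mu_i(u)\,\tilde\mu_i(-u+\rho_{i+1})=\tilde\mu_{i+1}(u)\,\tilde\mu_{i+1}(-u+\rho_{i+1}),$$ where $\tilde\mu_i(u)=(2u-\rho_{i+1})\mu_i(u)+\sum_{a=i+1}^\kappa s_a\mu_a(u)$.
   Context: Fix integers $m,n\ge0$, $\kappa=m+n$, a parity sequence $\mathbf s=(s_1,\dots,s_\kappa)\in\{\pm1\}^\kappa$ with exactly $m$ entries $1$, $s_i=(-1)^{|i|}$; $\rho_k=\sum_{a=k}^\kappa s_a$ ($1\le k\le\kappa$), $\rho_{\kappa+1}=0$. $V=\mathbb C^{m|n}$ with basis $v_i$ of parity $|i|$, matrix units $E_{ij}$, $R(u)=1-\frac1u\sum_{i,j}s_jE_{ij}\otimes E_{ji}$. Fix $\boldsymbol\varepsilon\in\{\pm1\}^\kappa$. The twisted super Yangian $\mathscr B_{\mathbf s,\boldsymbol\varepsilon}$ is generated by $b_{ij}^{(r)}$ ($r\ge1$) of parity $|i|+|j|$, with $b_{ij}(u)=\delta_{ij}\varepsilon_i+\sum_{r\ge1}b_{ij}^{(r)}u^{-r}$, $B(u)=\sum(-1)^{|i||j|+|j|}b_{ij}(u)\otimes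 E_{ij}$, and relations $R(u-v)B_1(u)R(u+v)B_2(v)=B_2(v)R(u+v)B_1(u)R(u-v)$, $B(u)B(-u)=1$. The Verma module $M(\boldsymbol\mu(u))$ is the quotient of $\mathscr B_{\mathbf s,\boldsymbol\varepsilon}$ by the left ideal generated by all coefficients of $b_{ij}(u)$ for $1\le i<j\le\kappa$ and of $b_{ii}(u)-\mu_i(u)$ for $1\le i\le\kappa$. *)

theory Defs
  imports "HOL-Computational_Algebra.Formal_Laurent_Series"
begin

text \<open>A generator (i,j,r) stands for b_ij^(r).  Elements of the free associative
  C-algebra are coefficient functions on words (lists of generators);
  multiplication is concatenation-convolution (every word has finitely many splittings).\<close>

type_synonym gen = "nat \<times> nat \<times> nat"
type_synonym falg = "gen list \<Rightarrow> complex"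

definition fzero :: falg where "fzero = (\<lambda>w. 0)"
definition fone :: falg where "fone = (\<lambda>w. if w = [] then 1 else 0)"
definition fgen :: "gen \<Rightarrow> falg" where "fgen g = (\<lambda>w. if w = [g] then 1 else 0)"
definition fmon :: "complex \<Rightarrow> gen list \<Rightarrow> falg" where
  "fmon c v = (\<lambda>w. if w = v then c else 0)"
definition fadd :: "falg \<Rightarrow> falg \<Rightarrow> falg" where "fadd x y = (\<lambda>w. x w + y w)"
definition fsub :: "falg \<Rightarrow> falg \<Rightarrow> falg" where "fsub x y = (\<lambda>w. x w - y w)"
definition fscal :: "complex \<Rightarrow> falg \<Rightarrow> falg" where "fscal c x = (\<lambda>w. c * x w)"
definition fmul :: "falg \<Rightarrow> falg \<Rightarrow> falg" where
  "fmul x y = (\<lambda>w. \<Sum>k\<in>{0..length w}. x (take k w) * y (drop k w))"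
definition fsum :: "('a \<Rightarrow> falg) \<Rightarrow> 'a set \<Rightarrow> falg" where
  "fsum f A = (\<lambda>w. \<Sum>a\<in>A. f a w)"

definition valid_gen :: "nat \<Rightarrow> gen \<Rightarrow> bool" where
  "valid_gen \<kappa> g = (case g of (i, j, r) \<Rightarrow> 1 \<le> i \<and> i \<le> \<kappa> \<and> 1 \<le> j \<and> j \<le> \<kappa> \<and> 1 \<le> r)"

text \<open>A series is a coefficient function: ser m n is the coefficient of u^m v^n.
  All series occurring below have exponents \<le> 2 in each variable (bounded above),
  so the Cauchy product is a finite sum over the window [m - 4, 4].\<close>

type_synonym ser = "int \<Rightarrow> int \<Rightarrow> falg"

definition ser_win :: int where "ser_win = 4"

definition smul :: "ser \<Rightarrow> ser \<Rightarrow> ser" where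
  "smul X Y = (\<lambda>m n. fsum (\<lambda>(a, b). fmul (X a b) (Y (m - a) (n - b)))
                ({m - ser_win..ser_win} \<times> {n - ser_win..ser_win}))"
definition sadd :: "ser \<Rightarrow> ser \<Rightarrow> ser" where "sadd X Y = (\<lambda>m n. fadd (X m n) (Y m n))"
definition ssub :: "ser \<Rightarrow> ser \<Rightarrow> ser" where "ssub X Y = (\<lambda>m n. fsub (X m n) (Y m n))"
definition sscal :: "complex \<Rightarrow> ser \<Rightarrow> ser" where "sscal c X = (\<lambda>m n. fscal c (X m n))"
definition szero :: ser where "szero = (\<lambda>m n. fzero)"
definition smon :: "complex \<Rightarrow> int \<Rightarrow> int \<Rightarrow> ser" where
  "smon c a b = (\<lambda>m n. if m = a \<and> n = b then fscal c fone else fzero)"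

text \<open>An element is given by its coefficients X i j k l (coefficient of E_ij \<otimes> E_kl).
  All elements used are even, so the coefficient of E_ij \<otimes> E_kl has parity
  |i|+|j|+|k|+|l|; the product uses the sign rule of the graded tensor product
  (x \<otimes> e \<otimes> f)(y \<otimes> e' \<otimes> f') = (-1)^(|y|(|e|+|f|) + |f||e'|) xy \<otimes> ee' \<otimes> ff'.\<close>

type_synonym tmat = "nat \<Rightarrow> nat \<Rightarrow> nat \<Rightarrow> nat \<Rightarrow> ser"

definition par :: "(nat \<Rightarrow> int) \<Rightarrow> nat \<Rightarrow> nat" where
  "par s i = (if s i = 1 then 0 else 1)"

definition tmul :: "nat \<Rightarrow> (nat \<Rightarrow> int) \<Rightarrow> tmat \<Rightarrow> tmat \<Rightarrow> tmat" where
  "tmul \<kappa> s X Y = (\<lambda>i j k l. \<lambda>m n. fsum (\<lambda>(a, c).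
      (smul (sscal ((-1) ^ ((par s a + par s j + par s c + par s l) * (par s i + par s a + par s k + par s c)
                         + (par s k + par s c) * (par s a + par s j)))
                    (X i a k c)) (Y a j c l)) m n) ({1..\<kappa>} \<times> {1..\<kappa>}))"

definition tsub :: "tmat \<Rightarrow> tmat \<Rightarrow> tmat" where
  "tsub X Y = (\<lambda>i j k l. ssub (X i j k l) (Y i j k l))"

definition tid :: tmat where
  "tid = (\<lambda>i j k l. if i = j \<and> k = l then smon 1 0 0 else szero)"
definition tP :: "(nat \<Rightarrow> int) \<Rightarrow> tmat" where
  "tP s = (\<lambda>i j k l. if k = j \<and> l = i then smon (of_int (s j)) 0 0 else szero)"

text \<open>(u-v) R(u-v) = (u - v) - P   and   (u+v) R(u+v) = (u + v) - P\<close>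
definition Rminus :: "(nat \<Rightarrow> int) \<Rightarrow> tmat" where
  "Rminus s = (\<lambda>i j k l. ssub (if i = j \<and> k = l then sadd (smon 1 1 0) (smon (-1) 0 1) else szero)
                               (tP s i j k l))"
definition Rplus :: "(nat \<Rightarrow> int) \<Rightarrow> tmat" where
  "Rplus s = (\<lambda>i j k l. ssub (if i = j \<and> k = l then sadd (smon 1 1 0) (smon 1 0 1) else szero)
                              (tP s i j k l))"

definition theta :: "(nat \<Rightarrow> int) \<Rightarrow> nat \<Rightarrow> nat \<Rightarrow> complex" where
  "theta s i j = (-1) ^ (par s i * par s j + par s j)"

definition bU :: "(nat \<Rightarrow> int) \<Rightarrow> nat \<Rightarrow> nat \<Rightarrow> ser" where
  "bU \<epsilon> i j = (\<lambda>m n. if n = 0 then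
       (if m = 0 then (if i = j then fscal (of_int (\<epsilon> i)) fone else fzero)
        else if m < 0 then fgen (i, j, nat (- m)) else fzero) else fzero)"
definition bV :: "(nat \<Rightarrow> int) \<Rightarrow> nat \<Rightarrow> nat \<Rightarrow> ser" where
  "bV \<epsilon> i j = (\<lambda>m n. bU \<epsilon> i j n m)"
definition bUneg :: "(nat \<Rightarrow> int) \<Rightarrow> nat \<Rightarrow> nat \<Rightarrow> ser" where
  "bUneg \<epsilon> i j = (\<lambda>m n. fscal ((-1) ^ nat (- m)) (bU \<epsilon> i j m n))"

definition B1 :: "(nat \<Rightarrow> int) \<Rightarrow> (nat \<Rightarrow> int) \<Rightarrow> tmat" where
  "B1 s \<epsilon> = (\<lambda>i j k l. if k = l then sscal (theta s i j) (bU \<epsilon> i j) else szero)"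
definition B1neg :: "(nat \<Rightarrow> int) \<Rightarrow> (nat \<Rightarrow> int) \<Rightarrow> tmat" where
  "B1neg s \<epsilon> = (\<lambda>i j k l. if k = l then sscal (theta s i j) (bUneg \<epsilon> i j) else szero)"
definition B2 :: "(nat \<Rightarrow> int) \<Rightarrow> (nat \<Rightarrow> int) \<Rightarrow> tmat" where
  "B2 s \<epsilon> = (\<lambda>i j k l. if i = j then sscal (theta s k l) (bV \<epsilon> k l) else szero)"

text \<open>Reflection relation multiplied by (u-v)(u+v), and unitarity B(u)B(-u) = 1
  (embedded in the first tensor factor).\<close>
definition refl_rel :: "nat \<Rightarrow> (nat \<Rightarrow> int) \<Rightarrow> (nat \<Rightarrow> int) \<Rightarrow> tmat" where
  "refl_rel \<kappa> s \<epsilon> = tsub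
     (tmul \<kappa> s (tmul \<kappa> s (tmul \<kappa> s (Rminus s) (B1 s \<epsilon>)) (Rplus s)) (B2 s \<epsilon>))
     (tmul \<kappa> s (tmul \<kappa> s (tmul \<kappa> s (B2 s \<epsilon>) (Rplus s)) (B1 s \<epsilon>)) (Rminus s))"
definition unit_rel :: "nat \<Rightarrow> (nat \<Rightarrow> int) \<Rightarrow> (nat \<Rightarrow> int) \<Rightarrow> tmat" where
  "unit_rel \<kappa> s \<epsilon> = tsub (tmul \<kappa> s (B1 s \<epsilon>) (B1neg s \<epsilon>)) tid"

definition defining_rels :: "nat \<Rightarrow> (nat \<Rightarrow> int) \<Rightarrow> (nat \<Rightarrow> int) \<Rightarrow> falg set" where
  "defining_rels \<kappa> s \<epsilon> =
     {refl_rel \<kappa> s \<epsilon> i j k l m n | i j k l m n.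
        i \<in> {1..\<kappa>} \<and> j \<in> {1..\<kappa>} \<and> k \<in> {1..\<kappa>} \<and> l \<in> {1..\<kappa>}}
   \<union> {unit_rel \<kappa> s \<epsilon> i j k l m n | i j k l m n.
        i \<in> {1..\<kappa>} \<and> j \<in> {1..\<kappa>} \<and> k \<in> {1..\<kappa>} \<and> l \<in> {1..\<kappa>}}"

inductive_set two_sided_ideal :: "nat \<Rightarrow> falg set \<Rightarrow> falg set" for \<kappa> and G where
  gen: "x \<in> G \<Longrightarrow> x \<in> two_sided_ideal \<kappa> G"
| zero: "fzero \<in> two_sided_ideal \<kappa> G"
| add: "x \<in> two_sided_ideal \<kappa> G \<Longrightarrow> y \<in> two_sided_ideal \<kappa> G \<Longrightarrow> fadd x y \<in> two_sided_ideal \<kappa> G"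
| lmul: "x \<in> two_sided_ideal \<kappa> G \<Longrightarrow> list_all (valid_gen \<kappa>) w \<Longrightarrow>
          fmul (fmon c w) x \<in> two_sided_ideal \<kappa> G"
| rmul: "x \<in> two_sided_ideal \<kappa> G \<Longrightarrow> list_all (valid_gen \<kappa>) w \<Longrightarrow>
          fmul x (fmon c w) \<in> two_sided_ideal \<kappa> G"

inductive_set left_ideal :: "nat \<Rightarrow> falg set \<Rightarrow> falg set" for \<kappa> and G where
  gen: "x \<in> G \<Longrightarrow> x \<in> left_ideal \<kappa> G"
| zero: "fzero \<in> left_ideal \<kappa> G"
| add: "x \<in> left_ideal \<kappa> G \<Longrightarrow> y \<in> left_ideal \<kappa> G \<Longrightarrow> fadd x y \<in> left_ideal \<kappa> G"
| lmul: "x \<in> left_ideal \<kappa> G \<Longrightarrow> list_all (valid_gen \<kappa>) w \<Longrightarrow>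
          fmul (fmon c w) x \<in> left_ideal \<kappa> G"

text \<open>Generators of the Verma left ideal (lifted to the free algebra): all coefficients
  of b_ij(u) (i<j) and of b_ii(u) - mu_i(u); mu_i is a power series in u^{-1}.\<close>
definition verma_gens :: "nat \<Rightarrow> (nat \<Rightarrow> int) \<Rightarrow> (nat \<Rightarrow> complex fps) \<Rightarrow> falg set" where
  "verma_gens \<kappa> \<epsilon> \<mu> =
     {fgen (i, j, r) | i j r. 1 \<le> i \<and> i < j \<and> j \<le> \<kappa> \<and> 1 \<le> r}
   \<union> {fsub (fgen (i, i, r)) (fscal (\<mu> i $ r) fone) | i r. 1 \<le> i \<and> i \<le> \<kappa> \<and> 1 \<le> r}
   \<union> {fscal (of_int (\<epsilon> i) - \<mu> i $ 0) fone | i. 1 \<le> i \<and> i \<le> \<kappa>}"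

text \<open>M(mu) = B / (B-left ideal) is nonzero iff 1 is not in the preimage of that left
  ideal in the free algebra, i.e. the left ideal generated by the two-sided ideal of
  defining relations together with the Verma generators.\<close>
definition verma_nontrivial :: "nat \<Rightarrow> (nat \<Rightarrow> int) \<Rightarrow> (nat \<Rightarrow> int) \<Rightarrow> (nat \<Rightarrow> complex fps) \<Rightarrow> bool" where
  "verma_nontrivial \<kappa> s \<epsilon> \<mu> =
     (fone \<notin> left_ideal \<kappa> (two_sided_ideal \<kappa> (defining_rels \<kappa> s \<epsilon>) \<union> verma_gens \<kappa> \<epsilon> \<mu>))"

definition rho :: "nat \<Rightarrow> (nat \<Rightarrow> int) \<Rightarrow> nat \<Rightarrow> complex" where
  "rho \<kappa> s k = of_int (\<Sum>a\<in>{k..\<kappa>}. s a)"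

text \<open>Series in X = u^{-1}.  mu(c - u) = mu(X \<mapsto> -X/(1 - cX)).\<close>
definition shift_neg :: "complex \<Rightarrow> complex fps" where
  "shift_neg c = - fps_X * inverse (1 - fps_const c * fps_X)"

definition mu_tilde :: "nat \<Rightarrow> (nat \<Rightarrow> int) \<Rightarrow> (nat \<Rightarrow> complex fps) \<Rightarrow> nat \<Rightarrow> complex fls" where
  "mu_tilde \<kappa> s \<mu> i =
     (2 * fls_X_inv - fls_const (rho \<kappa> s (i+1))) * fps_to_fls (\<mu> i)
     + (\<Sum>a\<in>{i+1..\<kappa>}. fls_const (of_int (s a)) * fps_to_fls (\<mu> a))"

text \<open>tilde mu_i(-u + c), i.e. the same expression with u replaced by c - u.\<close>
definition mu_tilde_refl :: "nat \<Rightarrow> (nat \<Rightarrow> int) \<Rightarrow> (nat \<Rightarrow> complex fps) \<Rightarrow> nat \<Rightarrow> complex \<Rightarrow> complex fls" where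
  "mu_tilde_refl \<kappa> s \<mu> i c =
     (2 * (fls_const c - fls_X_inv) - fls_const (rho \<kappa> s (i+1))) * fps_to_fls (\<mu> i oo shift_neg c)
     + (\<Sum>a\<in>{i+1..\<kappa>}. fls_const (of_int (s a)) * fps_to_fls (\<mu> a oo shift_neg c))"

end

theory Submission
  imports Defs "HOL-Library.Function_Algebras" "HOL-Computational_Algebra.Fundamental_Theorem_Algebra"
begin

text \<open>After the signs of the graded tensor square are absorbed by a gauge factor, the defining
  relations become an ordinary reflection equation together with \<open>B(u) B(-u) = 1\<close>.

  Necessity: if the left ideal is proper, there is a linear functional with \<open>\<phi>(1) = 1\<close> that
  vanishes on it.  Applied to words of length at most two, the components of the reflection
  equation yield the conditions, after specialising \<open>v = \<rho> - u\<close>.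

  Sufficiency: let \<open>L\<close> be \<open>1 + (\<alpha> + E) / u\<close> with \<open>E\<close> a rank one (Dyson) realisation of the general
  linear Lie superalgebra by oscillators, so that \<open>E\<^sup>2\<close> is a multiple of \<open>E\<close>.  Dressing
  a solution \<open>B\<close> to \<open>L B L'\<close>, starting from a diagonal one, keeps the reflection equation, unitarity and the highest
  weight vector, does not change \<open>\<mu>\<^sub>k\<close> for \<open>k > i\<close>, and multiplies the \<open>i\<close>-th tilde series by
  \<open>(z + c) / (z - c)\<close> with \<open>z = u - \<rho> / 2\<close>.  A series \<open>g\<close> with \<open>g(z) g(-z) = 1\<close> and constant term
  \<open>1\<close> is \<open>q(z) / q(-z)\<close> for \<open>q = (1 + g) / 2\<close>, hence modulo any power of \<open>1 / u\<close> a finite product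
  of such factors, by splitting a truncation of \<open>q\<close> into linear factors.  Approximating the
  weight to every order suffices because a proof that \<open>1\<close> lies in the left ideal involves
  only finitely many coefficients of the weight.\<close>

text \<open>The point v = \<rho> - u is forced. Summing the relations for b_ia b_ai over a > i
  expresses the value of the functional on the i-th diagonal entry of B(u)B(v) with denominator u +
  v - \<rho>; setting this to zero in the relations for i and i + 1 leaves the condition. For \<rho>
  = 0 a further factor u + v vanishes there too: it is cancelled before the substitution, and
  unitarity evaluates what remains.

  A dressing at i also alters the weights below i, so the weight is fitted from index \<kappa>
  downwards. If E^2 = \<nu> E, the parameters of L and L' add up to -\<nu>: this makes L(u) L'(-u)
  scalar and lets the two pass through R(u + v), and it leaves one free number c per dressing. That
  the quotient g of the target and realised tilde series satisfies g(z) g(-z) = 1 up to the chosen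
  order is not computed: necessity is applied to the realised Verma module. Every dressing uses
  fresh oscillators, so that its E supercommutes with all that was built before.\<close>

lemma sum_fun_apply: "(sum f A) x = (\<Sum>a\<in>A. f a x)" for f :: "'a \<Rightarrow> 'b \<Rightarrow> 'c::comm_monoid_add"
  by (induction A rule: infinite_finite_induct) auto

lemma sum_ser_apply: "(sum f A) m n = (\<Sum>a\<in>A. f a m n)" for f :: "'a \<Rightarrow> ser"
  by (simp add: sum_fun_apply)

text \<open>\<open>falg\<close> is a function type, so its linear operations are those of
  \<open>Function_Algebras\<close> and the usual facts on sums apply. \<open>fmul\<close> and
  \<open>fone\<close> are kept, because product and unit of functions are pointwise and mean
  something else.\<close>

lemma fops: "fzero = 0" "fadd x y = x + y" "fsub x y = x - y" "fsum f A = sum f A"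
  by (auto simp: fzero_def fadd_def fsub_def fsum_def fun_eq_iff sum_fun_apply)

lemma sops: "szero = 0" "sadd X Y = X + Y" "ssub X Y = X - Y"
  by (auto simp: szero_def sadd_def ssub_def fops fun_eq_iff)

lemma fscal_simps [simp]: "fscal c 0 = 0" "fscal 0 x = 0" "fscal 1 x = x" "fscal c (fscal d x) = fscal (c * d) x"
  by (auto simp: fscal_def fun_eq_iff)

lemma fscal_linear: "fscal c (x + y) = fscal c x + fscal c y" "fscal c (x - y) = fscal c x - fscal c y"
  "fscal c (- x) = - fscal c x" "fscal (- c) x = - fscal c x"
  "fscal c (sum f A) = (\<Sum>a\<in>A. fscal c (f a))"
  by (auto simp: fscal_def fun_eq_iff algebra_simps sum_fun_apply sum_distrib_left)

lemma fmul_simps [simp]: "fmul 0 y = 0" "fmul x 0 = 0"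
  "fmul (fscal c x) y = fscal c (fmul x y)" "fmul x (fscal c y) = fscal c (fmul x y)"
  by (auto simp: fmul_def fscal_def fun_eq_iff sum_distrib_left mult_ac)

lemma fmul_linear: "fmul (x + y) z = fmul x z + fmul y z" "fmul x (y + z) = fmul x y + fmul x z"
  "fmul (x - y) z = fmul x z - fmul y z" "fmul x (y - z) = fmul x y - fmul x z"
  "fmul (- x) z = - fmul x z" "fmul x (- z) = - fmul x z"
  by (auto simp: fmul_def fun_eq_iff algebra_simps sum.distrib sum_subtractf sum_negf)

lemma fmul_sum: "fmul (sum f A) y = (\<Sum>a\<in>A. fmul (f a) y)" "fmul y (sum f A) = (\<Sum>a\<in>A. fmul y (f a))"
  by (induction A rule: infinite_finite_induct) (auto simp: fmul_linear)

lemma fone_fmon: "fone = fmon 1 []" by (auto simp: fone_def fmon_def)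
lemma fgen_fmon: "fgen g = fmon 1 [g]" by (auto simp: fgen_def fmon_def)
lemma fscal_fmon: "fscal c (fmon d w) = fmon (c * d) w" by (auto simp: fscal_def fmon_def)

lemma fmul_fmon: "fmul (fmon c v) (fmon d w) = fmon (c * d) (v @ w)"
proof
  fix x
  \<comment> \<open>Among the splittings of x only the cut at \<open>length v\<close> can produce
    the pair v, w.\<close>
  have "fmul (fmon c v) (fmon d w) x =
      (\<Sum>k\<in>{0..length x}. if k = length v then if x = v @ w then c * d else 0 else 0)"
    unfolding fmul_def
  proof (rule sum.cong)
    fix k assume k: "k \<in> {0..length x}"
    show "fmon c v (take k x) * fmon d w (drop k x) =
       (if k = length v then if x = v @ w then c * d else 0 else 0)"
    proof (cases "take k x = v \<and> drop k x = w")
      case True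
      then have "length (take k x) = length v" by simp
      with k have "k = length v" by simp
      moreover have "x = v @ w" using True append_take_drop_id[of k x] by simp
      ultimately show ?thesis using True by (simp add: fmon_def)
    next
      case False
      then have "\<not> (k = length v \<and> x = v @ w)" by auto
      then show ?thesis using False by (auto simp: fmon_def)
    qed
  qed simp
  also have "\<dots> = fmon (c * d) (v @ w) x" by (auto simp: fmon_def)
  finally show "fmul (fmon c v) (fmon d w) x = fmon (c * d) (v @ w) x" .
qed

lemma fmul_fone [simp]: "fmul fone x = x" "fmul x fone = x"
proof -
  show "fmul fone x = x"
  proof
    fix w
    have "fmul fone x w = (\<Sum>k\<in>{0..length w}. if k = 0 then x w else 0)"
      unfolding fmul_def by (rule sum.cong) (auto simp: fone_def)
    then show "fmul fone x w = x w" by simp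
  qed
  show "fmul x fone = x"
  proof
    fix w
    have "fmul x fone w = (\<Sum>k\<in>{0..length w}. if k = length w then x w else 0)"
      unfolding fmul_def by (rule sum.cong) (auto simp: fone_def)
    then show "fmul x fone w = x w" by simp
  qed
qed

lemma fmul_fmon_nil: "fmul (fmon c []) x = fscal c x"
proof -
  have "fmon c [] = fscal c fone" by (simp add: fone_fmon fscal_fmon)
  then show ?thesis by simp
qed

subsection \<open>Doubly indexed series\<close>

text \<open>4 is the bound \<open>ser_win\<close>: the window in \<open>smul\<close> sees exponents
  of both factors only up to 4, so a product with a monomial is the true product as long as nothing
  lies above it.\<close>

definition bounded_ser :: "ser \<Rightarrow> bool" where
  "bounded_ser X \<longleftrightarrow> (\<forall>m n. m > 4 \<or> n > 4 \<longrightarrow> X m n = 0)"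

lemma smul_linear: "smul (X + Y) Z = smul X Z + smul Y Z" "smul Z (X + Y) = smul Z X + smul Z Y"
  "smul (X - Y) Z = smul X Z - smul Y Z" "smul Z (X - Y) = smul Z X - smul Z Y"
  by (auto simp: smul_def fops fun_eq_iff fmul_linear sum.distrib sum_subtractf case_prod_unfold sum_fun_apply)

lemma smul_zero [simp]: "smul 0 Y = 0" "smul Y 0 = 0"
  by (auto simp: smul_def fops fun_eq_iff case_prod_unfold sum_fun_apply)

lemma sscal_simps [simp]: "sscal c 0 = 0" "sscal 1 X = X" "sscal c (sscal d X) = sscal (c * d) X" "sscal 0 X = 0"
  by (auto simp: sscal_def fun_eq_iff)

lemma sscal_linear: "sscal c (X + Y) = sscal c X + sscal c Y" "sscal c (X - Y) = sscal c X - sscal c Y"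
  "sscal c (sum F A) = (\<Sum>a\<in>A. sscal c (F a))"
  by (auto simp: sscal_def fun_eq_iff fscal_linear sum_fun_apply)

lemma smul_sscal [simp]: "smul (sscal c X) Y = sscal c (smul X Y)" "smul X (sscal c Y) = sscal c (smul X Y)"
  by (auto simp: smul_def sscal_def fops fun_eq_iff case_prod_unfold fscal_linear sum_fun_apply)

lemma smul_smon_left:
  assumes "bounded_ser Y" "a \<le> 4" "b \<le> 4"
  shows "smul (smon c a b) Y = (\<lambda>m n. fscal c (Y (m - a) (n - b)))"
proof (intro ext)
  fix m n w
  have "smul (smon c a b) Y m n =
    (\<Sum>x\<in>{m - 4..4} \<times> {n - 4..4}. if x = (a, b) then fscal c (Y (m - a) (n - b)) else 0)"
    unfolding smul_def fops ser_win_def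
    by (rule sum.cong) (auto simp: smon_def fops)
  also have "\<dots> = fscal c (Y (m - a) (n - b))"
    using assms by (auto simp: bounded_ser_def)
  finally show "smul (smon c a b) Y m n w = fscal c (Y (m - a) (n - b)) w" by simp
qed

lemma smul_smon_right:
  assumes "bounded_ser Y" "a \<le> 4" "b \<le> 4"
  shows "smul Y (smon c a b) = (\<lambda>m n. fscal c (Y (m - a) (n - b)))"
proof (intro ext)
  fix m n w
  have "smul Y (smon c a b) m n =
    (\<Sum>x\<in>{m - 4..4} \<times> {n - 4..4}. if x = (m - a, n - b) then fscal c (Y (m - a) (n - b)) else 0)"
    unfolding smul_def fops ser_win_def
    by (rule sum.cong) (auto simp: smon_def fops)
  also have "\<dots> = fscal c (Y (m - a) (n - b))"
    using assms by (auto simp: bounded_ser_def)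
  finally show "smul Y (smon c a b) m n w = fscal c (Y (m - a) (n - b)) w" by simp
qed

text \<open>Multiplying a graded matrix entrywise by this sign turns the product of the graded
  tensor square into the ordinary matrix product.\<close>

definition gauge :: "(nat \<Rightarrow> int) \<Rightarrow> nat \<Rightarrow> nat \<Rightarrow> nat \<Rightarrow> nat \<Rightarrow> complex" where
  "gauge s i j k l = (-1) ^ ((par s i + par s k) * (par s j + par s l) + par s j + par s l
     + (par s k + par s l) * par s j)"

definition gauged :: "(nat \<Rightarrow> int) \<Rightarrow> tmat \<Rightarrow> tmat" where
  "gauged s X = (\<lambda>i j k l. sscal (gauge s i j k l) (X i j k l))"

definition mtmul :: "nat \<Rightarrow> tmat \<Rightarrow> tmat \<Rightarrow> tmat" where
  "mtmul \<kappa> X Y = (\<lambda>i j k l. \<Sum>(a, c)\<in>{1..\<kappa>} \<times> {1..\<kappa>}. smul (X i a k c) (Y a j c l))"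

lemma gauge_square: "gauge s i j k l * gauge s i j k l = 1"
  by (simp add: gauge_def flip: power_mult_distrib)

lemma gauged_tmul: "gauged s (tmul \<kappa> s X Y) = mtmul \<kappa> (gauged s X) (gauged s Y)"
proof (intro ext)
  fix i j k l m n w
  \<comment> \<open>The sign of the graded product is a cocycle in the parities and
    \<open>gauge\<close> is a cochain with that coboundary. Only parities enter, so comparing
    exponents modulo two settles it.\<close>
  have sign: "gauge s i j k l * (-1) ^ ((par s a + par s j + par s c + par s l) *
        (par s i + par s a + par s k + par s c) + (par s k + par s c) * (par s a + par s j))
      = gauge s a j c l * gauge s i a k c" for a c
    unfolding gauge_def power_add[symmetric] by (auto simp: minus_one_power_iff)
  have smul_apply: "smul (sscal c X) Y m n = fscal c (smul X Y m n)" "smul X (sscal c Y) m n = fscal c (smul X Y m n)"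
    for c X Y by (simp_all, simp_all add: sscal_def)
  have "gauged s (tmul \<kappa> s X Y) i j k l m n = mtmul \<kappa> (gauged s X) (gauged s Y) i j k l m n"
    unfolding gauged_def tmul_def mtmul_def sscal_def[of "gauge s i j k l"] fops fscal_linear sum_ser_apply
    by (rule sum.cong) (auto simp: smul_apply sign simp del: smul_sscal)
  then show "gauged s (tmul \<kappa> s X Y) i j k l m n w = mtmul \<kappa> (gauged s X) (gauged s Y) i j k l m n w"
    by simp
qed

lemma gauged_tsub: "gauged s (tsub X Y) = gauged s X - gauged s Y"
  by (auto simp: gauged_def tsub_def fun_eq_iff sops sscal_linear)

definition psign :: "(nat \<Rightarrow> int) \<Rightarrow> nat \<Rightarrow> nat \<Rightarrow> complex" where
  "psign s i j = (-1) ^ (par s i * par s j)"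

lemma psign_sym: "psign s i j = psign s j i" by (simp add: psign_def mult.commute)
lemma psign_square [simp]: "psign s i j * psign s i j = 1" "psign s i j * (psign s i j * x) = x"
  by (simp_all add: psign_def flip: power_mult_distrib mult.assoc)

subsection \<open>The defining relations in components\<close>

definition sshift :: "int \<Rightarrow> int \<Rightarrow> ser \<Rightarrow> ser" where
  "sshift p q X = (\<lambda>m n. X (m - p) (n - q))"

text \<open>Keeps account of degrees in the iterated products: each R matrix raises the bound by
  one, and every intermediate factor must stay inside the window of \<open>smul\<close>.\<close>

definition sdeg_le :: "int \<Rightarrow> ser \<Rightarrow> bool" where
  "sdeg_le d X \<longleftrightarrow> (\<forall>m n. m > d \<or> n > d \<longrightarrow> X m n = 0)"

lemma sscal_minus: "sscal (- c) X = - sscal c X"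
  by (auto simp: sscal_def fscal_def fun_eq_iff)

lemma sshift_simps [simp]: "sshift p q 0 = 0" "sshift p q (sscal c X) = sscal c (sshift p q X)"
  "sshift p q (sshift p' q' X) = sshift (p + p') (q + q') X" "sshift 0 0 X = X"
  by (auto simp: sshift_def sscal_def fun_eq_iff algebra_simps)

lemma sshift_linear: "sshift p q (X + Y) = sshift p q X + sshift p q Y"
  "sshift p q (X - Y) = sshift p q X - sshift p q Y"
  "sshift p q (sum F A) = (\<Sum>a\<in>A. sshift p q (F a))"
  by (auto simp: sshift_def fun_eq_iff sum_fun_apply)

lemma sdeg_le_simps: "sdeg_le d 0" "sdeg_le d X \<Longrightarrow> sdeg_le d (sscal c X)"
  "sdeg_le d X \<Longrightarrow> sdeg_le d Y \<Longrightarrow> sdeg_le d (X + Y)"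
  "sdeg_le d X \<Longrightarrow> sdeg_le d Y \<Longrightarrow> sdeg_le d (X - Y)"
  "(\<And>a. a \<in> A \<Longrightarrow> sdeg_le d (F a)) \<Longrightarrow> sdeg_le d (sum F A)"
  "sdeg_le d X \<Longrightarrow> sdeg_le d (- X)"
  by (auto simp: sdeg_le_def sscal_def sum_ser_apply)

lemma sdeg_le_mono: "sdeg_le d' X \<Longrightarrow> d' \<le> d \<Longrightarrow> sdeg_le d X"
  by (auto simp: sdeg_le_def)

lemma sdeg_le_sshift: "sdeg_le d' X \<Longrightarrow> d' + p \<le> d \<Longrightarrow> d' + q \<le> d \<Longrightarrow> sdeg_le d (sshift p q X)"
  by (auto simp: sdeg_le_def sshift_def)

lemma bounded_ser_iff: "bounded_ser X \<longleftrightarrow> sdeg_le 4 X"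
  by (simp add: bounded_ser_def sdeg_le_def)

lemma smul_sshift:
  assumes "sdeg_le 2 X" "0 \<le> p" "p \<le> 2" "0 \<le> q" "q \<le> 2"
  shows "smul (sshift p q X) Y = sshift p q (smul X Y)"
proof -
  have "smul (sshift p q X) Y m n = sshift p q (smul X Y) m n" for m n
  proof -
    let ?f = "\<lambda>(a, b). fmul (X a b) (Y (m - p - a) (n - q - b))"
    have "smul (sshift p q X) Y m n = (\<Sum>x\<in>{m-4..4}\<times>{n-4..4}. ?f (fst x - p, snd x - q))"
      unfolding smul_def fops ser_win_def by (rule sum.cong) (auto simp: sshift_def)
    also have "\<dots> = (\<Sum>x\<in>{m-p-4..4-p}\<times>{n-q-4..4-q}. ?f x)"
      by (rule sum.reindex_bij_witness[of _ "\<lambda>x. (fst x + p, snd x + q)" "\<lambda>x. (fst x - p, snd x - q)"]) auto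
    \<comment> \<open>The window moved by (p, q) is extended back to 4. An added exponent exceeds 4
      - p or 4 - q, hence 2, and there X vanishes.\<close>
    also have "\<dots> = (\<Sum>x\<in>{m-p-4..4}\<times>{n-q-4..4}. ?f x)"
      using assms by (intro sum.mono_neutral_left) (auto simp: sdeg_le_def)
    also have "\<dots> = sshift p q (smul X Y) m n"
      unfolding smul_def fops ser_win_def sshift_def by simp
    finally show ?thesis .
  qed
  then show ?thesis by (intro ext) simp
qed

definition bcoef :: "(nat \<Rightarrow> int) \<Rightarrow> nat \<Rightarrow> nat \<Rightarrow> int \<Rightarrow> falg" where
  "bcoef \<epsilon> i j t = bU \<epsilon> i j t 0"

lemma bcoef_pos: "t > 0 \<Longrightarrow> bcoef \<epsilon> i j t = 0"
  by (simp add: bcoef_def bU_def fops)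

lemma bU_bcoef: "bU \<epsilon> i j m n = (if n = 0 then bcoef \<epsilon> i j m else 0)"
  by (simp add: bcoef_def bU_def fops)

lemma bV_bcoef: "bV \<epsilon> i j m n = (if m = 0 then bcoef \<epsilon> i j n else 0)"
  by (simp add: bV_def bU_bcoef)

lemma sdeg_bU: "0 \<le> d \<Longrightarrow> sdeg_le d (bU \<epsilon> i j)" and sdeg_bV: "0 \<le> d \<Longrightarrow> sdeg_le d (bV \<epsilon> i j)"
  by (auto simp: sdeg_le_def bU_bcoef bV_bcoef bcoef_pos)

lemma smul_bU_bV: "smul (bU \<epsilon> i j) (bV \<epsilon> k l) m n = fmul (bcoef \<epsilon> i j m) (bcoef \<epsilon> k l n)"
proof -
  have "smul (bU \<epsilon> i j) (bV \<epsilon> k l) m n =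
     (\<Sum>x\<in>{m-4..4}\<times>{n-4..4}. if x = (m, 0) then fmul (bcoef \<epsilon> i j m) (bcoef \<epsilon> k l n) else 0)"
    unfolding smul_def fops ser_win_def by (rule sum.cong) (auto simp: bU_bcoef bV_bcoef)
  also have "\<dots> = fmul (bcoef \<epsilon> i j m) (bcoef \<epsilon> k l n)"
    by (auto simp: bcoef_pos)
  finally show ?thesis .
qed

lemma smul_bV_bU: "smul (bV \<epsilon> k l) (bU \<epsilon> i j) m n = fmul (bcoef \<epsilon> k l n) (bcoef \<epsilon> i j m)"
proof -
  have "smul (bV \<epsilon> k l) (bU \<epsilon> i j) m n =
     (\<Sum>x\<in>{m-4..4}\<times>{n-4..4}. if x = (0, n) then fmul (bcoef \<epsilon> k l n) (bcoef \<epsilon> i j m) else 0)"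
    unfolding smul_def fops ser_win_def by (rule sum.cong) (auto simp: bU_bcoef bV_bcoef)
  also have "\<dots> = fmul (bcoef \<epsilon> k l n) (bcoef \<epsilon> i j m)"
    by (auto simp: bcoef_pos)
  finally show ?thesis .
qed

text \<open>The gauged R matrices: \<sigma> = -1 for (u - v) - P and \<sigma> = 1 for (u + v) - P.
  The gauge turns the entry s_j of the graded flip into the symmetric sign
  \<open>psign\<close>.\<close>

definition Rmat :: "(nat \<Rightarrow> int) \<Rightarrow> complex \<Rightarrow> tmat" where
  "Rmat s \<sigma> = (\<lambda>i j k l. (if i = j \<and> k = l then smon 1 1 0 + smon \<sigma> 0 1 else 0)
     - (if k = j \<and> l = i then smon (psign s i j) 0 0 else 0))"

lemma sscal_smon: "sscal c (smon d a b) = smon (c * d) a b"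
  by (auto simp: sscal_def smon_def fops fun_eq_iff)

lemma mtmul_cong:
  "(\<And>a c. a \<in> {1..\<kappa>} \<Longrightarrow> c \<in> {1..\<kappa>} \<Longrightarrow> X i a k c = X' i a k c \<and> Y a j c l = Y' a j c l) \<Longrightarrow>
    mtmul \<kappa> X Y i j k l = mtmul \<kappa> X' Y' i j k l"
  unfolding mtmul_def by (rule sum.cong) auto

context
  fixes \<kappa> :: nat and s \<epsilon> :: "nat \<Rightarrow> int"
  assumes s: "\<forall>i\<in>{1..\<kappa>}. s i = 1 \<or> s i = -1"
begin

text \<open>The gauge is not symmetric in the two tensor factors: it removes every sign from a
  matrix in the second factor, while a matrix in the first keeps the signs picked up in passing the
  index k.\<close>

lemma gauge_diag: "gauge s i i k k = 1" "gauge s i i k l * theta s k l = 1"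
  "gauge s i j k k * theta s i j = psign s k i * psign s k j"
  unfolding gauge_def theta_def psign_def power_add[symmetric] by (auto simp: minus_one_power_iff)

lemma gauge_swap: "j \<in> {1..\<kappa>} \<Longrightarrow> gauge s i j j i * of_int (s j) = psign s i j"
proof -
  assume "j \<in> {1..\<kappa>}"
  then have "of_int (s j) = (-1 :: complex) ^ par s j" using s by (auto simp: par_def)
  then show ?thesis unfolding gauge_def psign_def
    by (simp only: power_add[symmetric]) (auto simp: minus_one_power_iff)
qed

lemma gauged_B2: "gauged s (B2 s \<epsilon>) = (\<lambda>i j k l. if i = j then bV \<epsilon> k l else 0)"
  by (auto simp: gauged_def B2_def sops fun_eq_iff gauge_diag)

lemma gauged_B1: "gauged s (B1 s \<epsilon>) = (\<lambda>i j k l. if k = l then sscal (psign s k i * psign s k j) (bU \<epsilon> i j) else 0)"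
  by (auto simp: gauged_def B1_def sops fun_eq_iff gauge_diag)

lemma gauged_R:
  assumes "j \<in> {1..\<kappa>}"
  shows "gauged s (Rminus s) i j k l = Rmat s (-1) i j k l" "gauged s (Rplus s) i j k l = Rmat s 1 i j k l"
proof -
  have P: "sscal (gauge s i j k l) (tP s i j k l) = (if k = j \<and> l = i then smon (psign s i j) 0 0 else 0)"
    using gauge_swap[OF assms, of i] by (simp add: tP_def sops sscal_smon)
  have I: "sscal (gauge s i j k l) (if i = j \<and> k = l then smon 1 1 0 + smon \<sigma> 0 1 else 0) =
      (if i = j \<and> k = l then smon 1 1 0 + smon \<sigma> 0 1 else 0)" for \<sigma>
    by (simp add: gauge_diag)
  show "gauged s (Rminus s) i j k l = Rmat s (-1) i j k l" "gauged s (Rplus s) i j k l = Rmat s 1 i j k l"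
    by (simp_all only: gauged_def Rminus_def Rplus_def Rmat_def sops sscal_linear I P)
qed

text \<open>R is a combination of the identity and a flip, so multiplying by it only shifts
  exponents and exchanges the row indices i and k. Degree at most 3 before means at most 4 after,
  still inside the window.\<close>

lemma Rmat_mtmul:
  assumes "i \<in> {1..\<kappa>}" "k \<in> {1..\<kappa>}" and Y: "\<And>a c. sdeg_le 3 (Y a j c l)"
  shows "mtmul \<kappa> (Rmat s \<sigma>) Y i j k l =
    sshift 1 0 (Y i j k l) + sscal \<sigma> (sshift 0 1 (Y i j k l)) - sscal (psign s i k) (Y k j i l)"
proof -
  have b: "bounded_ser (Y a j c l)" for a c
    unfolding bounded_ser_iff by (rule sdeg_le_mono[OF Y]) simp
  have smon: "smul (smon c p q) (Y a j d l) = sscal c (sshift p q (Y a j d l))" if "p \<le> 4" "q \<le> 4" for c p q a d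
    using smul_smon_left[OF b that] by (simp add: sshift_def sscal_def)
  have "mtmul \<kappa> (Rmat s \<sigma>) Y i j k l = (\<Sum>x\<in>{1..\<kappa>}\<times>{1..\<kappa>}.
      (if x = (i, k) then sshift 1 0 (Y i j k l) + sscal \<sigma> (sshift 0 1 (Y i j k l)) else 0)
      - (if x = (k, i) then sscal (psign s i k) (Y k j i l) else 0))"
    unfolding mtmul_def
  proof (rule sum.cong[OF refl])
    fix x :: "nat \<times> nat"
    obtain a c where x: "x = (a, c)" by (cases x)
    show "(case x of (a, c) \<Rightarrow> smul (Rmat s \<sigma> i a k c) (Y a j c l)) =
      (if x = (i, k) then sshift 1 0 (Y i j k l) + sscal \<sigma> (sshift 0 1 (Y i j k l)) else 0)
      - (if x = (k, i) then sscal (psign s i k) (Y k j i l) else 0)"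
      unfolding x Rmat_def prod.case smul_linear
    proof (rule arg_cong2[where f = minus])
      show "smul (if i = a \<and> k = c then smon 1 1 0 + smon \<sigma> 0 1 else 0) (Y a j c l) =
        (if (a, c) = (i, k) then sshift 1 0 (Y i j k l) + sscal \<sigma> (sshift 0 1 (Y i j k l)) else 0)"
      proof (cases "a = i \<and> c = k")
        case True
        then show ?thesis by (simp add: smul_linear smon)
      next
        case False
        then have "\<not> (i = a \<and> k = c)" "(a, c) \<noteq> (i, k)" by auto
        then show ?thesis by (simp only: if_False smul_zero)
      qed
      show "smul (if k = a \<and> c = i then smon (psign s i a) 0 0 else 0) (Y a j c l) =
        (if (a, c) = (k, i) then sscal (psign s i k) (Y k j i l) else 0)"
        by (cases "k = a \<and> c = i") (auto simp: smon)
    qed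
  qed
  then show ?thesis using assms(1,2) by (simp add: sum_subtractf)
qed

lemma mtmul_Rmat:
  assumes "j \<in> {1..\<kappa>}" "l \<in> {1..\<kappa>}" and Y: "\<And>a c. sdeg_le 3 (Y i a k c)"
  shows "mtmul \<kappa> Y (Rmat s \<sigma>) i j k l =
    sshift 1 0 (Y i j k l) + sscal \<sigma> (sshift 0 1 (Y i j k l)) - sscal (psign s j l) (Y i l k j)"
proof -
  have b: "bounded_ser (Y i a k c)" for a c
    unfolding bounded_ser_iff by (rule sdeg_le_mono[OF Y]) simp
  have smon: "smul (Y i a k d) (smon c p q) = sscal c (sshift p q (Y i a k d))" if "p \<le> 4" "q \<le> 4" for c p q a d
    using smul_smon_right[OF b that] by (simp add: sshift_def sscal_def)
  have "mtmul \<kappa> Y (Rmat s \<sigma>) i j k l = (\<Sum>x\<in>{1..\<kappa>}\<times>{1..\<kappa>}.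
      (if x = (j, l) then sshift 1 0 (Y i j k l) + sscal \<sigma> (sshift 0 1 (Y i j k l)) else 0)
      - (if x = (l, j) then sscal (psign s j l) (Y i l k j) else 0))"
    unfolding mtmul_def
  proof (rule sum.cong[OF refl])
    fix x :: "nat \<times> nat"
    obtain a c where x: "x = (a, c)" by (cases x)
    show "(case x of (a, c) \<Rightarrow> smul (Y i a k c) (Rmat s \<sigma> a j c l)) =
      (if x = (j, l) then sshift 1 0 (Y i j k l) + sscal \<sigma> (sshift 0 1 (Y i j k l)) else 0)
      - (if x = (l, j) then sscal (psign s j l) (Y i l k j) else 0)"
      unfolding x Rmat_def prod.case smul_linear
    proof (rule arg_cong2[where f = minus])
      show "smul (Y i a k c) (if a = j \<and> c = l then smon 1 1 0 + smon \<sigma> 0 1 else 0) =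
        (if (a, c) = (j, l) then sshift 1 0 (Y i j k l) + sscal \<sigma> (sshift 0 1 (Y i j k l)) else 0)"
      proof (cases "a = j \<and> c = l")
        case True
        then show ?thesis by (simp add: smul_linear smon)
      next
        case False
        then have "\<not> (a = j \<and> c = l)" "(a, c) \<noteq> (j, l)" by auto
        then show ?thesis by (simp only: if_False smul_zero)
      qed
      show "smul (Y i a k c) (if c = j \<and> l = a then smon (psign s a j) 0 0 else 0) =
        (if (a, c) = (l, j) then sscal (psign s j l) (Y i l k j) else 0)"
        by (cases "c = j \<and> l = a") (auto simp: smon psign_sym)
    qed
  qed
  then show ?thesis using assms(1,2) by (simp add: sum_subtractf)
qed

definition UV :: "nat \<Rightarrow> nat \<Rightarrow> nat \<Rightarrow> nat \<Rightarrow> ser" where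
  "UV i j k l = smul (bU \<epsilon> i j) (bV \<epsilon> k l)"
definition VU :: "nat \<Rightarrow> nat \<Rightarrow> nat \<Rightarrow> nat \<Rightarrow> ser" where
  "VU k l i j = smul (bV \<epsilon> k l) (bU \<epsilon> i j)"

text \<open>Choosing the scalar or the flip in each of the two R matrices gives the four terms. A
  sum over c, that is an entry of B(u)B(v), appears exactly when the flip of R(u + v) is taken,
  since it brings both matrices into the same tensor factor.\<close>

lemma refl_left:
  assumes "i \<in> {1..\<kappa>}" "j \<in> {1..\<kappa>}" "k \<in> {1..\<kappa>}" "l \<in> {1..\<kappa>}"
  shows "gauged s (tmul \<kappa> s (tmul \<kappa> s (tmul \<kappa> s (Rminus s) (B1 s \<epsilon>)) (Rplus s)) (B2 s \<epsilon>)) i j k l =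
    sscal (psign s k i * psign s k j) (sshift 2 0 (UV i j k l) - sshift 0 2 (UV i j k l))
    - sscal (psign s i j) (sshift 1 0 (UV k j i l) + sshift 0 1 (UV k j i l))
    - (if k = j then sscal (psign s i j) (\<Sum>c\<in>{1..\<kappa>}. sshift 1 0 (UV i c c l) - sshift 0 1 (UV i c c l)) else 0)
    + (if i = j then \<Sum>c\<in>{1..\<kappa>}. UV k c c l else 0)"
proof -
  define Q1 where "Q1 = (\<lambda>i j k l. (if k = l then sscal (psign s k i * psign s k j) (sshift 1 0 (bU \<epsilon> i j) - sshift 0 1 (bU \<epsilon> i j)) else 0)
     - (if i = l then sscal (psign s i j) (bU \<epsilon> k j) else 0))"
  have Q1: "gauged s (tmul \<kappa> s (Rminus s) (B1 s \<epsilon>)) i j k l = Q1 i j k l"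
    if "i \<in> {1..\<kappa>}" "j \<in> {1..\<kappa>}" "k \<in> {1..\<kappa>}" "l \<in> {1..\<kappa>}" for i j k l
  proof -
    have "gauged s (tmul \<kappa> s (Rminus s) (B1 s \<epsilon>)) i j k l = mtmul \<kappa> (Rmat s (-1)) (gauged s (B1 s \<epsilon>)) i j k l"
      unfolding gauged_tmul by (rule mtmul_cong) (simp add: gauged_R)
    also have "\<dots> = Q1 i j k l"
      by (subst Rmat_mtmul[OF that(1,3)])
        (auto simp: gauged_B1 Q1_def sdeg_le_simps sdeg_bU sscal_linear sscal_minus)
    finally show ?thesis .
  qed
  have deg1: "sdeg_le 1 (Q1 i j k l)" for i j k l
    unfolding Q1_def by (auto intro!: sdeg_le_simps sdeg_le_sshift[where d' = 0] sdeg_bU)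
  define Q2 where "Q2 = (\<lambda>i j k l. sshift 1 0 (Q1 i j k l) + sshift 0 1 (Q1 i j k l) - sscal (psign s j l) (Q1 i l k j))"
  have Q2: "gauged s (tmul \<kappa> s (tmul \<kappa> s (Rminus s) (B1 s \<epsilon>)) (Rplus s)) i j k l = Q2 i j k l"
    if "i \<in> {1..\<kappa>}" "j \<in> {1..\<kappa>}" "k \<in> {1..\<kappa>}" "l \<in> {1..\<kappa>}" for i j k l
  proof -
    have "gauged s (tmul \<kappa> s (tmul \<kappa> s (Rminus s) (B1 s \<epsilon>)) (Rplus s)) i j k l = mtmul \<kappa> Q1 (Rmat s 1) i j k l"
      unfolding gauged_tmul[of _ _ _ "Rplus s"] using that by (intro mtmul_cong) (simp add: gauged_R Q1)
    also have "\<dots> = Q2 i j k l"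
      by (subst mtmul_Rmat[OF that(2,4)]) (auto intro: sdeg_le_mono[OF deg1] simp: Q2_def)
    finally show ?thesis .
  qed
  have "gauged s (tmul \<kappa> s (tmul \<kappa> s (tmul \<kappa> s (Rminus s) (B1 s \<epsilon>)) (Rplus s)) (B2 s \<epsilon>)) i j k l =
     mtmul \<kappa> Q2 (\<lambda>i j k l. if i = j then bV \<epsilon> k l else 0) i j k l"
    unfolding gauged_tmul[of _ _ _ "B2 s \<epsilon>"] using assms by (intro mtmul_cong) (simp add: gauged_B2 Q2)
  also have "\<dots> = (\<Sum>c\<in>{1..\<kappa>}. smul (Q2 i j k c) (bV \<epsilon> c l))"
    using assms unfolding mtmul_def sum.cartesian_product[symmetric]
    by (subst sum.swap) (simp add: if_distrib[of "smul _"] cong: if_cong)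
  also have "\<dots> = (\<Sum>c\<in>{1..\<kappa>}.
      (if c = k then sscal (psign s k i * psign s k j) (sshift 2 0 (UV i j k l) - sshift 0 2 (UV i j k l)) else 0)
      - (if c = i then sscal (psign s i j) (sshift 1 0 (UV k j i l) + sshift 0 1 (UV k j i l)) else 0)
      - (if k = j then sscal (psign s i j) (sshift 1 0 (UV i c c l) - sshift 0 1 (UV i c c l)) else 0)
      + (if i = j then UV k c c l else 0))" 
  proof (rule sum.cong[OF refl])
    fix c assume c: "c \<in> {1..\<kappa>}"
    have *: "smul (sshift p q (bU \<epsilon> a b)) Y = sshift p q (smul (bU \<epsilon> a b) Y)" if "p \<in> {0,1,2}" "q \<in> {0,1,2}" for p q a b Y
      using that by (intro smul_sshift sdeg_bU) auto
    show "smul (Q2 i j k c) (bV \<epsilon> c l) = (if c = k then sscal (psign s k i * psign s k j) (sshift 2 0 (UV i j k l) - sshift 0 2 (UV i j k l)) else 0)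
      - (if c = i then sscal (psign s i j) (sshift 1 0 (UV k j i l) + sshift 0 1 (UV k j i l)) else 0)
      - (if k = j then sscal (psign s i j) (sshift 1 0 (UV i c c l) - sshift 0 1 (UV i c c l)) else 0)
      + (if i = j then UV k c c l else 0)"
      by (auto simp: Q2_def Q1_def UV_def sshift_linear smul_linear sscal_linear sscal_minus * psign_sym mult_ac)
  qed
  also have "\<dots> = sscal (psign s k i * psign s k j) (sshift 2 0 (UV i j k l) - sshift 0 2 (UV i j k l))
    - sscal (psign s i j) (sshift 1 0 (UV k j i l) + sshift 0 1 (UV k j i l))
    - (if k = j then sscal (psign s i j) (\<Sum>c\<in>{1..\<kappa>}. sshift 1 0 (UV i c c l) - sshift 0 1 (UV i c c l)) else 0)
    + (if i = j then \<Sum>c\<in>{1..\<kappa>}. UV k c c l else 0)"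
    using assms by (simp add: sum.distrib sum_subtractf sscal_linear)
  finally show ?thesis .
qed

lemma refl_right:
  assumes "i \<in> {1..\<kappa>}" "j \<in> {1..\<kappa>}" "k \<in> {1..\<kappa>}" "l \<in> {1..\<kappa>}"
  shows "gauged s (tmul \<kappa> s (tmul \<kappa> s (tmul \<kappa> s (B2 s \<epsilon>) (Rplus s)) (B1 s \<epsilon>)) (Rminus s)) i j k l =
    sscal (psign s l i * psign s l j) (sshift 2 0 (VU k l i j) - sshift 0 2 (VU k l i j))
    - sscal (psign s i j) (sshift 1 0 (VU k j i l) + sshift 0 1 (VU k j i l))
    - (if i = l then sscal (psign s i j) (\<Sum>c\<in>{1..\<kappa>}. sshift 1 0 (VU k c c j) - sshift 0 1 (VU k c c j)) else 0)
    + (if i = j then \<Sum>c\<in>{1..\<kappa>}. VU k c c l else 0)"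
proof -
  define Z1 where "Z1 = (\<lambda>i j k l. (if i = j then sshift 1 0 (bV \<epsilon> k l) + sshift 0 1 (bV \<epsilon> k l) else 0)
     - (if i = l then sscal (psign s j l) (bV \<epsilon> k j) else 0))"
  have Z1: "gauged s (tmul \<kappa> s (B2 s \<epsilon>) (Rplus s)) i j k l = Z1 i j k l"
    if "i \<in> {1..\<kappa>}" "j \<in> {1..\<kappa>}" "k \<in> {1..\<kappa>}" "l \<in> {1..\<kappa>}" for i j k l
  proof -
    have "gauged s (tmul \<kappa> s (B2 s \<epsilon>) (Rplus s)) i j k l = mtmul \<kappa> (gauged s (B2 s \<epsilon>)) (Rmat s 1) i j k l"
      unfolding gauged_tmul using that by (intro mtmul_cong) (simp add: gauged_R)
    also have "\<dots> = Z1 i j k l"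
      by (subst mtmul_Rmat[OF that(2,4)])
        (auto simp: gauged_B2 Z1_def sdeg_le_simps sdeg_bV sscal_linear sscal_minus)
    finally show ?thesis .
  qed
  define Z2 where "Z2 = (\<lambda>i j k l. sscal (psign s l i * psign s l j) (sshift 1 0 (VU k l i j) + sshift 0 1 (VU k l i j))
     - (if i = l then sscal (psign s l j) (\<Sum>c\<in>{1..\<kappa>}. VU k c c j) else 0))"
  have Z2: "gauged s (tmul \<kappa> s (tmul \<kappa> s (B2 s \<epsilon>) (Rplus s)) (B1 s \<epsilon>)) i j k l = Z2 i j k l"
    if ijkl: "i \<in> {1..\<kappa>}" "j \<in> {1..\<kappa>}" "k \<in> {1..\<kappa>}" "l \<in> {1..\<kappa>}" for i j k l
  proof -
    have "gauged s (tmul \<kappa> s (tmul \<kappa> s (B2 s \<epsilon>) (Rplus s)) (B1 s \<epsilon>)) i j k l =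
        mtmul \<kappa> Z1 (\<lambda>i j k l. if k = l then sscal (psign s k i * psign s k j) (bU \<epsilon> i j) else 0) i j k l"
      unfolding gauged_tmul[of _ _ _ "B1 s \<epsilon>"] using that by (intro mtmul_cong) (simp add: gauged_B1 Z1)
    also have "\<dots> = (\<Sum>a\<in>{1..\<kappa>}. smul (Z1 i a k l) (sscal (psign s l a * psign s l j) (bU \<epsilon> a j)))"
      using ijkl unfolding mtmul_def sum.cartesian_product[symmetric]
      by (simp add: if_distrib[of "smul _"] cong: if_cong)
    also have "\<dots> = (\<Sum>a\<in>{1..\<kappa>}. (if a = i then sscal (psign s l i * psign s l j) (sshift 1 0 (VU k l i j) + sshift 0 1 (VU k l i j)) else 0)
       - (if i = l then sscal (psign s l j) (VU k a a j) else 0))"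
    proof (rule sum.cong[OF refl])
      fix a assume "a \<in> {1..\<kappa>}"
      have *: "smul (sshift p q (bV \<epsilon> a b)) Y = sshift p q (smul (bV \<epsilon> a b) Y)" if "p \<in> {0,1,2}" "q \<in> {0,1,2}" for p q a b Y
        using that by (intro smul_sshift sdeg_bV) auto
      show "smul (Z1 i a k l) (sscal (psign s l a * psign s l j) (bU \<epsilon> a j)) =
        (if a = i then sscal (psign s l i * psign s l j) (sshift 1 0 (VU k l i j) + sshift 0 1 (VU k l i j)) else 0)
       - (if i = l then sscal (psign s l j) (VU k a a j) else 0)"
        by (auto simp: Z1_def VU_def sshift_linear smul_linear sscal_linear sscal_minus * psign_sym mult_ac)
    qed
    also have "\<dots> = Z2 i j k l"
      using that by (simp add: Z2_def sum_subtractf sscal_linear)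
    finally show ?thesis .
  qed
  have deg2: "sdeg_le 1 (Z2 i j k l)" for i j k l
  proof -
    have "sdeg_le 0 (VU k l i j)" for k l i j
      by (auto simp: sdeg_le_def VU_def smul_bV_bU bcoef_pos)
    moreover from this have "sdeg_le 1 (VU k l i j)" for k l i j
      by (rule sdeg_le_mono) simp
    ultimately show ?thesis
      unfolding Z2_def by (auto intro!: sdeg_le_simps sdeg_le_sshift[where d' = 0])
  qed
  have "gauged s (tmul \<kappa> s (tmul \<kappa> s (tmul \<kappa> s (B2 s \<epsilon>) (Rplus s)) (B1 s \<epsilon>)) (Rminus s)) i j k l =
     mtmul \<kappa> Z2 (Rmat s (-1)) i j k l"
    unfolding gauged_tmul[of _ _ _ "Rminus s"] using assms by (intro mtmul_cong) (simp add: gauged_R Z2)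
  also have "\<dots> = sshift 1 0 (Z2 i j k l) + sscal (-1) (sshift 0 1 (Z2 i j k l)) - sscal (psign s j l) (Z2 i l k j)"
    by (rule mtmul_Rmat[OF assms(2,4)]) (rule sdeg_le_mono[OF deg2], simp)
  also have "\<dots> = sscal (psign s l i * psign s l j) (sshift 2 0 (VU k l i j) - sshift 0 2 (VU k l i j))
    - sscal (psign s i j) (sshift 1 0 (VU k j i l) + sshift 0 1 (VU k j i l))
    - (if i = l then sscal (psign s i j) (\<Sum>c\<in>{1..\<kappa>}. sshift 1 0 (VU k c c j) - sshift 0 1 (VU k c c j)) else 0)
    + (if i = j then \<Sum>c\<in>{1..\<kappa>}. VU k c c l else 0)"
    by (auto simp: Z2_def sshift_linear sscal_linear sscal_minus sum_subtractf psign_sym mult_ac)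
  finally show ?thesis .
qed

end

definition bb :: "(nat \<Rightarrow> int) \<Rightarrow> nat \<Rightarrow> nat \<Rightarrow> nat \<Rightarrow> nat \<Rightarrow> int \<Rightarrow> int \<Rightarrow> falg" where
  "bb \<epsilon> i j k l m n = fmul (bcoef \<epsilon> i j m) (bcoef \<epsilon> k l n)"

text \<open>The four parts are the coefficients of \<open>u\<^sup>2 - v\<^sup>2\<close>, \<open>u + v\<close>, \<open>u - v\<close> and \<open>1\<close> in the
  (gauged) reflection relation.\<close>

definition comp_rel :: "nat \<Rightarrow> (nat \<Rightarrow> int) \<Rightarrow> (nat \<Rightarrow> int) \<Rightarrow> nat \<Rightarrow> nat \<Rightarrow> nat \<Rightarrow> nat \<Rightarrow> int \<Rightarrow> int \<Rightarrow> falg" where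
  "comp_rel \<kappa> s \<epsilon> i j k l m n =
    (let G1 = (\<lambda>m n. fscal (psign s k i * psign s k j) (bb \<epsilon> i j k l m n) - fscal (psign s l i * psign s l j) (bb \<epsilon> k l i j n m));
         G2 = (\<lambda>m n. fscal (psign s i j) (bb \<epsilon> k j i l m n - bb \<epsilon> k j i l n m));
         G3 = (\<lambda>m n. (if k = j then fscal (psign s i j) (\<Sum>c\<in>{1..\<kappa>}. bb \<epsilon> i c c l m n) else 0)
                 - (if i = l then fscal (psign s i j) (\<Sum>c\<in>{1..\<kappa>}. bb \<epsilon> k c c j n m) else 0));
         G4 = (\<lambda>m n. if i = j then (\<Sum>c\<in>{1..\<kappa>}. bb \<epsilon> k c c l m n) - (\<Sum>c\<in>{1..\<kappa>}. bb \<epsilon> k c c l n m) else 0)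
     in G1 (m - 2) n - G1 m (n - 2) - (G2 (m - 1) n + G2 m (n - 1)) - (G3 (m - 1) n - G3 m (n - 1)) + G4 m n)"

text \<open>The gauge factor is a sign, so a functional or a representation kills the original
  relation exactly when it kills the sign-free one.\<close>

lemma refl_rel_comp:
  assumes s: "\<forall>i\<in>{1..\<kappa>}. s i = 1 \<or> s i = -1"
    and ijkl: "i \<in> {1..\<kappa>}" "j \<in> {1..\<kappa>}" "k \<in> {1..\<kappa>}" "l \<in> {1..\<kappa>}"
  shows "refl_rel \<kappa> s \<epsilon> i j k l m n = fscal (gauge s i j k l) (comp_rel \<kappa> s \<epsilon> i j k l m n)"
proof -
  have UV: "UV \<epsilon> i j k l m n = bb \<epsilon> i j k l m n" "VU \<epsilon> k l i j m n = bb \<epsilon> k l i j n m" for i j k l m n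
    by (simp_all add: UV_def[OF s] VU_def[OF s] smul_bU_bV smul_bV_bU bb_def)
  have ser_apply: "(X + Y) m n = X m n + Y m n" "(X - Y) m n = X m n - Y m n" "(0 :: ser) m n = 0" for X Y :: ser and m n
    by (simp_all add: fun_eq_iff)
  have tmat_apply: "(X - Y) i j k l = X i j k l - Y i j k l" for X Y :: tmat
    by (simp add: fun_eq_iff)
  have ite: "(if P then X else (0 :: ser)) m n = (if P then X m n else 0)" for P X m n
    by simp
  have "fscal (gauge s i j k l) (refl_rel \<kappa> s \<epsilon> i j k l m n) = gauged s (refl_rel \<kappa> s \<epsilon>) i j k l m n"
    by (simp add: gauged_def sscal_def)
  also have "\<dots> = comp_rel \<kappa> s \<epsilon> i j k l m n"
    unfolding refl_rel_def gauged_tsub tmat_apply refl_left[OF s ijkl] refl_right[OF s ijkl] comp_rel_def Let_def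
      ser_apply ite sscal_def sshift_def sum_ser_apply UV
    by (simp add: fscal_linear sum_subtractf algebra_simps)
  finally show ?thesis
    using gauge_square[of s i j k l] by (metis fscal_simps(3,4))
qed

text \<open>The sign comes from B(-u): the second factor has exponent m - t, so replacing u by -u
  gives (-1)^(t - m). For t outside {m..0} one of the two exponents is positive and the term is
  absent.\<close>

definition unit_comp :: "nat \<Rightarrow> (nat \<Rightarrow> int) \<Rightarrow> nat \<Rightarrow> nat \<Rightarrow> int \<Rightarrow> falg" where
  "unit_comp \<kappa> \<epsilon> i j m =
     (\<Sum>a\<in>{1..\<kappa>}. \<Sum>t\<in>{m..0}. fscal ((-1) ^ nat (t - m)) (bb \<epsilon> i a a j t (m - t)))
     - (if i = j \<and> m = 0 then fone else 0)"

lemma smul_bU_bUneg: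
  "smul (bU \<epsilon> i a) (bUneg \<epsilon> a j) m n =
    (if n = 0 then \<Sum>t\<in>{m..0}. fscal ((-1) ^ nat (t - m)) (bb \<epsilon> i a a j t (m - t)) else 0)"
proof -
  have "smul (bU \<epsilon> i a) (bUneg \<epsilon> a j) m n =
     (\<Sum>t\<in>{m-4..4}. \<Sum>r\<in>{n-4..4}. if r = 0 then
        (if n = 0 then fscal ((-1) ^ nat (t - m)) (bb \<epsilon> i a a j t (m - t)) else 0) else 0)"
    unfolding smul_def fops ser_win_def sum.cartesian_product[symmetric]
    by (intro sum.cong refl) (auto simp: bU_bcoef bUneg_def bb_def)
  also have "\<dots> = (\<Sum>t\<in>{m-4..4}. if n = 0 then fscal ((-1) ^ nat (t - m)) (bb \<epsilon> i a a j t (m - t)) else 0)"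
    by (intro sum.cong refl) auto
  also have "\<dots> = (\<Sum>t\<in>{m..0}. if n = 0 then fscal ((-1) ^ nat (t - m)) (bb \<epsilon> i a a j t (m - t)) else 0)"
    by (intro sum.mono_neutral_right) (auto simp: bb_def bcoef_pos)
  finally show ?thesis by simp
qed

lemma unit_rel_comp:
  assumes s: "\<forall>i\<in>{1..\<kappa>}. s i = 1 \<or> s i = -1"
    and ijkl: "i \<in> {1..\<kappa>}" "j \<in> {1..\<kappa>}" "k \<in> {1..\<kappa>}" "l \<in> {1..\<kappa>}"
  shows "unit_rel \<kappa> s \<epsilon> i j k l m n =
    (if k = l \<and> n = 0 then fscal (gauge s i j k l * (psign s k i * psign s k j)) (unit_comp \<kappa> \<epsilon> i j m) else 0)"
proof -
  have B1neg: "gauged s (B1neg s \<epsilon>) = (\<lambda>i j k l. if k = l then sscal (psign s k i * psign s k j) (bUneg \<epsilon> i j) else 0)"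
    by (auto simp: gauged_def B1neg_def sops fun_eq_iff gauge_diag[OF s])
  have e: "psign s k i * psign s k a * (psign s k a * psign s k j) = psign s k i * psign s k j" for a
    by (metis mult.assoc psign_square(1) mult_1_left)
  have "gauged s (tmul \<kappa> s (B1 s \<epsilon>) (B1neg s \<epsilon>)) i j k l =
     (\<Sum>a\<in>{1..\<kappa>}. \<Sum>c\<in>{1..\<kappa>}. if c = k then
        (if k = l then sscal (psign s k i * psign s k j) (smul (bU \<epsilon> i a) (bUneg \<epsilon> a j)) else 0) else 0)"
    unfolding gauged_tmul mtmul_def gauged_B1[OF s] B1neg sum.cartesian_product[symmetric]
    by (intro sum.cong refl) (use e in \<open>auto simp: mult_ac\<close>)
  also have "\<dots> = (if k = l then sscal (psign s k i * psign s k j) (\<Sum>a\<in>{1..\<kappa>}. smul (bU \<epsilon> i a) (bUneg \<epsilon> a j)) else 0)"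
    using ijkl by (simp add: sscal_linear)
  finally have prod: "gauged s (tmul \<kappa> s (B1 s \<epsilon>) (B1neg s \<epsilon>)) i j k l = \<dots>" .
  have tid: "gauged s tid i j k l m n = (if k = l \<and> n = 0 then fscal (psign s k i * psign s k j) (if i = j \<and> m = 0 then fone else 0) else 0)"
    by (auto simp: gauged_def tid_def sops gauge_diag[OF s] smon_def fops)
  have "fscal (gauge s i j k l) (unit_rel \<kappa> s \<epsilon> i j k l m n) = gauged s (unit_rel \<kappa> s \<epsilon>) i j k l m n"
    by (simp add: gauged_def sscal_def)
  also have "\<dots> = gauged s (tmul \<kappa> s (B1 s \<epsilon>) (B1neg s \<epsilon>)) i j k l m n - gauged s tid i j k l m n"
    unfolding unit_rel_def gauged_tsub by (simp add: fun_eq_iff)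
  also have "\<dots> = (if k = l \<and> n = 0 then fscal (psign s k i * psign s k j) (unit_comp \<kappa> \<epsilon> i j m) else 0)"
    unfolding prod tid unit_comp_def
    by (auto simp: sscal_def sum_ser_apply smul_bU_bUneg fscal_linear)
  finally have *: "fscal (gauge s i j k l) (unit_rel \<kappa> s \<epsilon> i j k l m n) =
    (if k = l \<and> n = 0 then fscal (psign s k i * psign s k j) (unit_comp \<kappa> \<epsilon> i j m) else 0)" .
  have "unit_rel \<kappa> s \<epsilon> i j k l m n = fscal (gauge s i j k l) (fscal (gauge s i j k l) (unit_rel \<kappa> s \<epsilon> i j k l m n))"
    by (simp add: gauge_square)
  then show ?thesis unfolding * by (auto simp: mult_ac)
qed

subsection \<open>A functional that detects non-membership in a left ideal\<close>

lemma left_ideal_fscal: "x \<in> left_ideal \<kappa> G \<Longrightarrow> fscal c x \<in> left_ideal \<kappa> G"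
  using left_ideal.lmul[of x \<kappa> G "[]" c] by (simp add: fmul_fmon_nil)

text \<open>Linear algebra over the complex numbers suffices: a basis of the ideal stays independent
  when \<open>fone\<close> is added, and the functional reads off the coordinate of
  \<open>fone\<close>. It stands in for the coefficient of the highest weight vector in the quotient
  module.\<close>

lemma left_ideal_functional:
  assumes "fone \<notin> left_ideal \<kappa> G"
  obtains \<phi> :: "falg \<Rightarrow> complex" where
    "\<And>x y. \<phi> (x + y) = \<phi> x + \<phi> y" "\<And>c x. \<phi> (fscal c x) = c * \<phi> x"
    "\<And>x. x \<in> left_ideal \<kappa> G \<Longrightarrow> \<phi> x = 0" "\<phi> fone = 1"
proof -
  interpret vector_space_pair fscal "(*) :: complex \<Rightarrow> _ \<Rightarrow> _"
    by unfold_locales (auto simp: fscal_def fun_eq_iff algebra_simps)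
  obtain B where B: "B \<subseteq> left_ideal \<kappa> G" "vs1.independent B" "left_ideal \<kappa> G \<subseteq> vs1.span B"
    by (rule vs1.maximal_independent_subset)
  have "vs1.span B \<subseteq> left_ideal \<kappa> G"
  proof (rule vs1.span_minimal[OF B(1)])
    show "vs1.subspace (left_ideal \<kappa> G)"
      unfolding vs1.subspace_def using left_ideal.zero left_ideal.add left_ideal_fscal
      by (metis fops(1,2))
  qed
  with assms have fone: "fone \<notin> vs1.span B" by blast
  have ind: "vs1.independent (insert fone B)"
    by (rule vs1.independent_insertI[OF fone B(2)])
  define \<phi> where "\<phi> = construct (insert fone B) (\<lambda>x. if x = fone then 1 else 0)"
  interpret l: Vector_Spaces.linear fscal "(*) :: complex \<Rightarrow> _ \<Rightarrow> _" \<phi>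
    unfolding \<phi>_def by (rule linear_construct[OF ind])
  have zero: "\<phi> x = 0" if "x \<in> vs1.span B" for x
  proof (rule l.eq_0_on_span[OF _ that])
    fix b assume "b \<in> B"
    moreover from this fone have "b \<noteq> fone" using vs1.span_base by metis
    ultimately show "\<phi> b = 0" unfolding \<phi>_def by (subst construct_basis[OF ind]) auto
  qed
  show thesis
  proof (rule that)
    show "\<phi> fone = 1" unfolding \<phi>_def by (subst construct_basis[OF ind]) auto
    show "x \<in> left_ideal \<kappa> G \<Longrightarrow> \<phi> x = 0" for x using B(3) zero by blast
  qed (rule l.add l.scale)+
qed

subsection \<open>Formal series in two commuting variables\<close>

text \<open>A series in \<open>X = u\<^sup>-\<^sup>1\<close> and \<open>Y = v\<^sup>-\<^sup>1\<close> is a power series in \<open>Y\<close> whose coefficients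
  are power series in \<open>X\<close>.\<close>

definition ser2 :: "(int \<Rightarrow> int \<Rightarrow> 'a) \<Rightarrow> 'a fps fps" where
  "ser2 G = Abs_fps (\<lambda>q. Abs_fps (\<lambda>p. G (- int p) (- int q)))"

definition XY :: "nat \<Rightarrow> nat \<Rightarrow> 'a::ring_1 fps fps" where
  "XY a b = fps_const (fps_X ^ a) * fps_X ^ b"

lemma ser2_nth [simp]: "ser2 G $ q $ p = G (- int p) (- int q)"
  by (simp add: ser2_def)

lemma ser2_linear: "ser2 (\<lambda>m n. F m n + G m n) = ser2 F + ser2 G"
  "ser2 (\<lambda>m n. F m n - G m n) = ser2 F - ser2 G" for F G :: "int \<Rightarrow> int \<Rightarrow> 'a::ring_1"
  by (simp_all add: fps_eq_iff)

lemma ser2_sum: "ser2 (\<lambda>m n. \<Sum>a\<in>A. F a m n) = (\<Sum>a\<in>A. ser2 (F a))" for F :: "_ \<Rightarrow> int \<Rightarrow> int \<Rightarrow> 'a::ring_1"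
  by (simp add: fps_eq_iff fps_sum_nth)

lemma ser2_scale: "ser2 (\<lambda>m n. c * F m n) = fps_const (fps_const c) * ser2 F" for F :: "int \<Rightarrow> int \<Rightarrow> 'a::ring_1"
  by (simp add: fps_eq_iff)

lemma XY_mult_nth: "(XY a b * F) $ q $ p = (if a \<le> p \<and> b \<le> q then F $ (q - b) $ (p - a) else 0)"
  for F :: "'a::ring_1 fps fps"
  unfolding XY_def mult.assoc by (simp add: fps_X_power_mult_nth not_less not_le)

lemma XY_mult_ser2_nth:
  fixes G :: "int \<Rightarrow> int \<Rightarrow> 'a::ring_1"
  assumes "\<And>m n. m > 0 \<or> n > 0 \<Longrightarrow> G m n = 0"
  shows "(XY a b * ser2 G) $ q $ p = G (int a - int p) (int b - int q)"
  using assms by (auto simp: XY_mult_nth of_nat_diff)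

text \<open>Multiplying by X^2 Y^2 clears the positive powers: u^2 becomes Y^2, u + v becomes X Y^2
  + X^2 Y, and so on. Exponents above 2 contribute nothing, so all coefficient identities together
  are one identity of power series.\<close>

lemma ser2_relation:
  fixes G1 G2 G3 G4 :: "int \<Rightarrow> int \<Rightarrow> 'a::ring_1"
  assumes "\<And>m n. m > 0 \<or> n > 0 \<Longrightarrow> G1 m n = 0" "\<And>m n. m > 0 \<or> n > 0 \<Longrightarrow> G2 m n = 0"
    "\<And>m n. m > 0 \<or> n > 0 \<Longrightarrow> G3 m n = 0" "\<And>m n. m > 0 \<or> n > 0 \<Longrightarrow> G4 m n = 0"
  shows "(\<forall>m n. G1 (m - 2) n - G1 m (n - 2) - (G2 (m - 1) n + G2 m (n - 1)) - (G3 (m - 1) n - G3 m (n - 1)) + G4 m n = 0)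
    \<longleftrightarrow> XY 0 2 * ser2 G1 - XY 2 0 * ser2 G1 - (XY 1 2 * ser2 G2 + XY 2 1 * ser2 G2)
      - (XY 1 2 * ser2 G3 - XY 2 1 * ser2 G3) + XY 2 2 * ser2 G4 = 0" (is "?L \<longleftrightarrow> ?R = 0")
proof -
  have nth: "?R $ q $ p = G1 (- int p) (2 - int q) - G1 (2 - int p) (- int q)
      - (G2 (1 - int p) (2 - int q) + G2 (2 - int p) (1 - int q))
      - (G3 (1 - int p) (2 - int q) - G3 (2 - int p) (1 - int q)) + G4 (2 - int p) (2 - int q)" for p q
    unfolding fps_add_nth fps_sub_nth by (simp only: XY_mult_ser2_nth[OF assms(1)] XY_mult_ser2_nth[OF assms(2)]
      XY_mult_ser2_nth[OF assms(3)] XY_mult_ser2_nth[OF assms(4)]) simp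
  show ?thesis
  proof
    assume L: ?L
    show "?R = 0"
    proof (rule fps_ext, rule fps_ext)
      fix q p
      show "?R $ q $ p = 0 $ q $ p"
        unfolding nth using L[rule_format, of "2 - int p" "2 - int q"] by simp
    qed
  next
    assume R: "?R = 0"
    show ?L
    proof (intro allI)
      fix m n
      show "G1 (m - 2) n - G1 m (n - 2) - (G2 (m - 1) n + G2 m (n - 1)) - (G3 (m - 1) n - G3 m (n - 1)) + G4 m n = 0"
      proof (cases "m \<le> 2 \<and> n \<le> 2")
        case True
        then show ?thesis using nth[of "nat (2 - n)" "nat (2 - m)"] unfolding R by simp
      next
        case False
        then have "m > 2 \<or> n > 2" by auto
        then show ?thesis by (auto simp: assms)
      qed
    qed
  qed
qed

subsection \<open>Substitution of a series without constant term for the second variable\<close>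

text \<open>The value of F at Y = \<sigma>(X). Stopping the sum at N loses nothing in degree N when
  \<sigma> has no constant term, because \<sigma>^n then starts in degree n or later.\<close>

definition subst2 :: "'a::comm_ring_1 fps \<Rightarrow> 'a fps fps \<Rightarrow> 'a fps" where
  "subst2 \<sigma> F = Abs_fps (\<lambda>N. \<Sum>n\<le>N. (F $ n * \<sigma> ^ n) $ N)"

context
  fixes \<sigma> :: "'a::comm_ring_1 fps"
  assumes \<sigma>0: "\<sigma> $ 0 = 0"
begin

lemma power_nth_low: "N < n \<Longrightarrow> (f * \<sigma> ^ n) $ N = 0"
proof -
  define g where "g = fps_shift 1 \<sigma>"
  have g: "\<sigma> = fps_X * g"
    by (rule fps_ext) (auto simp: g_def \<sigma>0)
  have "f * \<sigma> ^ n = fps_X ^ n * (f * g ^ n)"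
    unfolding g power_mult_distrib by (rule mult.left_commute)
  moreover assume "N < n"
  ultimately show ?thesis
    by (simp add: fps_X_power_mult_nth)
qed

lemma subst2_nth: "N \<le> M \<Longrightarrow> subst2 \<sigma> F $ N = (\<Sum>n\<le>M. (F $ n * \<sigma> ^ n) $ N)"
  unfolding subst2_def by (simp, intro sum.mono_neutral_left) (auto simp: power_nth_low)

lemma subst2_linear: "subst2 \<sigma> (F + G) = subst2 \<sigma> F + subst2 \<sigma> G" "subst2 \<sigma> (F - G) = subst2 \<sigma> F - subst2 \<sigma> G"
  by (simp_all add: subst2_def fps_eq_iff algebra_simps sum.distrib sum_subtractf)

lemma subst2_0 [simp]: "subst2 \<sigma> 0 = 0" by (simp add: subst2_def fps_eq_iff)

lemma subst2_sum: "subst2 \<sigma> (sum F A) = (\<Sum>a\<in>A. subst2 \<sigma> (F a))"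
  by (induction A rule: infinite_finite_induct) (auto simp: subst2_linear)

text \<open>Together with the rule for \<open>fps_X\<close> this pulls out every polynomial in X and
  Y, and the later computations pull out only such factors; genuine products f(X) g(Y) are treated
  by \<open>subst2_separated\<close>.\<close>

lemma subst2_const_mult: "subst2 \<sigma> (fps_const f * F) = f * subst2 \<sigma> F"
proof (rule fps_ext)
  fix N
  have "subst2 \<sigma> (fps_const f * F) $ N = (\<Sum>n\<le>N. \<Sum>i=0..N. f $ i * (F $ n * \<sigma> ^ n) $ (N - i))"
    unfolding subst2_def by (simp add: mult.assoc fps_mult_nth[of f])
  also have "\<dots> = (\<Sum>i=0..N. f $ i * subst2 \<sigma> F $ (N - i))"
    by (subst sum.swap) (auto intro!: sum.cong simp: subst2_nth[of _ N] sum_distrib_left)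
  finally show "subst2 \<sigma> (fps_const f * F) $ N = (f * subst2 \<sigma> F) $ N" by (simp add: fps_mult_nth)
qed

lemma subst2_X_mult: "subst2 \<sigma> (fps_X * F) = \<sigma> * subst2 \<sigma> F"
proof (rule fps_ext)
  fix N
  have "subst2 \<sigma> (fps_X * F) $ N = (\<Sum>n\<le>Suc N. ((fps_X * F) $ n * \<sigma> ^ n) $ N)"
    by (rule subst2_nth) simp
  also have "\<dots> = (\<Sum>n\<le>N. (\<sigma> * (F $ n * \<sigma> ^ n)) $ N)"
    by (subst sum.atMost_Suc_shift) (simp add: mult_ac)
  also have "\<dots> = (\<Sum>i=0..N. \<sigma> $ i * (\<Sum>n\<le>N. (F $ n * \<sigma> ^ n) $ (N - i)))"
    unfolding fps_mult_nth[of \<sigma>] sum_distrib_left by (rule sum.swap)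
  also have "\<dots> = (\<sigma> * subst2 \<sigma> F) $ N"
    unfolding fps_mult_nth[of \<sigma>] by (auto intro!: sum.cong simp: subst2_nth[of _ N])
  finally show "subst2 \<sigma> (fps_X * F) $ N = (\<sigma> * subst2 \<sigma> F) $ N" .
qed

end

lemma subst2_separated:
  "subst2 \<sigma> (Abs_fps (\<lambda>q. fps_const (g $ q) * f)) = f * (g oo \<sigma>)" if "\<sigma> $ 0 = 0"
proof (rule fps_ext)
  fix N
  have "subst2 \<sigma> (Abs_fps (\<lambda>q. fps_const (g $ q) * f)) $ N = (\<Sum>n\<le>N. \<Sum>i=0..N. f $ i * (g $ n * \<sigma> ^ n $ (N - i)))"
    unfolding subst2_def by (simp add: mult.assoc fps_mult_nth[of f] sum_distrib_left mult.left_commute)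
  also have "\<dots> = (\<Sum>i=0..N. f $ i * (\<Sum>n\<le>N. g $ n * \<sigma> ^ n $ (N - i)))"
    unfolding sum_distrib_left by (rule sum.swap)
  also have "\<dots> = (f * (g oo \<sigma>)) $ N"
    unfolding fps_mult_nth[of f] fps_compose_nth
    by (intro sum.cong refl arg_cong2[where f = "(*)"] sum.mono_neutral_right)
      (use power_nth_low[OF that, of _ _ 1] in auto)
  finally show "subst2 \<sigma> (Abs_fps (\<lambda>q. fps_const (g $ q) * f)) $ N = (f * (g oo \<sigma>)) $ N" .
qed

subsection \<open>Necessity\<close>

definition mcoef :: "(nat \<Rightarrow> complex fps) \<Rightarrow> nat \<Rightarrow> int \<Rightarrow> complex" where
  "mcoef \<mu> i t = (if t \<le> 0 then \<mu> i $ nat (- t) else 0)"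

lemma bcoef_fmon:
  assumes "i \<in> {1..\<kappa>}" "j \<in> {1..\<kappa>}"
  obtains c w where "bcoef \<epsilon> i j t = fmon c w" "list_all (valid_gen \<kappa>) w"
proof -
  have zero: "(0 :: falg) = fmon 0 []" by (auto simp: fmon_def fun_eq_iff)
  consider "t > 0" | "t = 0" | "t < 0" by linarith
  then show thesis
  proof cases
    case 1
    then show thesis using that[of 0 "[]"] by (simp add: bcoef_pos zero)
  next
    case 2
    then show thesis
      using that[of "if i = j then of_int (\<epsilon> i) else 0" "[]"]
      by (auto simp: bcoef_def bU_def fops fone_fmon fscal_fmon zero split: if_splits)
  next
    case 3
    then show thesis
      using that[of 1 "[(i, j, nat (- t))]"] assms
      by (auto simp: bcoef_def bU_def fgen_fmon valid_gen_def)
  qed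
qed

text \<open>The left ideal absorbs words on the left, so \<phi> sees the rightmost letter first, as
  if it acted on the highest weight vector. For two letters this gives zero when the right one is
  raising, and a product of weights when both are diagonal.\<close>

lemma verma_functional:
  assumes s: "\<forall>i\<in>{1..\<kappa>}. s i = 1 \<or> s i = -1"
    and mu0: "\<forall>i\<in>{1..\<kappa>}. \<mu> i $ 0 = of_int (\<epsilon> i)"
    and nt: "verma_nontrivial \<kappa> s \<epsilon> \<mu>"
  obtains \<phi> :: "falg \<Rightarrow> complex" where
    "\<And>x y. \<phi> (x + y) = \<phi> x + \<phi> y" "\<And>c x. \<phi> (fscal c x) = c * \<phi> x" "\<phi> fone = 1"
    "\<And>i j k l m n. \<lbrakk>i \<in> {1..\<kappa>}; j \<in> {1..\<kappa>}; k \<in> {1..\<kappa>}; l \<in> {1..\<kappa>}; k < l\<rbrakk> \<Longrightarrow> \<phi> (bb \<epsilon> i j k l m n) = 0"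
    "\<And>i k m n. \<lbrakk>i \<in> {1..\<kappa>}; k \<in> {1..\<kappa>}\<rbrakk> \<Longrightarrow> \<phi> (bb \<epsilon> i i k k m n) = mcoef \<mu> i m * mcoef \<mu> k n"
    "\<And>i j k l m n. \<lbrakk>i \<in> {1..\<kappa>}; j \<in> {1..\<kappa>}; k \<in> {1..\<kappa>}; l \<in> {1..\<kappa>}\<rbrakk> \<Longrightarrow> \<phi> (comp_rel \<kappa> s \<epsilon> i j k l m n) = 0"
    "\<And>i j m. \<lbrakk>i \<in> {1..\<kappa>}; j \<in> {1..\<kappa>}\<rbrakk> \<Longrightarrow> \<phi> (unit_comp \<kappa> \<epsilon> i j m) = 0"
proof -
  let ?L = "left_ideal \<kappa> (two_sided_ideal \<kappa> (defining_rels \<kappa> s \<epsilon>) \<union> verma_gens \<kappa> \<epsilon> \<mu>)"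
  from nt have "fone \<notin> ?L" by (simp add: verma_nontrivial_def)
  then obtain \<phi> :: "falg \<Rightarrow> complex" where \<phi>: "\<And>x y. \<phi> (x + y) = \<phi> x + \<phi> y" "\<And>c x. \<phi> (fscal c x) = c * \<phi> x"
    "\<And>x. x \<in> ?L \<Longrightarrow> \<phi> x = 0" "\<phi> fone = 1"
    using left_ideal_functional by blast
  have \<phi>0: "\<phi> 0 = 0" using \<phi>(2)[of 0 0] by simp
  have \<phi>diff: "\<phi> (x - y) = \<phi> x - \<phi> y" for x y
    using \<phi>(1)[of "x - y" y] by simp
  have rel: "x \<in> ?L" if "x \<in> defining_rels \<kappa> s \<epsilon>" for x
    using that by (intro left_ideal.gen UnI1 two_sided_ideal.gen)
  have vg: "\<phi> (fmul (fmon c w) x) = 0" if "x \<in> verma_gens \<kappa> \<epsilon> \<mu>" "list_all (valid_gen \<kappa>) w" for c w x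
    using that by (intro \<phi>(3) left_ideal.lmul left_ideal.gen UnI2)
  have up: "\<phi> (fmul (fmon c w) (bcoef \<epsilon> k l n)) = 0"
    if w: "list_all (valid_gen \<kappa>) w" and kl: "k \<in> {1..\<kappa>}" "l \<in> {1..\<kappa>}" "k < l" for c w k l n
  proof (cases "n < 0")
    case True
    have "fgen (k, l, nat (- n)) \<in> verma_gens \<kappa> \<epsilon> \<mu>"
    proof -
      have "1 \<le> k" "l \<le> \<kappa>" "1 \<le> nat (- n)" using kl True by auto
      then show ?thesis using kl(3) unfolding verma_gens_def by blast
    qed
    from vg[OF this w, of c] show ?thesis using True by (simp add: bcoef_def bU_def)
  next
    case False
    \<comment> \<open>For n = 0 the coefficient is a Kronecker delta times a sign, which vanishes
      off the diagonal.\<close>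
    then have "bcoef \<epsilon> k l n = 0" using kl by (auto simp: bcoef_def bU_def fops)
    then show ?thesis by (simp add: \<phi>0)
  qed
  have diag: "\<phi> (fmul (fmon c w) (bcoef \<epsilon> k k n)) = mcoef \<mu> k n * \<phi> (fmon c w)"
    if w: "list_all (valid_gen \<kappa>) w" and k: "k \<in> {1..\<kappa>}" for c w k n
  proof -
    consider "n > 0" | "n = 0" | "n < 0" by linarith
    then show ?thesis
    proof cases
      case 1
      then show ?thesis by (simp add: bcoef_pos mcoef_def \<phi>0)
    next
      case 2
      then show ?thesis using mu0 k by (simp add: bcoef_def bU_def mcoef_def \<phi>(2))
    next
      case 3
      then have "fsub (fgen (k, k, nat (- n))) (fscal (\<mu> k $ nat (- n)) fone) \<in> verma_gens \<kappa> \<epsilon> \<mu>"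
      proof -
        have "1 \<le> k" "k \<le> \<kappa>" "1 \<le> nat (- n)" using k 3 by auto
        then show ?thesis unfolding verma_gens_def by blast
      qed
      from vg[OF this w, of c] show ?thesis
        using 3 by (simp add: fops fmul_linear \<phi>diff \<phi>(2) bcoef_def bU_def mcoef_def)
    qed
  qed
  show thesis
  proof (rule that[OF \<phi>(1,2,4)])
    fix i j k l m n
    assume ijkl: "i \<in> {1..\<kappa>}" "j \<in> {1..\<kappa>}" "k \<in> {1..\<kappa>}" "l \<in> {1..\<kappa>}"
    obtain c w where cw: "bcoef \<epsilon> i j m = fmon c w" "list_all (valid_gen \<kappa>) w"
      by (rule bcoef_fmon[OF ijkl(1,2)])
    show "k < l \<Longrightarrow> \<phi> (bb \<epsilon> i j k l m n) = 0"
      unfolding bb_def cw(1) by (rule up[OF cw(2) ijkl(3,4)])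
    have "refl_rel \<kappa> s \<epsilon> i j k l m n \<in> defining_rels \<kappa> s \<epsilon>"
      using ijkl unfolding defining_rels_def by blast
    from \<phi>(3)[OF rel[OF this]] have "gauge s i j k l * \<phi> (comp_rel \<kappa> s \<epsilon> i j k l m n) = 0"
      by (simp add: refl_rel_comp[OF s ijkl] \<phi>(2))
    moreover have "gauge s i j k l \<noteq> 0" by (simp add: gauge_def)
    ultimately show "\<phi> (comp_rel \<kappa> s \<epsilon> i j k l m n) = 0" by simp
  next
    fix i j m assume ij: "i \<in> {1..\<kappa>}" "j \<in> {1..\<kappa>}"
    have "unit_rel \<kappa> s \<epsilon> i j i i m 0 \<in> defining_rels \<kappa> s \<epsilon>"
      using ij unfolding defining_rels_def by blast
    from \<phi>(3)[OF rel[OF this]] have "gauge s i j i i * (psign s i i * psign s i j) * \<phi> (unit_comp \<kappa> \<epsilon> i j m) = 0"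
      by (simp add: unit_rel_comp[OF s ij ij(1,1)] \<phi>(2))
    moreover have "gauge s i j i i * (psign s i i * psign s i j) \<noteq> 0" by (simp add: gauge_def psign_def)
    ultimately show "\<phi> (unit_comp \<kappa> \<epsilon> i j m) = 0" by simp
  next
    fix i k m n assume ik: "i \<in> {1..\<kappa>}" "k \<in> {1..\<kappa>}"
    obtain c w where cw: "bcoef \<epsilon> i i m = fmon c w" "list_all (valid_gen \<kappa>) w"
      by (rule bcoef_fmon[OF ik(1,1)])
    have "\<phi> (fmon c w) = mcoef \<mu> i m"
      using diag[of "[]" i 1 m] ik by (simp add: fmul_fmon_nil cw(1) flip: fone_fmon) (simp add: \<phi>(4))
    then show "\<phi> (bb \<epsilon> i i k k m n) = mcoef \<mu> i m * mcoef \<mu> k n"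
      unfolding bb_def cw(1) using diag[OF cw(2) ik(2)] by simp
  qed
qed

text \<open>X times the tilde series, with X = 1/u: the pole 2u becomes the constant 2 and the
  computation stays within power series.\<close>

definition Qser :: "nat \<Rightarrow> (nat \<Rightarrow> int) \<Rightarrow> (nat \<Rightarrow> complex fps) \<Rightarrow> nat \<Rightarrow> complex fps" where
  "Qser \<kappa> s \<mu> i = (2 - fps_const (rho \<kappa> s (i + 1)) * fps_X) * \<mu> i
     + fps_X * (\<Sum>a\<in>{i+1..\<kappa>}. fps_const (of_int (s a)) * \<mu> a)"

lemma shift_neg_eq: "(1 - fps_const c * fps_X) * shift_neg c = - fps_X"
proof -
  have "(1 - fps_const c * fps_X) * inverse (1 - fps_const c * fps_X :: complex fps) = 1"
    by (subst mult.commute, rule inverse_mult_eq_1) simp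
  then show ?thesis unfolding shift_neg_def by (metis mult.left_commute mult.right_neutral mult_minus_left)
qed

lemma shift_neg_0 [simp]: "shift_neg c $ 0 = 0"
  by (simp add: shift_neg_def)

lemma shift_neg_zero: "shift_neg 0 = - fps_X"
  using shift_neg_eq[of 0] by simp

text \<open>This is u + v = c divided by u v, with \<open>shift_neg c\<close> in the role of
  1/v.\<close>

lemma shift_neg_sum: "fps_X + shift_neg c = fps_const c * fps_X * shift_neg c"
proof -
  have "shift_neg c - fps_const c * fps_X * shift_neg c = - fps_X"
    using shift_neg_eq[of c] by (simp add: left_diff_distrib)
  then have "shift_neg c = fps_const c * fps_X * shift_neg c - fps_X"
    by (simp add: diff_eq_eq)
  then show ?thesis by (metis add.commute diff_add_cancel)
qed

lemma shift_neg_nz: "shift_neg c \<noteq> 0"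
proof
  assume "shift_neg c = 0"
  then have "fps_X = (0 :: complex fps)" using shift_neg_eq[of c] by simp
  then show False by simp
qed

definition ser_in_Y :: "'a::zero fps \<Rightarrow> 'a fps fps" where
  "ser_in_Y f = Abs_fps (\<lambda>q. fps_const (f $ q))"

lemma ser2_mcoef: "ser2 (\<lambda>m n. mcoef \<mu> i m * mcoef \<mu> k n) = fps_const (\<mu> i) * ser_in_Y (\<mu> k)"
  by (simp add: fps_eq_iff mcoef_def ser_in_Y_def)

lemma fps_const_sum: "fps_const (sum f A) = (\<Sum>a\<in>A. fps_const (f a))"
  by (rule fps_ext) (simp add: fps_sum_nth)

lemma ser2_zero: "ser2 (\<lambda>_ _. 0) = (0 :: 'a::ring_1 fps fps)"
  by (simp add: fps_eq_iff)

lemma subst2_ser_in_Y: "\<sigma> $ 0 = 0 \<Longrightarrow> subst2 \<sigma> (fps_const f * ser_in_Y g) = f * (g oo \<sigma>)"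
  using subst2_separated[of \<sigma> g f] unfolding ser_in_Y_def
  by (metis (no_types, lifting) ext fps_const_mult_right fps_ext fps_mult_left_const_nth fps_nth_Abs_fps mult.commute)

lemma rho_Suc: "k \<le> \<kappa> \<Longrightarrow> rho \<kappa> s k = of_int (s k) + rho \<kappa> s (Suc k)"
  by (simp add: rho_def sum.atLeast_Suc_atMost)

lemma XY_eq: "XY a b = fps_const fps_X ^ a * (fps_X :: 'a::ring_1 fps fps) ^ b"
  by (simp add: XY_def fps_const_power)

lemma necessity:
  assumes s: "\<forall>i\<in>{1..\<kappa>}. s i = 1 \<or> s i = -1"
    and mu0: "\<forall>i\<in>{1..\<kappa>}. \<mu> i $ 0 = of_int (\<epsilon> i)"
    and nt: "verma_nontrivial \<kappa> s \<epsilon> \<mu>" and \<kappa>: "1 \<le> \<kappa>"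
  shows "\<mu> \<kappa> * (\<mu> \<kappa> oo (- fps_X)) = 1"
    and "1 \<le> i \<Longrightarrow> i < \<kappa> \<Longrightarrow> Qser \<kappa> s \<mu> i * (Qser \<kappa> s \<mu> i oo shift_neg (rho \<kappa> s (i+1))) =
       Qser \<kappa> s \<mu> (i+1) * (Qser \<kappa> s \<mu> (i+1) oo shift_neg (rho \<kappa> s (i+1)))"
proof -
  obtain \<phi> :: "falg \<Rightarrow> complex" where add: "\<And>x y. \<phi> (x + y) = \<phi> x + \<phi> y" and scale: "\<And>c x. \<phi> (fscal c x) = c * \<phi> x"
    and one: "\<phi> fone = 1"
    and up: "\<And>i j k l m n. \<lbrakk>i \<in> {1..\<kappa>}; j \<in> {1..\<kappa>}; k \<in> {1..\<kappa>}; l \<in> {1..\<kappa>}; k < l\<rbrakk> \<Longrightarrow> \<phi> (bb \<epsilon> i j k l m n) = 0"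
    and diag: "\<And>i k m n. \<lbrakk>i \<in> {1..\<kappa>}; k \<in> {1..\<kappa>}\<rbrakk> \<Longrightarrow> \<phi> (bb \<epsilon> i i k k m n) = mcoef \<mu> i m * mcoef \<mu> k n"
    and reflrel: "\<And>i j k l m n. \<lbrakk>i \<in> {1..\<kappa>}; j \<in> {1..\<kappa>}; k \<in> {1..\<kappa>}; l \<in> {1..\<kappa>}\<rbrakk> \<Longrightarrow> \<phi> (comp_rel \<kappa> s \<epsilon> i j k l m n) = 0"
    and unit: "\<And>i j m. \<lbrakk>i \<in> {1..\<kappa>}; j \<in> {1..\<kappa>}\<rbrakk> \<Longrightarrow> \<phi> (unit_comp \<kappa> \<epsilon> i j m) = 0"
    using verma_functional[OF s mu0 nt] by blast
  have zero: "\<phi> 0 = 0" using scale[of 0 0] by simp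
  have diff: "\<phi> (x - y) = \<phi> x - \<phi> y" for x y
    using add[of "x - y" y] by simp
  have phi_sum: "\<phi> (sum f A) = (\<Sum>a\<in>A. \<phi> (f a))" for f :: "nat \<Rightarrow> falg" and A
    by (induction A rule: infinite_finite_induct) (simp_all only: sum.infinite sum.empty sum.insert zero add simp_thms)
  have phi_sum': "\<phi> (sum f A) = (\<Sum>a\<in>A. \<phi> (f a))" for f :: "int \<Rightarrow> falg" and A
    by (induction A rule: infinite_finite_induct) (simp_all only: sum.infinite sum.empty sum.insert zero add simp_thms)
  define bp where "bp = (\<lambda>i a m n. \<phi> (bb \<epsilon> i a a i m n))"
  \<comment> \<open>\<open>\<beta> i\<close> collects the values of \<phi> on the i-th diagonal
    entry of B(u)B(v).\<close>
  define \<beta> where "\<beta> = (\<lambda>i m n. \<Sum>c\<in>{1..\<kappa>}. bp i c m n)"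
  have bb_pos: "bb \<epsilon> i j k l m n = 0" if "m > 0 \<or> n > 0" for i j k l m n
    using that by (auto simp: bb_def bcoef_pos)
  have bp_pos: "bp i a m n = 0" "\<beta> i m n = 0" if "m > 0 \<or> n > 0" for i a m n
    using that by (auto simp: bp_def \<beta>_def bb_pos zero)
  have mc_pos: "mcoef \<mu> i m * mcoef \<mu> k n = 0" if "m > 0 \<or> n > 0" for i k m n
    using that by (auto simp: mcoef_def)
  have es: "psign s a a = of_int (s a)" if "a \<in> {1..\<kappa>}" for a
    using that s by (auto simp: psign_def par_def)
  define B where "B = (\<lambda>i. ser2 (\<beta> i))"
  define U where "U = (\<lambda>i. fps_const (\<mu> i))"
  define V where "V = (\<lambda>i. ser_in_Y (\<mu> i))"
  define K :: "complex \<Rightarrow> complex fps fps" where "K = (\<lambda>c. fps_const (fps_const c))"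
  define X :: "complex fps fps" where "X = fps_const fps_X"
  define Y :: "complex fps fps" where "Y = fps_X"
  have XY: "XY a b = X ^ a * Y ^ b" for a b by (simp add: XY_eq X_def Y_def)
  have K_simps: "K (a + b) = K a + K b" "K (a - b) = K a - K b" "K (a * b) = K a * K b" "K 0 = 0" "K 1 = 1"
     "K (- a) = - K a" for a b
    by (simp_all add: K_def)
  have ser2_K: "ser2 (\<lambda>m n. c * F m n) = K c * ser2 F" for c and F :: "int \<Rightarrow> int \<Rightarrow> complex"
    by (simp add: K_def ser2_scale)
  have Xnz: "X \<noteq> 0" by (simp add: X_def)
  have Ynz: "Y \<noteq> 0" by (simp add: Y_def)

  \<comment> \<open>With all four indices equal the first two parts drop out, because \<phi> is
    symmetric on b_ii b_ii. What remains is 1 - s_i (u - v) times the antisymmetric part of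
    \<open>\<beta> i\<close>, and the ring of double series has no zero divisors.\<close>
  have sym: "ser2 (\<lambda>m n. \<beta> i n m) = B i" if i: "i \<in> {1..\<kappa>}" for i
  proof -
    define \<Delta> where "\<Delta> = (\<lambda>m n. \<beta> i m n - \<beta> i n m)"
    have comm: "\<phi> (bb \<epsilon> i i i i m n) = \<phi> (bb \<epsilon> i i i i n m)" for m n
      using diag[OF i i] by simp
    have "\<forall>m n. 0 - 0 - (0 + 0) - (psign s i i * \<Delta> (m - 1) n - psign s i i * \<Delta> m (n - 1)) + \<Delta> m n = 0"
    proof (intro allI)
      fix m n
      have "\<phi> (comp_rel \<kappa> s \<epsilon> i i i i m n) =
        0 - 0 - (0 + 0) - (psign s i i * \<Delta> (m - 1) n - psign s i i * \<Delta> m (n - 1)) + \<Delta> m n"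
        unfolding comp_rel_def Let_def \<Delta>_def \<beta>_def bp_def
        by (simp add: add diff scale phi_sum comm algebra_simps)
      then show "0 - 0 - (0 + 0) - (psign s i i * \<Delta> (m - 1) n - psign s i i * \<Delta> m (n - 1)) + \<Delta> m n = 0"
        using reflrel[OF i i i i] by simp
    qed
    then have "- (XY 1 2 * ser2 (\<lambda>m n. psign s i i * \<Delta> m n) - XY 2 1 * ser2 (\<lambda>m n. psign s i i * \<Delta> m n)) + XY 2 2 * ser2 \<Delta> = 0"
      using ser2_relation[of "\<lambda>_ _. 0" "\<lambda>_ _. 0" "\<lambda>m n. psign s i i * \<Delta> m n" \<Delta>]
      by (simp add: \<Delta>_def bp_pos(2) disj_commute ser2_zero)
    then have "X * Y * (X * Y - K (psign s i i) * (Y - X)) * ser2 \<Delta> = 0"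
      unfolding ser2_K XY by (simp add: algebra_simps power2_eq_square)
    moreover have "X * Y - K (psign s i i) * (Y - X) \<noteq> 0"
    proof
      assume "X * Y - K (psign s i i) * (Y - X) = 0"
      then have "(X * Y - K (psign s i i) * (Y - X)) $ 0 $ 1 = 0" by simp
      moreover have "(X * Y - K (psign s i i) * (Y - X)) $ 0 $ 1 = psign s i i"
        by (simp add: X_def Y_def K_def)
      moreover have "psign s i i \<noteq> 0" by (simp add: psign_def)
      ultimately show False by simp
    qed
    ultimately have "ser2 \<Delta> = 0" using Xnz Ynz by auto
    then show ?thesis by (simp add: \<Delta>_def ser2_linear B_def)
  qed

  \<comment> \<open>Indices (i, a, a, i): of the two products in the first part, b_ai b_ia ends in a
    raising letter and is killed. The relation therefore expresses b_ia b_ai through the weights and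
    the series B.\<close>
  have pair: "(Y ^ 2 - X ^ 2) * ser2 (bp i a) = X * Y * ((X + Y) * (K (of_int (s a)) * (U a * V i - U i * V a))
      + (Y - X) * (K (of_int (s a)) * B i - K (of_int (s a)) * B a))"
    if i: "i \<in> {1..\<kappa>}" and a: "a \<in> {1..\<kappa>}" and ia: "i < a" for i a
  proof -
    let ?e = "psign s i a"
    define G1 where "G1 = (\<lambda>m n. (?e * of_int (s a)) * bp i a m n)"
    define G2 where "G2 = (\<lambda>m n. ?e * (mcoef \<mu> a m * mcoef \<mu> i n - mcoef \<mu> i m * mcoef \<mu> a n))"
    define G3 where "G3 = (\<lambda>m n. ?e * (\<beta> i m n - \<beta> a n m))"
    have "\<forall>m n. G1 (m - 2) n - G1 m (n - 2) - (G2 (m - 1) n + G2 m (n - 1)) - (G3 (m - 1) n - G3 m (n - 1)) + 0 = 0"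
    proof (intro allI)
      fix m n
      have "\<phi> (comp_rel \<kappa> s \<epsilon> i a a i m n) =
        G1 (m - 2) n - G1 m (n - 2) - (G2 (m - 1) n + G2 m (n - 1)) - (G3 (m - 1) n - G3 m (n - 1)) + 0"
        unfolding comp_rel_def Let_def G1_def G2_def G3_def \<beta>_def bp_def
        using ia up[OF a i i a ia]
        by (simp add: add diff scale phi_sum diag[OF a i] es[OF a] psign_sym algebra_simps)
      then show "G1 (m - 2) n - G1 m (n - 2) - (G2 (m - 1) n + G2 m (n - 1)) - (G3 (m - 1) n - G3 m (n - 1)) + 0 = 0"
        using reflrel[OF i a a i] by simp
    qed
    then have rel: "XY 0 2 * ser2 G1 - XY 2 0 * ser2 G1 - (XY 1 2 * ser2 G2 + XY 2 1 * ser2 G2)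
      - (XY 1 2 * ser2 G3 - XY 2 1 * ser2 G3) + XY 2 2 * ser2 (\<lambda>_ _. 0) = 0"
      by (subst (asm) ser2_relation) (auto simp: G1_def G2_def G3_def bp_pos mc_pos)
    have G: "ser2 G1 = K ?e * (K (of_int (s a)) * ser2 (bp i a))"
      "ser2 G2 = K ?e * (U a * V i - U i * V a)" "ser2 G3 = K ?e * (B i - B a)"
      unfolding G1_def G2_def G3_def
      by (simp_all add: ser2_K ser2_linear ser2_mcoef sym[OF a] U_def V_def B_def K_simps mult.assoc)
    have sq: "K (of_int (s a)) * K (of_int (s a)) = 1"
    proof -
      have "s a = 1 \<or> s a = -1" using s a by blast
      then show ?thesis by (auto simp: K_simps)
    qed
    have e2: "K ?e * K ?e = 1" by (simp flip: K_simps(3)) (simp add: K_simps)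
    let ?R = "(Y ^ 2 - X ^ 2) * (K (of_int (s a)) * ser2 (bp i a))
      - X * Y * ((X + Y) * (U a * V i - U i * V a) + (Y - X) * (B i - B a))"
    have "K ?e * ?R = 0" using rel unfolding G XY ser2_zero by (simp add: algebra_simps power2_eq_square)
    then have "K ?e * (K ?e * ?R) = 0" by simp
    then have "?R = 0" unfolding mult.assoc[symmetric] e2 by simp
    then have "K (of_int (s a)) * ?R = 0" by simp
    moreover have "K (of_int (s a)) * ?R = (Y ^ 2 - X ^ 2) * ((K (of_int (s a)) * K (of_int (s a))) * ser2 (bp i a))
      - X * Y * ((X + Y) * (K (of_int (s a)) * (U a * V i - U i * V a)) + (Y - X) * (K (of_int (s a)) * B i - K (of_int (s a)) * B a))"
      by (simp add: algebra_simps)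
    ultimately show ?thesis unfolding sq by simp
  qed

  define \<Gamma> where "\<Gamma> = (\<lambda>i. \<Sum>a\<in>{i..\<kappa>}. K (of_int (s a)) * B a)"
  define SU where "SU = (\<lambda>i. \<Sum>a\<in>{i+1..\<kappa>}. K (of_int (s a)) * U a)"
  define SV where "SV = (\<lambda>i. \<Sum>a\<in>{i+1..\<kappa>}. K (of_int (s a)) * V a)"
  \<comment> \<open>Divided by X Y this is (u - v) mu_i(u) mu_i(v) plus the sum over a > i of s_a
    (mu_a(u) mu_i(v) - mu_a(v) mu_i(u)), the part of the relations that involves weights
    only.\<close>
  define D where "D = (\<lambda>i. (Y - X) * (U i * V i) + X * Y * (SU i * V i - SV i * U i))"
  have Krho: "(\<Sum>a\<in>{i+1..\<kappa>}. K (of_int (s a))) = K (rho \<kappa> s (i + 1))" for i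
    by (simp add: rho_def K_def fps_const_sum)
  have Bsum: "B i = U i * V i + (\<Sum>a\<in>{i+1..\<kappa>}. ser2 (bp i a))" if i: "i \<in> {1..\<kappa>}" for i
  proof -
    have "bp i c m n = 0" if "c \<in> {1..<i}" for c m n
      using that i up[of i c c i] by (auto simp: bp_def)
    then have "\<beta> i m n = bp i i m n + (\<Sum>a\<in>{i+1..\<kappa>}. bp i a m n)" for m n
    proof -
      have "{1..\<kappa>} = {1..<i} \<union> ({i} \<union> {i+1..\<kappa>})" using i by auto
      then have "\<beta> i m n = (\<Sum>c\<in>{1..<i}. bp i c m n) + (\<Sum>c\<in>{i} \<union> {i+1..\<kappa>}. bp i c m n)"
        unfolding \<beta>_def by (simp only:) (rule sum.union_disjoint, auto)
      then show ?thesis using \<open>\<And>c m n. c \<in> {1..<i} \<Longrightarrow> bp i c m n = 0\<close> by simp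
    qed
    then have "\<beta> i = (\<lambda>m n. mcoef \<mu> i m * mcoef \<mu> i n + (\<Sum>a\<in>{i+1..\<kappa>}. bp i a m n))"
      using diag[OF i i] by (simp add: fun_eq_iff bp_def)
    then show ?thesis unfolding B_def U_def V_def by (simp only: ser2_linear ser2_sum ser2_mcoef)
  qed
  \<comment> \<open>Summing \<open>pair\<close> over a > i makes B_i appear on both sides.
    Collecting it produces the factor u + v - \<rho>, here multiplied by X Y.\<close>
  have main: "(Y - X) * (X + Y - K (rho \<kappa> s (i + 1)) * X * Y) * B i = (X + Y) * D i - (Y - X) * X * Y * \<Gamma> (i + 1)"
    if i: "i \<in> {1..\<kappa>}" for i
  proof -
    have "(Y ^ 2 - X ^ 2) * (B i - U i * V i) = (\<Sum>a\<in>{i+1..\<kappa>}. (Y ^ 2 - X ^ 2) * ser2 (bp i a))"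
      using Bsum[OF i] by (simp add: sum_distrib_left)
    also have "\<dots> = (\<Sum>a\<in>{i+1..\<kappa>}. X * Y * ((X + Y) * (K (of_int (s a)) * (U a * V i - U i * V a))
      + (Y - X) * (K (of_int (s a)) * B i - K (of_int (s a)) * B a)))"
      using i by (intro sum.cong refl pair) auto
    also have "\<dots> = X * Y * ((X + Y) * (SU i * V i - SV i * U i) + (Y - X) * (K (rho \<kappa> s (i + 1)) * B i - \<Gamma> (i + 1)))"
      unfolding SU_def SV_def \<Gamma>_def Krho[symmetric]
      by (simp add: sum_distrib_left sum_distrib_right sum.distrib sum_subtractf algebra_simps)
    finally show ?thesis unfolding D_def by (simp add: algebra_simps power2_eq_square)
  qed

  \<comment> \<open>At v = -u the series B_i becomes a diagonal entry of B(u)B(-u).\<close>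
  have unitB: "subst2 (- fps_X) (B i) = 1" if i: "i \<in> {1..\<kappa>}" for i
  proof (rule fps_ext)
    fix N
    have pow: "((f :: complex fps) * (- fps_X) ^ n) $ N = (-1) ^ n * f $ (N - n)" if "n \<le> N" for f n
    proof -
      have "(-1 :: complex fps) = fps_const (-1)"
        by (rule fps_ext) simp
      then have p: "(- fps_X :: complex fps) ^ n = fps_const ((-1) ^ n) * fps_X ^ n"
        unfolding power_minus[of "fps_X :: complex fps"] by (metis fps_const_power)
      have "f * (- fps_X) ^ n = fps_const ((-1) ^ n) * (fps_X ^ n * f)"
        unfolding p by (simp only: mult_ac)
      from arg_cong[OF this, of "\<lambda>g. g $ N"] show ?thesis
        using that unfolding fps_mult_left_const_nth fps_X_power_mult_nth by simp
    qed
    have "0 = \<phi> (unit_comp \<kappa> \<epsilon> i i (- int N))" using unit[OF i i] by simp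
    also have "\<dots> = (\<Sum>a\<in>{1..\<kappa>}. \<Sum>t\<in>{- int N..0}. (-1) ^ nat (t + int N) * bp i a t (- int N - t)) - (if N = 0 then 1 else 0)"
      unfolding unit_comp_def by (simp add: diff phi_sum phi_sum' scale one zero bp_def)
    also have "(\<Sum>a\<in>{1..\<kappa>}. \<Sum>t\<in>{- int N..0}. (-1) ^ nat (t + int N) * bp i a t (- int N - t)) =
        (\<Sum>t\<in>{- int N..0}. (-1) ^ nat (t + int N) * \<beta> i t (- int N - t))"
      unfolding \<beta>_def sum_distrib_left by (rule sum.swap)
    also have "\<dots> = (\<Sum>n\<le>N. (-1) ^ n * \<beta> i (- int (N - n)) (- int n))"
      by (rule sum.reindex_bij_witness[of _ "\<lambda>n. int n - int N" "\<lambda>t. nat (t + int N)"]) (auto simp: of_nat_diff minus_diff_commute)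
    also have "\<dots> = subst2 (- fps_X) (B i) $ N"
      unfolding subst2_def by (simp add: pow B_def)
    finally show "subst2 (- fps_X) (B i) $ N = 1 $ N" by (simp split: if_splits)
  qed

  show first: "\<mu> \<kappa> * (\<mu> \<kappa> oo (- fps_X)) = 1"
  proof -
    \<comment> \<open>No index lies above \<kappa>, so only the product of weights survives.\<close>
    have "B \<kappa> = U \<kappa> * V \<kappa>" using Bsum[of \<kappa>] \<kappa> by simp
    then have "subst2 (- fps_X) (B \<kappa>) = \<mu> \<kappa> * (\<mu> \<kappa> oo (- fps_X))"
      by (simp add: U_def V_def subst2_ser_in_Y)
    then show ?thesis using unitB[of \<kappa>] \<kappa> by simp
  qed

  assume i1: "1 \<le> i" and i2: "i < \<kappa>"
  define \<rho> where "\<rho> = rho \<kappa> s (i + 1)"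
  define \<sigma> where "\<sigma> = shift_neg \<rho>"
  define t where "t = (of_int (s (i + 1)) :: complex)"
  have \<sigma>0: "\<sigma> $ 0 = 0" by (simp add: \<sigma>_def)
  have \<rho>': "rho \<kappa> s (i + 1 + 1) = \<rho> - t" using rho_Suc[of "i + 1" \<kappa> s] i2 by (simp add: \<rho>_def t_def)
  have \<Gamma>': "\<Gamma> (i + 1) = K t * B (i + 1) + \<Gamma> (i + 1 + 1)"
    using i2 unfolding \<Gamma>_def by (simp add: sum.atLeast_Suc_atMost t_def)
  define w where "w = X + Y - K \<rho> * X * Y"
  have A: "(Y - X) * w * B i = (X + Y) * D i - (Y - X) * X * Y * (K t * B (i + 1) + \<Gamma> (i + 1 + 1))"
    using main[of i] i1 i2 by (simp add: w_def \<rho>_def \<Gamma>'[simplified])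
  have C: "(Y - X) * (w + K t * X * Y) * B (i + 1) = (X + Y) * D (i + 1) - (Y - X) * X * Y * \<Gamma> (i + 1 + 1)"
    using main[of "i + 1"] i1 i2 unfolding \<rho>' by (simp add: w_def K_simps algebra_simps)
  \<comment> \<open>B_{i+1} is eliminated between the relations for i and i + 1. Up to a multiple of
    w, only the difference of the two D's is left.\<close>
  have comb: "(X + Y) * (K t * X * Y * (D i - D (i + 1))) =
     w * ((Y - X) * (w + K t * X * Y) * B i - (X + Y) * D i + (Y - X) * X * Y * \<Gamma> (i + 1 + 1))"
  proof -
    have "((Y - X) * w * B i) * (w + K t * X * Y) =
       ((X + Y) * D i - (Y - X) * X * Y * \<Gamma> (i + 1 + 1)) * (w + K t * X * Y) - X * Y * K t * ((Y - X) * (w + K t * X * Y) * B (i + 1))"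
      unfolding A by (simp add: algebra_simps)
    then show ?thesis unfolding C by (simp add: algebra_simps)
  qed
  have tnz: "t \<noteq> 0" using bspec[OF s, of "i + 1"] i1 i2 by (auto simp: t_def)
  have sX: "subst2 \<sigma> (X * F) = fps_X * subst2 \<sigma> F" and sY: "subst2 \<sigma> (Y * F) = \<sigma> * subst2 \<sigma> F"
    and sK: "subst2 \<sigma> (K c * F) = fps_const c * subst2 \<sigma> F" for F c
    using subst2_const_mult[OF \<sigma>0] subst2_X_mult[OF \<sigma>0] by (simp_all add: X_def Y_def K_def)
  note sub = sX sY sK subst2_linear[OF \<sigma>0] distrib_right left_diff_distrib mult.assoc
  have ws: "subst2 \<sigma> (w * F) = 0" for F
  proof -
    have "subst2 \<sigma> (w * F) = fps_X * subst2 \<sigma> F + \<sigma> * subst2 \<sigma> F - fps_const \<rho> * (fps_X * (\<sigma> * subst2 \<sigma> F))"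
      unfolding w_def by (simp only: sub)
    also have "\<dots> = (fps_X + \<sigma> - fps_const \<rho> * fps_X * \<sigma>) * subst2 \<sigma> F"
      by (simp add: algebra_simps)
    also have "\<dots> = 0" using shift_neg_sum[of \<rho>] by (simp add: \<sigma>_def)
    finally show ?thesis .
  qed
  have Xs: "fps_X * \<sigma> \<noteq> 0" using shift_neg_nz by (simp add: \<sigma>_def)
  have key: "subst2 \<sigma> (D i) = subst2 \<sigma> (D (i + 1))"
  \<comment> \<open>The substitution kills w. For nonzero \<rho> the factor X + Y becomes \<rho> X
    \<sigma> and can be cancelled afterwards; for \<rho> = 0 it coincides with w and has to be
    cancelled before.\<close>
  proof (cases "\<rho> = 0")
    case False
    have "(fps_X + \<sigma>) * (fps_const t * (fps_X * (\<sigma> * (subst2 \<sigma> (D i) - subst2 \<sigma> (D (i + 1)))))) = 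
      subst2 \<sigma> ((X + Y) * (K t * X * Y * (D i - D (i + 1))))"
      by (simp only: sub)
    also have "\<dots> = 0" unfolding comb by (rule ws)
    finally have "(fps_const \<rho> * fps_X * \<sigma>) * (fps_const t * (fps_X * (\<sigma> * (subst2 \<sigma> (D i) - subst2 \<sigma> (D (i + 1)))))) = 0"
      using shift_neg_sum[of \<rho>] unfolding \<sigma>_def by simp
    then show ?thesis using False Xs tnz by simp
  next
    case True
    then have w: "w = X + Y" by (simp add: w_def K_simps)
    have "X + Y \<noteq> 0"
    proof
      assume "X + Y = 0"
      then have "(X + Y) $ 1 $ 0 = 0" by simp
      then show False by (simp add: X_def Y_def)
    qed
    with comb have "K t * X * Y * (D i - D (i + 1)) =
      (Y - X) * (w + K t * X * Y) * B i - (X + Y) * D i + (Y - X) * X * Y * \<Gamma> (i + 1 + 1)"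
      unfolding w by (metis mult_left_cancel)
    also have "\<dots> = w * ((Y - X) * B i) - w * D i + (Y - X) * (X * Y * (K t * B i + \<Gamma> (i + 1 + 1)))"
      unfolding w by (simp add: algebra_simps)
    finally have "subst2 \<sigma> (K t * X * Y * (D i - D (i + 1))) =
      (\<sigma> - fps_X) * (fps_X * (\<sigma> * (fps_const t * subst2 \<sigma> (B i) + subst2 \<sigma> (\<Gamma> (i + 1 + 1)))))"
      by (simp only: subst2_linear[OF \<sigma>0] ws) (simp only: sub, simp add: algebra_simps)
    \<comment> \<open>Here v = -u, so \<open>unitB\<close> turns every B into 1 and the expression
      into t + rho_{i+2} = rho_{i+1} = 0.\<close>
    also have "fps_const t * subst2 \<sigma> (B i) + subst2 \<sigma> (\<Gamma> (i + 1 + 1)) = 0"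
    proof -
      have \<sigma>: "\<sigma> = - fps_X" using True by (simp add: \<sigma>_def shift_neg_zero)
      have "subst2 \<sigma> (\<Gamma> (i + 1 + 1)) = (\<Sum>a\<in>{i+1+1..\<kappa>}. fps_const (of_int (s a)))"
        unfolding \<Gamma>_def subst2_sum[OF \<sigma>0] sK using unitB i1 by (intro sum.cong) (auto simp: \<sigma>)
      also have "\<dots> = fps_const (rho \<kappa> s (i + 1 + 1))" by (simp add: rho_def fps_const_sum)
      finally show ?thesis using unitB[of i] i1 i2 unfolding \<rho>' True \<sigma> by simp
    qed
    finally have "fps_const t * (fps_X * (\<sigma> * (subst2 \<sigma> (D i) - subst2 \<sigma> (D (i + 1))))) = 0"
      by (simp only: sub) (simp add: algebra_simps)
    then show ?thesis using Xs tnz by simp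
  qed
  show "Qser \<kappa> s \<mu> i * (Qser \<kappa> s \<mu> i oo shift_neg (rho \<kappa> s (i+1))) =
       Qser \<kappa> s \<mu> (i+1) * (Qser \<kappa> s \<mu> (i+1) oo shift_neg (rho \<kappa> s (i+1)))"
  proof -
    define S where "S = (\<lambda>i. \<Sum>a\<in>{i+1..\<kappa>}. fps_const (of_int (s a)) * \<mu> a)"
    define T where "T = (\<lambda>i. \<Sum>a\<in>{i+1..\<kappa>}. fps_const (of_int (s a)) * (\<mu> a oo \<sigma>))"
    have T: "S i oo \<sigma> = T i" for i
      unfolding S_def T_def fps_compose_sum_distrib
      by (intro sum.cong refl) (simp only: fps_compose_mult_distrib[OF \<sigma>0] fps_const_compose)
    have sD: "subst2 \<sigma> (D i) = (\<sigma> - fps_X) * (\<mu> i * (\<mu> i oo \<sigma>)) + fps_X * \<sigma> * (S i * (\<mu> i oo \<sigma>) - \<mu> i * T i)" for i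
    proof -
      have "subst2 \<sigma> (SU i * V i) = S i * (\<mu> i oo \<sigma>)"
        unfolding SU_def S_def sum_distrib_right subst2_sum[OF \<sigma>0] U_def V_def
        by (intro sum.cong refl) (simp only: mult.assoc sK subst2_ser_in_Y[OF \<sigma>0])
      moreover have "SV i * U i = (\<Sum>a\<in>{i+1..\<kappa>}. K (of_int (s a)) * (U i * V a))"
        unfolding SV_def sum_distrib_right by (simp add: mult_ac)
      then have "subst2 \<sigma> (SV i * U i) = \<mu> i * T i"
        unfolding T_def sum_distrib_left U_def V_def
        by (simp only: subst2_sum[OF \<sigma>0] sK subst2_ser_in_Y[OF \<sigma>0]) (simp add: mult_ac)
      moreover have "subst2 \<sigma> (U i * V i) = \<mu> i * (\<mu> i oo \<sigma>)"
        unfolding U_def V_def by (rule subst2_ser_in_Y[OF \<sigma>0])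
      ultimately show ?thesis unfolding D_def by (simp add: sub) 
    qed
    have X\<sigma>: "fps_X + \<sigma> = fps_const \<rho> * (fps_X * \<sigma>)"
      using shift_neg_sum[of \<rho>] by (simp add: \<sigma>_def mult.assoc)
    have Q: "Qser \<kappa> s \<mu> i = (2 - fps_const \<rho> * fps_X) * \<mu> i + fps_X * S i"
      unfolding Qser_def S_def \<rho>_def ..
    have S': "S i = fps_const t * \<mu> (i + 1) + S (i + 1)"
      using i2 unfolding S_def t_def by (simp add: sum.atLeast_Suc_atMost)
    \<comment> \<open>Moving t X mu_{i+1} from the leading term into the sum gives the series of i +
      1 the same leading coefficient and the same S_i as that of i, with mu_{i+1} in place of
      mu_i.\<close>
    have Q': "Qser \<kappa> s \<mu> (i + 1) = (2 - fps_const \<rho> * fps_X) * \<mu> (i + 1) + fps_X * S i"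
      unfolding Qser_def \<rho>' S' by (simp add: S_def algebra_simps flip: fps_const_sub)
    have comp: "((2 - fps_const \<rho> * fps_X) * f + fps_X * S i) oo \<sigma> = (2 - fps_const \<rho> * \<sigma>) * (f oo \<sigma>) + \<sigma> * T i" for f
      by (simp add: fps_compose_add_distrib fps_compose_sub_distrib fps_compose_mult_distrib[OF \<sigma>0] \<sigma>0 T)
    \<comment> \<open>Under u + v = \<rho> one has 2u - \<rho> = u - v and 2v - \<rho> = v - u. The
      product is therefore a term in S_i and T_i, common to both indices, minus a multiple of the
      substituted D.\<close>
    have prod: "fps_X * \<sigma> * (((2 - fps_const \<rho> * fps_X) * f + fps_X * S i) * ((2 - fps_const \<rho> * \<sigma>) * g + \<sigma> * T i)) =
       fps_X * \<sigma> * (fps_X * \<sigma>) * (S i * T i) - (\<sigma> - fps_X) * ((\<sigma> - fps_X) * (f * g) + fps_X * \<sigma> * (S i * g - f * T i))" for f g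
    proof -
      have 1: "\<sigma> * (2 - fps_const \<rho> * fps_X) = \<sigma> - fps_X"
      proof -
        have "\<sigma> * (2 - fps_const \<rho> * fps_X) = 2 * \<sigma> - fps_const \<rho> * (fps_X * \<sigma>)" by (simp add: algebra_simps)
        then show ?thesis unfolding X\<sigma>[symmetric] by simp
      qed
      have 2: "fps_X * (2 - fps_const \<rho> * \<sigma>) = fps_X - \<sigma>"
      proof -
        have "fps_X * (2 - fps_const \<rho> * \<sigma>) = 2 * fps_X - fps_const \<rho> * (fps_X * \<sigma>)" by (simp add: algebra_simps)
        then show ?thesis unfolding X\<sigma>[symmetric] by simp
      qed
      have "fps_X * \<sigma> * (((2 - fps_const \<rho> * fps_X) * f + fps_X * S i) * ((2 - fps_const \<rho> * \<sigma>) * g + \<sigma> * T i)) =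
        ((\<sigma> * (2 - fps_const \<rho> * fps_X)) * f + fps_X * \<sigma> * S i) * ((fps_X * (2 - fps_const \<rho> * \<sigma>)) * g + fps_X * \<sigma> * T i)"
        by (simp add: algebra_simps)
      then show ?thesis unfolding 1 2 by (simp add: algebra_simps)
    qed
    have D1: "subst2 \<sigma> (D (i + 1)) = (\<sigma> - fps_X) * (\<mu> (i+1) * (\<mu> (i+1) oo \<sigma>)) + fps_X * \<sigma> * (S i * (\<mu> (i+1) oo \<sigma>) - \<mu> (i+1) * T i)"
    proof -
      have "T i = fps_const t * (\<mu> (i + 1) oo \<sigma>) + T (i + 1)"
        using i2 unfolding T_def t_def by (simp add: sum.atLeast_Suc_atMost)
      then show ?thesis unfolding sD S' by (simp add: algebra_simps)
    qed
    have "fps_X * \<sigma> * (Qser \<kappa> s \<mu> i * (Qser \<kappa> s \<mu> i oo \<sigma>)) = fps_X * \<sigma> * (Qser \<kappa> s \<mu> (i + 1) * (Qser \<kappa> s \<mu> (i + 1) oo \<sigma>))"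
      unfolding Q Q' comp prod D1[symmetric] sD[symmetric] key ..
    then show ?thesis using Xs unfolding \<sigma>_def \<rho>_def by auto
  qed
qed

subsection \<open>The reflection equation over an arbitrary ring\<close>

text \<open>Operators on \<open>V \<otimes> V\<close> with entries in a ring: \<open>M i j k l\<close> is the coefficient of
  \<open>E\<^sub>i\<^sub>j \<otimes> E\<^sub>k\<^sub>l\<close>, all signs being absorbed by the gauge.  Products vanish outside the index
  range, so that associativity holds for arbitrary functions.\<close>

type_synonym 'a mat4 = "nat \<Rightarrow> nat \<Rightarrow> nat \<Rightarrow> nat \<Rightarrow> 'a"

definition mat4_mul :: "nat \<Rightarrow> 'a::ring_1 mat4 \<Rightarrow> 'a mat4 \<Rightarrow> 'a mat4" where
  "mat4_mul \<kappa> X Y = (\<lambda>i j k l. if i \<in> {1..\<kappa>} \<and> j \<in> {1..\<kappa>} \<and> k \<in> {1..\<kappa>} \<and> l \<in> {1..\<kappa>}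
     then \<Sum>a\<in>{1..\<kappa>}. \<Sum>c\<in>{1..\<kappa>}. X i a k c * Y a j c l else 0)"

definition mat_mul :: "nat \<Rightarrow> (nat \<Rightarrow> nat \<Rightarrow> 'a::ring_1) \<Rightarrow> (nat \<Rightarrow> nat \<Rightarrow> 'a) \<Rightarrow> nat \<Rightarrow> nat \<Rightarrow> 'a" where
  "mat_mul \<kappa> x y = (\<lambda>i j. \<Sum>a\<in>{1..\<kappa>}. x i a * y a j)"

definition psg :: "(nat \<Rightarrow> int) \<Rightarrow> nat \<Rightarrow> nat \<Rightarrow> 'a::ring_1" where
  "psg s i j = (-1) ^ (par s i * par s j)"

lemma psg_cases: "psg s i j = (1 :: 'a::ring_1) \<or> psg s i j = (-1 :: 'a)"
  unfolding psg_def by (auto simp: minus_one_power_iff)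

lemma psg_sym: "psg s i j = psg s j i" by (simp add: psg_def mult.commute)

lemma psg_square [simp]: "psg s i j * psg s i j = (1 :: 'a::ring_1)" "psg s i j * (psg s i j * x) = (x :: 'a)"
  using psg_cases[of s i j, where 'a = 'a] by auto

lemma psg_commute: "x * psg s i j = psg s i j * (x :: 'a::ring_1)" "x * (psg s i j * y) = psg s i j * (x * y :: 'a)"
  using psg_cases[of s i j, where 'a = 'a] by auto

lemma psg_psg_commute: "psg s i j * psg s k l = psg s k l * (psg s i j :: 'a::ring_1)"
  "psg s i j * (psg s k l * x) = psg s k l * (psg s i j * x :: 'a)"
  using psg_cases[of s i j, where 'a = 'a] by auto

text \<open>With a = Y - X or a = X + Y and b = X Y this is X Y times (u - v) - P or (u + v) - P, so
  no negative powers of X and Y occur.\<close>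

definition Rop :: "(nat \<Rightarrow> int) \<Rightarrow> 'a::ring_1 \<Rightarrow> 'a \<Rightarrow> 'a mat4" where
  "Rop s a b = (\<lambda>i j k l. (if i = j \<and> k = l then a else 0) - (if k = j \<and> l = i then b * psg s i j else 0))"

text \<open>Signs appear here and not in \<open>second_factor\<close>, because the gauge frees only
  the second tensor factor from them.\<close>

definition first_factor :: "(nat \<Rightarrow> int) \<Rightarrow> (nat \<Rightarrow> nat \<Rightarrow> 'a::ring_1) \<Rightarrow> 'a mat4" where
  "first_factor s t = (\<lambda>i j k l. if k = l then psg s k i * (psg s k j * t i j) else 0)"

definition second_factor :: "(nat \<Rightarrow> nat \<Rightarrow> 'a::ring_1) \<Rightarrow> 'a mat4" where
  "second_factor t = (\<lambda>i j k l. if i = j then t k l else 0)"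

lemma mat4_mul_in_range:
  assumes "i \<in> {1..\<kappa>}" "j \<in> {1..\<kappa>}" "k \<in> {1..\<kappa>}" "l \<in> {1..\<kappa>}"
  shows "mat4_mul \<kappa> X Y i j k l = (\<Sum>a\<in>{1..\<kappa>}. \<Sum>c\<in>{1..\<kappa>}. X i a k c * Y a j c l)"
  using assms by (simp only: mat4_mul_def simp_thms if_True)

lemma mat4_mul_assoc: "mat4_mul \<kappa> (mat4_mul \<kappa> X Y) Z = mat4_mul \<kappa> X (mat4_mul \<kappa> Y Z)"
proof (intro ext)
  fix i j k l
  let ?I = "{1..\<kappa>} \<times> {1..\<kappa>}"
  have *: "mat4_mul \<kappa> X Y i j k l = (\<Sum>x\<in>?I. X i (fst x) k (snd x) * Y (fst x) j (snd x) l)"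
    if "(i, k) \<in> ?I" "(j, l) \<in> ?I" for X Y i j k l
    using that by (subst mat4_mul_in_range) (auto simp only: mem_Sigma_iff sum.cartesian_product case_prod_unfold)
  show "mat4_mul \<kappa> (mat4_mul \<kappa> X Y) Z i j k l = mat4_mul \<kappa> X (mat4_mul \<kappa> Y Z) i j k l"
  proof (cases "(i, k) \<in> ?I \<and> (j, l) \<in> ?I")
    case True
    have "mat4_mul \<kappa> (mat4_mul \<kappa> X Y) Z i j k l =
        (\<Sum>x\<in>?I. \<Sum>y\<in>?I. X i (fst y) k (snd y) * (Y (fst y) (fst x) (snd y) (snd x) * Z (fst x) j (snd x) l))"
      using True by (subst *) (auto simp: * sum_distrib_right mult.assoc intro!: sum.cong simp del: mem_Sigma_iff)
    also have "\<dots> = (\<Sum>y\<in>?I. \<Sum>x\<in>?I. X i (fst y) k (snd y) * (Y (fst y) (fst x) (snd y) (snd x) * Z (fst x) j (snd x) l))"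
      by (rule sum.swap)
    also have "\<dots> = mat4_mul \<kappa> X (mat4_mul \<kappa> Y Z) i j k l"
      using True by (subst *) (auto simp: * sum_distrib_left intro!: sum.cong simp del: mem_Sigma_iff)
    finally show ?thesis .
  qed (auto simp: mat4_mul_def)
qed

lemma mat_mul_assoc: "mat_mul \<kappa> (mat_mul \<kappa> x y) z = mat_mul \<kappa> x (mat_mul \<kappa> y z)"
  unfolding mat_mul_def fun_eq_iff sum_distrib_left sum_distrib_right mult.assoc
  by (auto intro: sum.swap)

lemma mat4_mul_eqI:
  assumes "\<And>i j k l. i \<in> {1..\<kappa>} \<Longrightarrow> j \<in> {1..\<kappa>} \<Longrightarrow> k \<in> {1..\<kappa>} \<Longrightarrow> l \<in> {1..\<kappa>} \<Longrightarrow>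
    mat4_mul \<kappa> X Y i j k l = mat4_mul \<kappa> X' Y' i j k l"
  shows "mat4_mul \<kappa> X Y = mat4_mul \<kappa> X' Y'"
proof (intro ext)
  fix i j k l
  show "mat4_mul \<kappa> X Y i j k l = mat4_mul \<kappa> X' Y' i j k l"
    using assms[of i j k l] by (cases "i \<in> {1..\<kappa>} \<and> j \<in> {1..\<kappa>} \<and> k \<in> {1..\<kappa>} \<and> l \<in> {1..\<kappa>}") (auto simp: mat4_mul_def)
qed

lemma mat4_mul_cong:
  assumes "\<And>i j k l. i \<in> {1..\<kappa>} \<Longrightarrow> j \<in> {1..\<kappa>} \<Longrightarrow> k \<in> {1..\<kappa>} \<Longrightarrow> l \<in> {1..\<kappa>} \<Longrightarrow> X i j k l = X' i j k l"
    and "\<And>i j k l. i \<in> {1..\<kappa>} \<Longrightarrow> j \<in> {1..\<kappa>} \<Longrightarrow> k \<in> {1..\<kappa>} \<Longrightarrow> l \<in> {1..\<kappa>} \<Longrightarrow> Y i j k l = Y' i j k l"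
  shows "mat4_mul \<kappa> X Y = mat4_mul \<kappa> X' Y'"
  by (rule mat4_mul_eqI) (auto simp: mat4_mul_def assms intro!: sum.cong)

context
  fixes \<kappa> :: nat and s :: "nat \<Rightarrow> int" and i j k l :: nat
  assumes ijkl: "i \<in> {1..\<kappa>}" "j \<in> {1..\<kappa>}" "k \<in> {1..\<kappa>}" "l \<in> {1..\<kappa>}"
begin

lemma Rop_mul: "mat4_mul \<kappa> (Rop s a b) Y i j k l = a * Y i j k l - b * (psg s i k * Y k j i l)"
proof -
  have "mat4_mul \<kappa> (Rop s a b) Y i j k l =
    (\<Sum>p\<in>{1..\<kappa>}. \<Sum>q\<in>{1..\<kappa>}. (if q = k then (if p = i then a * Y i j k l else 0) else 0)
        - (if q = i then (if p = k then b * (psg s i k * Y k j i l) else 0) else 0))"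
    unfolding mat4_mul_in_range[OF ijkl] Rop_def by (intro sum.cong refl) (auto simp: left_diff_distrib mult.assoc)
  then show ?thesis using ijkl by (simp add: sum_subtractf)
qed

lemma mul_Rop: "mat4_mul \<kappa> Y (Rop s a b) i j k l = Y i j k l * a - Y i l k j * (b * psg s j l)"
proof -
  have "mat4_mul \<kappa> Y (Rop s a b) i j k l =
    (\<Sum>p\<in>{1..\<kappa>}. \<Sum>q\<in>{1..\<kappa>}. (if q = l then (if p = j then Y i j k l * a else 0) else 0)
        - (if q = j then (if p = l then Y i l k j * (b * psg s j l) else 0) else 0))"
    unfolding mat4_mul_in_range[OF ijkl] Rop_def by (intro sum.cong refl) (auto simp: right_diff_distrib psg_sym)
  then show ?thesis using ijkl by (simp add: sum_subtractf)
qed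

lemma first_mul: "mat4_mul \<kappa> (first_factor s t) Y i j k l = (\<Sum>p\<in>{1..\<kappa>}. psg s k i * (psg s k p * (t i p * Y p j k l)))"
proof -
  have "mat4_mul \<kappa> (first_factor s t) Y i j k l =
    (\<Sum>p\<in>{1..\<kappa>}. \<Sum>q\<in>{1..\<kappa>}. if q = k then psg s k i * (psg s k p * (t i p * Y p j k l)) else 0)"
    unfolding mat4_mul_in_range[OF ijkl] first_factor_def by (intro sum.cong refl) (auto simp: mult.assoc)
  then show ?thesis using ijkl by simp
qed

lemma second_mul: "mat4_mul \<kappa> (second_factor t) Y i j k l = (\<Sum>q\<in>{1..\<kappa>}. t k q * Y i j q l)"
proof -
  have "mat4_mul \<kappa> (second_factor t) Y i j k l =
    (\<Sum>q\<in>{1..\<kappa>}. \<Sum>p\<in>{1..\<kappa>}. if p = i then t k q * Y i j q l else 0)"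
    unfolding mat4_mul_in_range[OF ijkl] second_factor_def by (subst sum.swap) (intro sum.cong refl, auto)
  then show ?thesis using ijkl by simp
qed

end

lemma first_factor_mul:
  assumes "i \<in> {1..\<kappa>}" "j \<in> {1..\<kappa>}" "k \<in> {1..\<kappa>}" "l \<in> {1..\<kappa>}"
  shows "first_factor s (mat_mul \<kappa> x y) i j k l = mat4_mul \<kappa> (first_factor s x) (first_factor s y) i j k l"
proof -
  have "psg s k i * (psg s k j * (x i p * y p j)) = psg s k i * (psg s k p * (x i p * (psg s k p * (psg s k j * y p j))))" for p
    by (simp add: psg_commute[of "x _ _"])
  then show ?thesis
    unfolding first_mul[OF assms] by (cases "k = l") (simp_all only: first_factor_def mat_mul_def sum_distrib_left if_True if_False mult_zero_right sum.neutral_const simp_thms)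
qed

lemma second_factor_mul:
  assumes "i \<in> {1..\<kappa>}" "j \<in> {1..\<kappa>}" "k \<in> {1..\<kappa>}" "l \<in> {1..\<kappa>}"
  shows "second_factor (mat_mul \<kappa> x y) i j k l = mat4_mul \<kappa> (second_factor x) (second_factor y) i j k l"
  unfolding second_mul[OF assms] by (simp add: second_factor_def mat_mul_def)

lemma first_second: 
  assumes "i \<in> {1..\<kappa>}" "j \<in> {1..\<kappa>}" "k \<in> {1..\<kappa>}" "l \<in> {1..\<kappa>}"
  shows "mat4_mul \<kappa> (first_factor s A) (second_factor B) i j k l = psg s k i * (psg s k j * (A i j * B k l))"
    "mat4_mul \<kappa> (second_factor B) (first_factor s A) i j k l = psg s l i * (psg s l j * (B k l * A i j))"
proof -
  show "mat4_mul \<kappa> (first_factor s A) (second_factor B) i j k l = psg s k i * (psg s k j * (A i j * B k l))"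
    unfolding first_mul[OF assms] second_factor_def using assms by (simp add: if_distrib[of "(*) _"] cong: if_cong)
  show "mat4_mul \<kappa> (second_factor B) (first_factor s A) i j k l = psg s l i * (psg s l j * (B k l * A i j))"
    unfolding second_mul[OF assms] first_factor_def using assms
    by (simp add: if_distrib[of "(*) _"] psg_commute[of "B _ _"] cong: if_cong)
qed

text \<open>Sklyanin's dressing: \<open>r\<close> is R(u - v), \<open>q\<close> is R(u + v), and T
  and S stand to the left and right of the old solution b. The factors are sorted so that
  \<open>r\<close> meets the T's, the undressed equation and the S's in turn. Only associativity
  enters, which keeps signs and scalars out of the argument.\<close>

lemma (in semigroup) dressing:
  assumes "r \<^bold>* (T1 \<^bold>* T2) = T2 \<^bold>* (T1 \<^bold>* r)" "r \<^bold>* (S1 \<^bold>* S2) = S2 \<^bold>* (S1 \<^bold>* r)"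
    and "S1 \<^bold>* (q \<^bold>* T2) = T2 \<^bold>* (q \<^bold>* S1)" "T1 \<^bold>* (q \<^bold>* S2) = S2 \<^bold>* (q \<^bold>* T1)"
    and "b1 \<^bold>* T2 = T2 \<^bold>* b1" "b1 \<^bold>* S2 = S2 \<^bold>* b1" "T1 \<^bold>* b2 = b2 \<^bold>* T1" "S1 \<^bold>* b2 = b2 \<^bold>* S1"
    and "r \<^bold>* (b1 \<^bold>* (q \<^bold>* b2)) = b2 \<^bold>* (q \<^bold>* (b1 \<^bold>* r))"
  shows "r \<^bold>* ((T1 \<^bold>* (b1 \<^bold>* S1)) \<^bold>* (q \<^bold>* (T2 \<^bold>* (b2 \<^bold>* S2)))) = (T2 \<^bold>* (b2 \<^bold>* S2)) \<^bold>* (q \<^bold>* ((T1 \<^bold>* (b1 \<^bold>* S1)) \<^bold>* r))"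
proof -
  have "r \<^bold>* ((T1 \<^bold>* (b1 \<^bold>* S1)) \<^bold>* (q \<^bold>* (T2 \<^bold>* (b2 \<^bold>* S2)))) = r \<^bold>* T1 \<^bold>* b1 \<^bold>* (S1 \<^bold>* (q \<^bold>* T2)) \<^bold>* b2 \<^bold>* S2"
    by (simp only: assoc)
  also have "\<dots> = r \<^bold>* T1 \<^bold>* (b1 \<^bold>* T2) \<^bold>* q \<^bold>* (S1 \<^bold>* b2) \<^bold>* S2"
    unfolding assms(3) by (simp only: assoc)
  also have "\<dots> = (r \<^bold>* (T1 \<^bold>* T2)) \<^bold>* (b1 \<^bold>* (q \<^bold>* b2)) \<^bold>* S1 \<^bold>* S2"
    unfolding assms(5,8) by (simp only: assoc)
  also have "\<dots> = T2 \<^bold>* T1 \<^bold>* (r \<^bold>* (b1 \<^bold>* (q \<^bold>* b2))) \<^bold>* S1 \<^bold>* S2"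
    unfolding assms(1) by (simp only: assoc)
  also have "\<dots> = T2 \<^bold>* (T1 \<^bold>* b2) \<^bold>* q \<^bold>* b1 \<^bold>* (r \<^bold>* (S1 \<^bold>* S2))"
    unfolding assms(9) by (simp only: assoc)
  also have "\<dots> = T2 \<^bold>* b2 \<^bold>* T1 \<^bold>* q \<^bold>* (b1 \<^bold>* S2) \<^bold>* S1 \<^bold>* r"
    unfolding assms(2,7) by (simp only: assoc)
  also have "\<dots> = T2 \<^bold>* b2 \<^bold>* (T1 \<^bold>* (q \<^bold>* S2)) \<^bold>* b1 \<^bold>* S1 \<^bold>* r"
    unfolding assms(6) by (simp only: assoc)
  also have "\<dots> = (T2 \<^bold>* (b2 \<^bold>* S2)) \<^bold>* (q \<^bold>* ((T1 \<^bold>* (b1 \<^bold>* S1)) \<^bold>* r))"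
    unfolding assms(4) by (simp only: assoc)
  finally show ?thesis .
qed

definition central :: "'a::ring_1 \<Rightarrow> bool" where
  "central a \<longleftrightarrow> (\<forall>x. x * a = a * x)"

lemma centralD: "central a \<Longrightarrow> x * a = a * x" "central a \<Longrightarrow> x * (a * y) = a * (x * y)"
proof -
  assume a: "central a"
  show xa: "x * a = a * x" for x using a by (simp add: central_def)
  show "x * (a * y) = a * (x * y)" unfolding mult.assoc[symmetric] xa ..
qed

lemma central_mult: "central a \<Longrightarrow> central b \<Longrightarrow> central (a * b)"
  unfolding central_def[of "a * b"]
proof
  fix x assume ab: "central a" "central b"
  have "x * (a * b) = a * (x * b)" by (rule centralD(2)[OF ab(1)])
  also have "\<dots> = a * b * x" by (simp only: centralD(1)[OF ab(2), of x] mult.assoc)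
  finally show "x * (a * b) = a * b * x" .
qed

lemma central_power: "central a \<Longrightarrow> central (a ^ n)"
  by (induction n) (auto intro: central_mult simp: central_def[of 1])

lemma central_add: "central a \<Longrightarrow> central b \<Longrightarrow> central (a + b)"
  and central_diff: "central a \<Longrightarrow> central b \<Longrightarrow> central (a - b)"
  by (auto simp: central_def algebra_simps)

definition reflection_eq :: "nat \<Rightarrow> (nat \<Rightarrow> int) \<Rightarrow> 'a::ring_1 \<Rightarrow> 'a \<Rightarrow> 'a \<Rightarrow> (nat \<Rightarrow> nat \<Rightarrow> 'a) \<Rightarrow> (nat \<Rightarrow> nat \<Rightarrow> 'a) \<Rightarrow> bool" where
  "reflection_eq \<kappa> s a a' b U V \<longleftrightarrow>
    mat4_mul \<kappa> (Rop s a b) (mat4_mul \<kappa> (first_factor s U) (mat4_mul \<kappa> (Rop s a' b) (second_factor V))) =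
    mat4_mul \<kappa> (second_factor V) (mat4_mul \<kappa> (Rop s a' b) (mat4_mul \<kappa> (first_factor s U) (Rop s a b)))"

text \<open>The same four terms as in \<open>comp_rel\<close>, now over a ring in which the entries
  of U and V need not commute; the scalars are central and can be collected in front.\<close>

lemma reflection_sides:
  assumes central: "central a" "central a'" "central b"
    and ijkl: "i \<in> {1..\<kappa>}" "j \<in> {1..\<kappa>}" "k \<in> {1..\<kappa>}" "l \<in> {1..\<kappa>}"
  shows "mat4_mul \<kappa> (Rop s a b) (mat4_mul \<kappa> (first_factor s U) (mat4_mul \<kappa> (Rop s a' b) (second_factor V))) i j k l
    - mat4_mul \<kappa> (second_factor V) (mat4_mul \<kappa> (Rop s a' b) (mat4_mul \<kappa> (first_factor s U) (Rop s a b))) i j k l = a * (a' * (psg s k i * (psg s k j * (U i j * V k l)) - psg s l i * (psg s l j * (V k l * U i j))))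
    - a' * (b * (psg s i j * (U k j * V i l - V k j * U i l)))
    - a * (b * ((if k = j then psg s i j * mat_mul \<kappa> U V i l else 0) - (if i = l then psg s i j * mat_mul \<kappa> V U k j else 0)))
    + b * (b * (if i = j then mat_mul \<kappa> U V k l - mat_mul \<kappa> V U k l else 0))"
proof -
  note c = centralD[OF central(1), of "U _ _"] centralD[OF central(2), of "U _ _"] centralD[OF central(3), of "U _ _"]
    centralD[OF central(1), of "V _ _"] centralD[OF central(2), of "V _ _"] centralD[OF central(3), of "V _ _"]
    centralD[OF central(1), of a'] centralD[OF central(1), of b] centralD[OF central(2), of b]
    centralD[OF central(1), of "psg s _ _"] centralD[OF central(2), of "psg s _ _"] centralD[OF central(3), of "psg s _ _"]
    psg_commute[of "U _ _"] psg_commute[of "V _ _"]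
  define W where "W = (\<lambda>i j k l. psg s k i * (psg s k j * (a' * (U i j * V k l))) - (if k = j then b * (psg s k i * mat_mul \<kappa> U V i l) else 0))"
  have W: "mat4_mul \<kappa> (first_factor s U) (mat4_mul \<kappa> (Rop s a' b) (second_factor V)) i j k l = W i j k l"
    if h: "i \<in> {1..\<kappa>}" "j \<in> {1..\<kappa>}" "k \<in> {1..\<kappa>}" "l \<in> {1..\<kappa>}" for i j k l
  proof -
    have "mat4_mul \<kappa> (first_factor s U) (mat4_mul \<kappa> (Rop s a' b) (second_factor V)) i j k l =
      (\<Sum>p\<in>{1..\<kappa>}. (if p = j then psg s k i * (psg s k j * (a' * (U i j * V k l))) else 0)
         - (if k = j then b * (psg s k i * (U i p * V p l)) else 0))"
      unfolding first_mul[OF h]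
    proof (intro sum.cong HOL.refl)
      fix p assume p: "p \<in> {1..\<kappa>}"
      show "psg s k i * (psg s k p * (U i p * mat4_mul \<kappa> (Rop s a' b) (second_factor V) p j k l)) =
        (if p = j then psg s k i * (psg s k j * (a' * (U i j * V k l))) else 0)
         - (if k = j then b * (psg s k i * (U i p * V p l)) else 0)"
        unfolding Rop_mul[OF p h(2,3,4)] second_factor_def
        by (auto simp: c right_diff_distrib psg_sym[of s p k])
    qed
    also have "\<dots> = W i j k l"
      using h by (simp add: W_def sum_subtractf sum_distrib_left mat_mul_def)
    finally show ?thesis .
  qed
  have L: "mat4_mul \<kappa> (Rop s a b) (mat4_mul \<kappa> (first_factor s U) (mat4_mul \<kappa> (Rop s a' b) (second_factor V))) i j k l =
     a * (a' * (psg s k i * (psg s k j * (U i j * V k l)))) - a' * (b * (psg s i j * (U k j * V i l)))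
     - a * (b * (if k = j then psg s i j * mat_mul \<kappa> U V i l else 0)) + b * (b * (if i = j then mat_mul \<kappa> U V k l else 0))"
    unfolding Rop_mul[OF ijkl] W[OF ijkl] W[OF ijkl(3,2,1,4)] W_def
    by (auto simp: c right_diff_distrib psg_sym[of s k i] psg_sym[of s j i])
  define Z where "Z = (\<lambda>i j k l. (if k = l then a * (a' * (psg s k i * (psg s k j * U i j))) else 0)
     - (if k = j then a' * (b * (psg s k i * U i l)) else 0) - (if i = l then a * (b * (psg s i j * U k j)) else 0)
     + (if i = j then b * (b * U k l) else 0))"
  have Z: "mat4_mul \<kappa> (Rop s a' b) (mat4_mul \<kappa> (first_factor s U) (Rop s a b)) i j k l = Z i j k l"
    if h: "i \<in> {1..\<kappa>}" "j \<in> {1..\<kappa>}" "k \<in> {1..\<kappa>}" "l \<in> {1..\<kappa>}" for i j k l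
    unfolding Rop_mul[OF h] mul_Rop[OF h] mul_Rop[OF h(3,2,1,4)] first_factor_def Z_def
    by (auto simp: c right_diff_distrib mult.assoc psg_sym psg_psg_commute)
  have R: "mat4_mul \<kappa> (second_factor V) (mat4_mul \<kappa> (Rop s a' b) (mat4_mul \<kappa> (first_factor s U) (Rop s a b))) i j k l =
     a * (a' * (psg s l i * (psg s l j * (V k l * U i j)))) - a' * (b * (psg s i j * (V k j * U i l)))
     - a * (b * (if i = l then psg s i j * mat_mul \<kappa> V U k j else 0)) + b * (b * (if i = j then mat_mul \<kappa> V U k l else 0))"
  proof -
    have "mat4_mul \<kappa> (second_factor V) (mat4_mul \<kappa> (Rop s a' b) (mat4_mul \<kappa> (first_factor s U) (Rop s a b))) i j k l =
      (\<Sum>q\<in>{1..\<kappa>}. (if q = l then a * (a' * (psg s l i * (psg s l j * (V k l * U i j)))) else 0)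
       - (if q = j then a' * (b * (psg s i j * (V k j * U i l))) else 0)
       - (if i = l then a * (b * (psg s i j * (V k q * U q j))) else 0)
       + (if i = j then b * (b * (V k q * U q l)) else 0))"
      unfolding second_mul[OF ijkl]
    proof (intro sum.cong HOL.refl)
      fix q assume q: "q \<in> {1..\<kappa>}"
      show "V k q * mat4_mul \<kappa> (Rop s a' b) (mat4_mul \<kappa> (first_factor s U) (Rop s a b)) i j q l =
       (if q = l then a * (a' * (psg s l i * (psg s l j * (V k l * U i j)))) else 0)
       - (if q = j then a' * (b * (psg s i j * (V k j * U i l))) else 0)
       - (if i = l then a * (b * (psg s i j * (V k q * U q j))) else 0)
       + (if i = j then b * (b * (V k q * U q l)) else 0)"
        unfolding Z[OF ijkl(1,2) q ijkl(4)] Z_def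
        by (auto simp: c right_diff_distrib distrib_left psg_sym psg_psg_commute)
    qed
    also have "\<dots> = a * (a' * (psg s l i * (psg s l j * (V k l * U i j)))) - a' * (b * (psg s i j * (V k j * U i l)))
     - a * (b * (if i = l then psg s i j * mat_mul \<kappa> V U k j else 0)) + b * (b * (if i = j then mat_mul \<kappa> V U k l else 0))"
      using ijkl by (simp add: sum_subtractf sum.distrib sum_distrib_left mat_mul_def)
    finally show ?thesis .
  qed
  show ?thesis unfolding L R by (auto simp: algebra_simps)
qed

lemma reflection_eq_entry:
  assumes "central a" "central a'" "central b" and refl: "reflection_eq \<kappa> s a a' b U V"
    and "i \<in> {1..\<kappa>}" "j \<in> {1..\<kappa>}" "k \<in> {1..\<kappa>}" "l \<in> {1..\<kappa>}"
  shows "a * (a' * (psg s k i * (psg s k j * (U i j * V k l)) - psg s l i * (psg s l j * (V k l * U i j))))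
    - a' * (b * (psg s i j * (U k j * V i l - V k j * U i l)))
    - a * (b * ((if k = j then psg s i j * mat_mul \<kappa> U V i l else 0) - (if i = l then psg s i j * mat_mul \<kappa> V U k j else 0)))
    + b * (b * (if i = j then mat_mul \<kappa> U V k l - mat_mul \<kappa> V U k l else 0)) = 0"
  unfolding reflection_sides[OF assms(1-3,5-8), symmetric] refl[unfolded reflection_eq_def] by simp

lemma reflection_eqI:
  assumes "central a" "central a'" "central b"
    and "\<And>i j k l. i \<in> {1..\<kappa>} \<Longrightarrow> j \<in> {1..\<kappa>} \<Longrightarrow> k \<in> {1..\<kappa>} \<Longrightarrow> l \<in> {1..\<kappa>} \<Longrightarrow> a * (a' * (psg s k i * (psg s k j * (U i j * V k l)) - psg s l i * (psg s l j * (V k l * U i j))))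
    - a' * (b * (psg s i j * (U k j * V i l - V k j * U i l)))
    - a * (b * ((if k = j then psg s i j * mat_mul \<kappa> U V i l else 0) - (if i = l then psg s i j * mat_mul \<kappa> V U k j else 0)))
    + b * (b * (if i = j then mat_mul \<kappa> U V k l - mat_mul \<kappa> V U k l else 0)) = 0"
  shows "reflection_eq \<kappa> s a a' b U V"
  unfolding reflection_eq_def
proof (rule mat4_mul_eqI)
  fix i j k l assume h: "i \<in> {1..\<kappa>}" "j \<in> {1..\<kappa>}" "k \<in> {1..\<kappa>}" "l \<in> {1..\<kappa>}"
  show "mat4_mul \<kappa> (Rop s a b) (mat4_mul \<kappa> (first_factor s U) (mat4_mul \<kappa> (Rop s a' b) (second_factor V))) i j k l =
    mat4_mul \<kappa> (second_factor V) (mat4_mul \<kappa> (Rop s a' b) (mat4_mul \<kappa> (first_factor s U) (Rop s a b))) i j k l"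
    using reflection_sides[OF assms(1-3) h, of s U V] assms(4)[OF h] by simp
qed

lemma central_fps_const: "central c \<Longrightarrow> central (fps_const c)"
  unfolding central_def by (auto simp: fps_eq_iff)

lemma central_fps_X: "central (fps_X :: 'a::ring_1 fps)"
  unfolding central_def by (simp add: fps_mult_fps_X_commute)

lemma central_XY: "central (XY a b)"
  unfolding XY_def by (intro central_mult central_fps_const central_power central_fps_X)

lemma XY_XY: "XY a b * (XY c d * F) = XY (a + c) (b + d) * F"
  by (auto simp: fps_eq_iff XY_mult_nth)

definition fps_neg_arg :: "'a::ring_1 fps \<Rightarrow> 'a fps" where
  "fps_neg_arg f = Abs_fps (\<lambda>n. (-1) ^ n * f $ n)"

abbreviation refl_XY :: "nat \<Rightarrow> (nat \<Rightarrow> int) \<Rightarrow> (nat \<Rightarrow> nat \<Rightarrow> 'a::ring_1 fps) \<Rightarrow> bool" where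
  "refl_XY \<kappa> s b \<equiv> reflection_eq \<kappa> s (XY 0 1 - XY 1 0) (XY 1 0 + XY 0 1) (XY 1 1)
      (\<lambda>i j. fps_const (b i j)) (\<lambda>i j. ser_in_Y (b i j))"

subsection \<open>Representations with a highest weight vector\<close>

text \<open>The highest weight vector is represented by its annihilator, a left ideal \<open>J\<close> of the
  ring of operators.\<close>

locale scalar_ring =
  fixes sc :: "complex \<Rightarrow> 'a::ring_1" and J :: "'a set"
  assumes sc_add: "sc (c + d) = sc c + sc d" and sc_mult: "sc (c * d) = sc c * sc d"
    and sc_1 [simp]: "sc 1 = 1" and sc_central: "central (sc c)"
    and J_0: "0 \<in> J" and J_add: "x \<in> J \<Longrightarrow> y \<in> J \<Longrightarrow> x + y \<in> J" and J_mult: "y \<in> J \<Longrightarrow> x * y \<in> J"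
    and J_proper: "1 \<notin> J"
begin

lemma sc_0 [simp]: "sc 0 = 0" using sc_add[of 0 0] by simp
lemma sc_minus: "sc (- c) = - sc c" using sc_add[of c "- c"] by (simp add: eq_neg_iff_add_eq_0 add.commute)
lemma sc_diff: "sc (c - d) = sc c - sc d" using sc_add[of c "- d"] by (simp add: sc_minus)
lemma sc_sum: "sc (sum f A) = (\<Sum>a\<in>A. sc (f a))"
  by (induction A rule: infinite_finite_induct) (auto simp: sc_add)
lemma sc_power: "sc (c ^ n) = sc c ^ n" by (induction n) (auto simp: sc_mult)
lemma sc_psign: "sc (psign s i j) = psg s i j"
  by (simp add: psign_def psg_def sc_power sc_minus)

lemma J_minus: "x \<in> J \<Longrightarrow> - x \<in> J" using J_mult[of x "-1"] by simp
lemma J_sum: "(\<And>a. a \<in> A \<Longrightarrow> f a \<in> J) \<Longrightarrow> sum f A \<in> J"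
  by (induction A rule: infinite_finite_induct) (auto simp: J_0 J_add)

definition hw_rep :: "nat \<Rightarrow> (nat \<Rightarrow> int) \<Rightarrow> (nat \<Rightarrow> int) \<Rightarrow> (nat \<Rightarrow> complex fps) \<Rightarrow> (nat \<Rightarrow> nat \<Rightarrow> 'a fps) \<Rightarrow> bool" where
  "hw_rep \<kappa> s \<epsilon> \<mu> b \<longleftrightarrow>
     (\<forall>i\<in>{1..\<kappa>}. \<forall>j\<in>{1..\<kappa>}. b i j $ 0 = (if i = j then sc (of_int (\<epsilon> i)) else 0)) \<and>
     refl_XY \<kappa> s b \<and>
     (\<forall>i\<in>{1..\<kappa>}. \<forall>j\<in>{1..\<kappa>}. mat_mul \<kappa> b (\<lambda>i j. fps_neg_arg (b i j)) i j = (if i = j then 1 else 0)) \<and>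
     (\<forall>i\<in>{1..\<kappa>}. \<forall>j\<in>{1..\<kappa>}. i < j \<longrightarrow> (\<forall>r. b i j $ r \<in> J)) \<and>
     (\<forall>i\<in>{1..\<kappa>}. \<forall>r. b i i $ r - sc (\<mu> i $ r) \<in> J)"

section \<open>Evaluating the free algebra in a representation\<close>

context
  fixes b :: "nat \<Rightarrow> nat \<Rightarrow> 'a fps"
begin

definition word_op :: "gen list \<Rightarrow> 'a" where
  "word_op w = prod_list (map (\<lambda>(i, j, r). b i j $ r) w)"

definition eval_free :: "falg \<Rightarrow> 'a" where
  "eval_free x = (\<Sum>w | x w \<noteq> 0. sc (x w) * word_op w)"

text \<open>\<open>falg\<close> also contains functions of infinite support, on which
  \<open>eval_free\<close> is meaningless. The generators of the ideals have finite support and the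
  closure rules preserve it.\<close>

definition finsupp :: "falg \<Rightarrow> bool" where "finsupp x \<longleftrightarrow> finite {w. x w \<noteq> 0}"

lemma eval_free_superset: "finite S \<Longrightarrow> {w. x w \<noteq> 0} \<subseteq> S \<Longrightarrow> eval_free x = (\<Sum>w\<in>S. sc (x w) * word_op w)"
  unfolding eval_free_def by (rule sum.mono_neutral_left) auto

lemma finsupp_0: "finsupp 0" by (simp add: finsupp_def)
lemma finsupp_fmon: "finsupp (fmon c w)"
  unfolding finsupp_def fmon_def by (rule finite_subset[of _ "{w}"]) auto
lemma finsupp_add: "finsupp x \<Longrightarrow> finsupp y \<Longrightarrow> finsupp (x + y)"
  unfolding finsupp_def by (rule finite_subset[of _ "{w. x w \<noteq> 0} \<union> {w. y w \<noteq> 0}"]) auto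
lemma finsupp_fscal: "finsupp x \<Longrightarrow> finsupp (fscal c x)"
  unfolding finsupp_def fscal_def by (rule finite_subset[of _ "{w. x w \<noteq> 0}"]) auto
lemma finsupp_diff: "finsupp x \<Longrightarrow> finsupp y \<Longrightarrow> finsupp (x - y)"
  unfolding finsupp_def by (rule finite_subset[of _ "{w. x w \<noteq> 0} \<union> {w. y w \<noteq> 0}"]) auto
lemma finsupp_sum: "(\<And>a. a \<in> A \<Longrightarrow> finsupp (f a)) \<Longrightarrow> finsupp (sum f A)"
  by (induction A rule: infinite_finite_induct) (simp_all only: sum.infinite sum.empty sum.insert finsupp_0 finsupp_add insertI1 insertI2 simp_thms)

lemma finsupp_if: "(P \<Longrightarrow> finsupp x) \<Longrightarrow> (\<not> P \<Longrightarrow> finsupp y) \<Longrightarrow> finsupp (if P then x else y)"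
  by simp

lemma eval_0: "eval_free 0 = 0" by (simp add: eval_free_def)

lemma eval_fmon: "eval_free (fmon c w) = sc c * word_op w"
  by (subst eval_free_superset[of "{w}"]) (auto simp: fmon_def)

lemma eval_add: "finsupp x \<Longrightarrow> finsupp y \<Longrightarrow> eval_free (x + y) = eval_free x + eval_free y"
  unfolding finsupp_def
  by (subst (1 2 3) eval_free_superset[of "{w. x w \<noteq> 0} \<union> {w. y w \<noteq> 0}"])
    (auto simp: sum.distrib sc_add distrib_right)

lemma eval_fscal: "finsupp x \<Longrightarrow> eval_free (fscal c x) = sc c * eval_free x"
  unfolding finsupp_def
  by (subst (1 2) eval_free_superset[of "{w. x w \<noteq> 0}"])
    (auto simp: fscal_def sc_mult sum_distrib_left mult.assoc)

lemma eval_diff: "finsupp x \<Longrightarrow> finsupp y \<Longrightarrow> eval_free (x - y) = eval_free x - eval_free y"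
  using eval_add[of "x - y" y] finsupp_diff[of x y] by simp

lemma eval_sum: "(\<And>a. a \<in> A \<Longrightarrow> finsupp (f a)) \<Longrightarrow> eval_free (sum f A) = (\<Sum>a\<in>A. eval_free (f a))"
  by (induction A rule: infinite_finite_induct) (simp_all only: sum.infinite sum.empty sum.insert eval_0 eval_add finsupp_sum insertI1 insertI2 simp_thms)

lemma finsupp_expand: "finsupp x \<Longrightarrow> x = (\<Sum>w | x w \<noteq> 0. fmon (x w) w)"
proof
  fix v
  assume "finsupp x"
  then have "finite {w. x w \<noteq> 0}" by (simp add: finsupp_def)
  then have "(\<Sum>w\<in>{w. x w \<noteq> 0}. if v = w then x w else 0) = x v" by (simp add: sum.delta')
  then show "x v = (\<Sum>w | x w \<noteq> 0. fmon (x w) w) v"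
    unfolding sum_fun_apply fmon_def by simp
qed

lemma fmul_expand:
  assumes "finsupp x" "finsupp y"
  shows "fmul x y = (\<Sum>v | x v \<noteq> 0. \<Sum>w | y w \<noteq> 0. fmon (x v * y w) (v @ w))"
proof -
  have "fmul x y = fmul (\<Sum>v | x v \<noteq> 0. fmon (x v) v) (\<Sum>w | y w \<noteq> 0. fmon (y w) w)"
    using finsupp_expand[OF assms(1)] finsupp_expand[OF assms(2)] by (rule arg_cong2)
  also have "\<dots> = (\<Sum>v | x v \<noteq> 0. \<Sum>w | y w \<noteq> 0. fmon (x v * y w) (v @ w))"
    unfolding fmul_sum(1) unfolding fmul_sum(2) fmul_fmon ..
  finally show ?thesis .
qed

lemma finsupp_fmul: "finsupp x \<Longrightarrow> finsupp y \<Longrightarrow> finsupp (fmul x y)"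
  by (simp only: fmul_expand) (intro finsupp_sum finsupp_fmon)

lemma eval_fmul: 
  assumes "finsupp x" "finsupp y"
  shows "eval_free (fmul x y) = eval_free x * eval_free y"
proof -
  have "eval_free (fmul x y) = (\<Sum>v | x v \<noteq> 0. \<Sum>w | y w \<noteq> 0. sc (x v * y w) * word_op (v @ w))"
    unfolding fmul_expand[OF assms] by (subst eval_sum, intro finsupp_sum finsupp_fmon)
      (intro sum.cong refl, subst eval_sum, rule finsupp_fmon, simp only: eval_fmon)
  also have "\<dots> = (\<Sum>v | x v \<noteq> 0. \<Sum>w | y w \<noteq> 0. sc (x v) * word_op v * (sc (y w) * word_op w))"
  proof (intro sum.cong refl)
    fix v w
    have "word_op (v @ w) = word_op v * word_op w" by (simp add: word_op_def)
    then show "sc (x v * y w) * word_op (v @ w) = sc (x v) * word_op v * (sc (y w) * word_op w)"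
      by (simp only: sc_mult mult.assoc centralD(2)[OF sc_central, of "word_op v"])
  qed
  also have "\<dots> = eval_free x * eval_free y"
    unfolding eval_free_def by (rule sum_product[symmetric])
  finally show ?thesis .
qed

lemma eval_two_sided:
  assumes "x \<in> two_sided_ideal \<kappa> G" "\<And>x. x \<in> G \<Longrightarrow> finsupp x \<and> eval_free x = 0"
  shows "finsupp x \<and> eval_free x = 0"
  using assms(1)
proof induction
  case (lmul x w c)
  then show ?case by (simp add: finsupp_fmul finsupp_fmon eval_fmul)
next
  case (rmul x w c)
  then show ?case by (simp add: finsupp_fmul finsupp_fmon eval_fmul)
next
  case zero
  show ?case unfolding fops by (simp only: finsupp_0 eval_0 simp_thms)
next
  case (add x y)
  then show ?case unfolding fops by (simp only: finsupp_add eval_add add_0 simp_thms)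
qed (rule assms(2))

lemma eval_left:
  assumes "x \<in> left_ideal \<kappa> G" "\<And>x. x \<in> G \<Longrightarrow> finsupp x \<and> eval_free x \<in> J"
  shows "finsupp x \<and> eval_free x \<in> J"
  using assms(1)
proof induction
  case (lmul x w c)
  then show ?case by (simp add: finsupp_fmul finsupp_fmon eval_fmul J_mult)
next
  case zero
  show ?case unfolding fops by (simp only: finsupp_0 eval_0 J_0 simp_thms)
next
  case (add x y)
  then show ?case unfolding fops by (simp only: finsupp_add eval_add J_add simp_thms)
qed (rule assms(2))

lemma eval_fone: "eval_free fone = 1"
  unfolding fone_fmon eval_fmon by (simp add: word_op_def)

context
  fixes \<kappa> :: nat and s \<epsilon> :: "nat \<Rightarrow> int" and \<mu> :: "nat \<Rightarrow> complex fps"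
  assumes s: "\<forall>i\<in>{1..\<kappa>}. s i = 1 \<or> s i = -1" and rep: "hw_rep \<kappa> s \<epsilon> \<mu> b"
begin

definition op_coef :: "nat \<Rightarrow> nat \<Rightarrow> int \<Rightarrow> 'a" where
  "op_coef i j t = (if t \<le> 0 then b i j $ nat (- t) else 0)"

lemma finsupp_bcoef: "finsupp (bcoef \<epsilon> i j t)"
  unfolding bcoef_def bU_def fops fgen_fmon fone_fmon
  by (simp add: finsupp_fmon finsupp_fscal finsupp_0)

lemma finsupp_bb: "finsupp (bb \<epsilon> i j k l m n)"
  unfolding bb_def by (intro finsupp_fmul finsupp_bcoef)

lemma eval_bcoef:
  assumes "i \<in> {1..\<kappa>}" "j \<in> {1..\<kappa>}"
  shows "eval_free (bcoef \<epsilon> i j t) = op_coef i j t"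
proof -
  have "b i j $ 0 = (if i = j then sc (of_int (\<epsilon> i)) else 0)"
    using rep assms unfolding hw_rep_def by blast
  then show ?thesis
    unfolding bcoef_def bU_def fops fgen_fmon fone_fmon op_coef_def
    by (simp add: eval_fmon eval_0 fscal_fmon word_op_def)
qed

lemma eval_bb:
  assumes "i \<in> {1..\<kappa>}" "j \<in> {1..\<kappa>}" "k \<in> {1..\<kappa>}" "l \<in> {1..\<kappa>}"
  shows "eval_free (bb \<epsilon> i j k l m n) = op_coef i j m * op_coef k l n"
  unfolding bb_def by (simp only: eval_fmul finsupp_bcoef eval_bcoef assms)

lemma ser2_op_coef:
  "ser2 (\<lambda>m n. op_coef i j m * op_coef k l n) = fps_const (b i j) * ser_in_Y (b k l)"
  "ser2 (\<lambda>m n. op_coef k l n * op_coef i j m) = ser_in_Y (b k l) * fps_const (b i j)"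
  by (simp_all add: fps_eq_iff op_coef_def ser_in_Y_def)

lemma ser2_psg: "ser2 (\<lambda>m n. psg s i j * F m n) = psg s i j * ser2 F" for F :: "int \<Rightarrow> int \<Rightarrow> 'a"
  unfolding psg_def by (cases "even (par s i * par s j)") (simp_all add: minus_one_power_iff fps_eq_iff)

lemma eval_comp_rel:
  assumes ijkl: "i \<in> {1..\<kappa>}" "j \<in> {1..\<kappa>}" "k \<in> {1..\<kappa>}" "l \<in> {1..\<kappa>}"
  shows "finsupp (comp_rel \<kappa> s \<epsilon> i j k l m n) \<and> eval_free (comp_rel \<kappa> s \<epsilon> i j k l m n) = 0"
proof -
  note fin = finsupp_bb finsupp_diff finsupp_add finsupp_fscal finsupp_sum finsupp_0
  define G1 where "G1 = (\<lambda>m n. psg s k i * (psg s k j * (op_coef i j m * op_coef k l n)) - psg s l i * (psg s l j * (op_coef k l n * op_coef i j m)))"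
  define G2 where "G2 = (\<lambda>m n. psg s i j * (op_coef k j m * op_coef i l n - op_coef k j n * op_coef i l m))"
  define G3 where "G3 = (\<lambda>m n. (if k = j then psg s i j * (\<Sum>c\<in>{1..\<kappa>}. op_coef i c m * op_coef c l n) else 0)
     - (if i = l then psg s i j * (\<Sum>c\<in>{1..\<kappa>}. op_coef k c n * op_coef c j m) else 0))"
  define G4 where "G4 = (\<lambda>m n. if i = j then (\<Sum>c\<in>{1..\<kappa>}. op_coef k c m * op_coef c l n) - (\<Sum>c\<in>{1..\<kappa>}. op_coef k c n * op_coef c l m) else 0)"
  have ev: "eval_free (comp_rel \<kappa> s \<epsilon> i j k l m n) =
     G1 (m - 2) n - G1 m (n - 2) - (G2 (m - 1) n + G2 m (n - 1)) - (G3 (m - 1) n - G3 m (n - 1)) + G4 m n" for m n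
  proof -
    let ?F1 = "\<lambda>m n. fscal (psign s k i * psign s k j) (bb \<epsilon> i j k l m n) - fscal (psign s l i * psign s l j) (bb \<epsilon> k l i j n m)"
    let ?F2 = "\<lambda>m n. fscal (psign s i j) (bb \<epsilon> k j i l m n - bb \<epsilon> k j i l n m)"
    let ?F3 = "\<lambda>m n. (if k = j then fscal (psign s i j) (\<Sum>c\<in>{1..\<kappa>}. bb \<epsilon> i c c l m n) else 0)
                 - (if i = l then fscal (psign s i j) (\<Sum>c\<in>{1..\<kappa>}. bb \<epsilon> k c c j n m) else 0)"
    let ?F4 = "\<lambda>m n. if i = j then (\<Sum>c\<in>{1..\<kappa>}. bb \<epsilon> k c c l m n) - (\<Sum>c\<in>{1..\<kappa>}. bb \<epsilon> k c c l n m) else 0"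
    have f: "finsupp (?F1 m n)" "finsupp (?F2 m n)" "finsupp (?F3 m n)" "finsupp (?F4 m n)" for m n
      by (intro fin finsupp_if)+
    have sum: "eval_free (\<Sum>c\<in>{1..\<kappa>}. bb \<epsilon> p c c q m n) = (\<Sum>c\<in>{1..\<kappa>}. op_coef p c m * op_coef c q n)"
      if "p \<in> {1..\<kappa>}" "q \<in> {1..\<kappa>}" for p q m n
      using that by (subst eval_sum) (auto simp: eval_bb finsupp_bb intro!: sum.cong)
    have e: "eval_free (?F1 m n) = G1 m n" "eval_free (?F2 m n) = G2 m n" "eval_free (?F3 m n) = G3 m n" "eval_free (?F4 m n) = G4 m n" for m n
      unfolding G1_def G2_def G3_def G4_def
         apply (simp only: eval_diff eval_fscal fin eval_bb ijkl sc_mult sc_psign mult.assoc)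
        apply (simp only: eval_diff eval_fscal fin eval_bb ijkl sc_mult sc_psign mult.assoc)
       apply (cases "k = j"; cases "i = l"; simp only: if_True if_False eval_diff eval_fscal fin eval_0 sum ijkl sc_psign simp_thms)
      apply (cases "i = j"; simp only: if_True if_False eval_diff fin eval_0 sum ijkl simp_thms)
      done
    show ?thesis
      unfolding comp_rel_def Let_def
      by (simp only: eval_diff eval_add finsupp_diff finsupp_add f e)
  qed
  have pos: "op_coef i j m * op_coef k l n = 0" if "m > 0 \<or> n > 0" for i j k l m n
    using that by (auto simp: op_coef_def)
  have vanish: "G1 m n = 0" "G2 m n = 0" "G3 m n = 0" "G4 m n = 0" if "m > 0 \<or> n > 0" for m n
  proof -
    from that have that': "n > 0 \<or> m > 0" by blast
    show "G1 m n = 0" "G2 m n = 0" "G3 m n = 0" "G4 m n = 0"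
      unfolding G1_def G2_def G3_def G4_def by (simp_all add: pos[OF that] pos[OF that'])
  qed
  let ?U = "\<lambda>i j. fps_const (b i j)" and ?V = "\<lambda>i j. ser_in_Y (b i j)"
  have S: "ser2 G1 = psg s k i * (psg s k j * (?U i j * ?V k l)) - psg s l i * (psg s l j * (?V k l * ?U i j))"
    "ser2 G2 = psg s i j * (?U k j * ?V i l - ?V k j * ?U i l)"
    "ser2 G3 = (if k = j then psg s i j * mat_mul \<kappa> ?U ?V i l else 0) - (if i = l then psg s i j * mat_mul \<kappa> ?V ?U k j else 0)"
    "ser2 G4 = (if i = j then mat_mul \<kappa> ?U ?V k l - mat_mul \<kappa> ?V ?U k l else 0)"
    unfolding G1_def G2_def G3_def G4_def mat_mul_def
    by (auto simp: ser2_linear ser2_psg ser2_op_coef ser2_sum ser2_zero)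
  have refl: "refl_XY \<kappa> s b" using rep by (simp add: hw_rep_def)
  \<comment> \<open>The entry of the reflection equation has coefficients (Y - X)(X + Y), (X + Y) X
    Y, (Y - X) X Y and (X Y)^2; expanded, these are the monomials of
    \<open>ser2_relation\<close>.\<close>
  have "XY 0 2 * ser2 G1 - XY 2 0 * ser2 G1 - (XY 1 2 * ser2 G2 + XY 2 1 * ser2 G2)
      - (XY 1 2 * ser2 G3 - XY 2 1 * ser2 G3) + XY 2 2 * ser2 G4 = 0"
    using reflection_eq_entry[OF _ _ central_XY refl ijkl, folded S]
    by (simp add: central_XY central_add central_diff left_diff_distrib right_diff_distrib distrib_left distrib_right XY_XY numeral_2_eq_2 algebra_simps)
  then have "\<forall>m n. G1 (m - 2) n - G1 m (n - 2) - (G2 (m - 1) n + G2 m (n - 1)) - (G3 (m - 1) n - G3 m (n - 1)) + G4 m n = 0"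
    by (subst ser2_relation) (use vanish in auto)
  moreover have "finsupp (comp_rel \<kappa> s \<epsilon> i j k l m n)"
    unfolding comp_rel_def Let_def by (intro fin finsupp_if)
  ultimately show ?thesis using ev by simp
qed

lemma eval_unit_comp:
  assumes ij: "i \<in> {1..\<kappa>}" "j \<in> {1..\<kappa>}"
  shows "finsupp (unit_comp \<kappa> \<epsilon> i j m) \<and> eval_free (unit_comp \<kappa> \<epsilon> i j m) = 0"
proof -
  note fin = finsupp_bb finsupp_fscal finsupp_sum finsupp_0 finsupp_fmon
  let ?S = "\<lambda>a. \<Sum>t\<in>{m..0}. fscal ((-1) ^ nat (t - m)) (bb \<epsilon> i a a j t (m - t))"
  have fS: "finsupp (?S a)" for a by (intro fin)
  have f1: "finsupp (if i = j \<and> m = 0 then fone else 0)" by (simp add: fone_fmon fin)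
  have "eval_free (unit_comp \<kappa> \<epsilon> i j m) = (\<Sum>a\<in>{1..\<kappa>}. \<Sum>t\<in>{m..0}. (-1) ^ nat (t - m) * (op_coef i a t * op_coef a j (m - t)))
     - (if i = j \<and> m = 0 then 1 else 0)"
  proof -
    have "eval_free (?S a) = (\<Sum>t\<in>{m..0}. (-1) ^ nat (t - m) * (op_coef i a t * op_coef a j (m - t)))" if "a \<in> {1..\<kappa>}" for a
      using that ij by (subst eval_sum) (auto simp: fin eval_fscal eval_bb sc_power sc_minus intro!: sum.cong)
    moreover have "eval_free (if i = j \<and> m = 0 then fone else 0) = (if i = j \<and> m = 0 then 1 else 0)"
      by (simp only: eval_fone eval_0 split: if_splits) simp
    ultimately show ?thesis
      unfolding unit_comp_def by (subst eval_diff[OF finsupp_sum[OF fS] f1], subst eval_sum[OF fS]) simp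
  qed
  also have "\<dots> = 0"
  proof (cases "m > 0")
    case True
    then show ?thesis by simp
  next
    case False
    define N where "N = nat (- m)"
    have m: "m = - int N" using False by (simp add: N_def)
    have "(\<Sum>t\<in>{m..0}. (-1) ^ nat (t - m) * (op_coef i a t * op_coef a j (m - t))) =
        (b i a * fps_neg_arg (b a j)) $ N" for a
    proof -
      have "(\<Sum>t\<in>{m..0}. (-1) ^ nat (t - m) * (op_coef i a t * op_coef a j (m - t))) =
         (\<Sum>r=0..N. (-1) ^ (N - r) * (b i a $ r * b a j $ (N - r)))"
        by (rule sum.reindex_bij_witness[of _ "\<lambda>r. - int r" "\<lambda>t. nat (- t)"])
          (auto simp: m op_coef_def nat_diff_distrib' of_nat_diff intro!: arg_cong2[where f = "(*)"] arg_cong2[where f = "(^)"] arg_cong2[where f = "fps_nth"])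
      also have "\<dots> = (\<Sum>r=0..N. b i a $ r * ((-1) ^ (N - r) * b a j $ (N - r)))"
        by (intro sum.cong HOL.refl) (simp add: minus_one_power_iff)
      finally show ?thesis by (simp add: fps_mult_nth fps_neg_arg_def)
    qed
    then have "(\<Sum>a\<in>{1..\<kappa>}. \<Sum>t\<in>{m..0}. (-1) ^ nat (t - m) * (op_coef i a t * op_coef a j (m - t))) =
       mat_mul \<kappa> b (\<lambda>i j. fps_neg_arg (b i j)) i j $ N"
      by (simp add: mat_mul_def fps_sum_nth)
    also have "\<dots> = (if i = j then 1 else 0) $ N"
      using rep ij unfolding hw_rep_def by simp
    finally show ?thesis by (simp add: m)
  qed
  finally show ?thesis
    unfolding unit_comp_def by (intro conjI finsupp_diff f1 finsupp_sum[OF fS])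
qed

text \<open>Evaluation kills the defining relations and sends the Verma generators into J, so a
  derivation of 1 in the left ideal would put 1 into J.\<close>

theorem hw_rep_nontrivial: "verma_nontrivial \<kappa> s \<epsilon> \<mu>"
proof -
  have rels: "finsupp x \<and> eval_free x = 0" if "x \<in> defining_rels \<kappa> s \<epsilon>" for x
    using that unfolding defining_rels_def
  proof
    assume "x \<in> {refl_rel \<kappa> s \<epsilon> i j k l m n |i j k l m n. i \<in> {1..\<kappa>} \<and> j \<in> {1..\<kappa>} \<and> k \<in> {1..\<kappa>} \<and> l \<in> {1..\<kappa>}}"
    then obtain i j k l m n where x: "x = refl_rel \<kappa> s \<epsilon> i j k l m n"
      and ijkl: "i \<in> {1..\<kappa>}" "j \<in> {1..\<kappa>}" "k \<in> {1..\<kappa>}" "l \<in> {1..\<kappa>}" by blast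
    show ?thesis unfolding x refl_rel_comp[OF s ijkl]
      using eval_comp_rel[OF ijkl] by (simp add: finsupp_fscal eval_fscal)
  next
    assume "x \<in> {unit_rel \<kappa> s \<epsilon> i j k l m n |i j k l m n. i \<in> {1..\<kappa>} \<and> j \<in> {1..\<kappa>} \<and> k \<in> {1..\<kappa>} \<and> l \<in> {1..\<kappa>}}"
    then obtain i j k l m n where x: "x = unit_rel \<kappa> s \<epsilon> i j k l m n"
      and ijkl: "i \<in> {1..\<kappa>}" "j \<in> {1..\<kappa>}" "k \<in> {1..\<kappa>}" "l \<in> {1..\<kappa>}" by blast
    show ?thesis unfolding x unit_rel_comp[OF s ijkl]
      using eval_unit_comp[OF ijkl(1,2)] by (auto simp: finsupp_fscal eval_fscal finsupp_0 eval_0)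
  qed
  have verma: "finsupp x \<and> eval_free x \<in> J" if "x \<in> verma_gens \<kappa> \<epsilon> \<mu>" for x
  proof -
    have r: "\<And>i j r. \<lbrakk>i \<in> {1..\<kappa>}; j \<in> {1..\<kappa>}; i < j\<rbrakk> \<Longrightarrow> b i j $ r \<in> J" "\<And>i r. i \<in> {1..\<kappa>} \<Longrightarrow> b i i $ r - sc (\<mu> i $ r) \<in> J"
      and b0: "\<And>i. i \<in> {1..\<kappa>} \<Longrightarrow> b i i $ 0 = sc (of_int (\<epsilon> i))"
      using rep unfolding hw_rep_def by simp_all
    from that consider (up) i j r where "x = fgen (i, j, r)" "1 \<le> i" "i < j" "j \<le> \<kappa>"
      | (diag) i r where "x = fsub (fgen (i, i, r)) (fscal (\<mu> i $ r) fone)" "1 \<le> i" "i \<le> \<kappa>"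
      | (const) i where "x = fscal (of_int (\<epsilon> i) - \<mu> i $ 0) fone" "1 \<le> i" "i \<le> \<kappa>"
      unfolding verma_gens_def by blast
    then show ?thesis
    proof cases
      case up
      then show ?thesis using r(1)[of i j r] by (simp add: fgen_fmon finsupp_fmon eval_fmon word_op_def)
    next
      case diag
      have "eval_free x = b i i $ r - sc (\<mu> i $ r)"
        unfolding diag(1) fops fgen_fmon fone_fmon fscal_fmon
        by (subst eval_diff[OF finsupp_fmon finsupp_fmon]) (simp add: eval_fmon word_op_def)
      moreover have "finsupp x"
        unfolding diag(1) fops fgen_fmon fone_fmon fscal_fmon by (intro finsupp_diff finsupp_fmon)
      ultimately show ?thesis using r(2)[of i r] diag by simp
    next
      case const
      have "eval_free x = b i i $ 0 - sc (\<mu> i $ 0)"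
        unfolding const(1) fone_fmon fscal_fmon using const b0[of i] by (simp add: eval_fmon word_op_def sc_diff)
      then show ?thesis using r(2)[of i 0] const by (simp add: fone_fmon fscal_fmon finsupp_fmon)
    qed
  qed
  have "finsupp x \<and> eval_free x \<in> J" if "x \<in> left_ideal \<kappa> (two_sided_ideal \<kappa> (defining_rels \<kappa> s \<epsilon>) \<union> verma_gens \<kappa> \<epsilon> \<mu>)" for x
    using that
  proof (rule eval_left)
    fix x assume "x \<in> two_sided_ideal \<kappa> (defining_rels \<kappa> s \<epsilon>) \<union> verma_gens \<kappa> \<epsilon> \<mu>"
    then show "finsupp x \<and> eval_free x \<in> J"
      using verma eval_two_sided[OF _ rels] J_0 by (metis UnE)
  qed
  then show ?thesis unfolding verma_nontrivial_def using eval_fone J_proper by metis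
qed

end

end

end

section \<open>Dependence of the left ideal on finitely many weight coefficients\<close>

lemma left_ideal_truncate:
  assumes "x \<in> left_ideal \<kappa> (T \<union> verma_gens \<kappa> \<epsilon> \<mu>)"
  shows "\<exists>N. \<forall>\<mu>'. (\<forall>i\<in>{1..\<kappa>}. \<forall>r\<le>N. \<mu>' i $ r = \<mu> i $ r) \<longrightarrow> x \<in> left_ideal \<kappa> (T \<union> verma_gens \<kappa> \<epsilon> \<mu>')"
  using assms
proof induction
  case (gen x)
  then consider "x \<in> T" | (up) i j r where "x = fgen (i, j, r)" "1 \<le> i" "i < j" "j \<le> \<kappa>" "1 \<le> r"
      | (diag) i r where "x = fsub (fgen (i, i, r)) (fscal (\<mu> i $ r) fone)" "1 \<le> i" "i \<le> \<kappa>" "1 \<le> r"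
      | (const) i where "x = fscal (of_int (\<epsilon> i) - \<mu> i $ 0) fone" "1 \<le> i" "i \<le> \<kappa>"
      unfolding verma_gens_def by blast
  then show ?case
  proof cases
    case 1
    then show ?thesis by (auto intro: left_ideal.gen)
  next
    case up
    then have "x \<in> verma_gens \<kappa> \<epsilon> \<mu>'" for \<mu>' unfolding verma_gens_def by blast
    then show ?thesis by (intro exI allI impI left_ideal.gen UnI2)
  next
    case diag
    show ?thesis
    proof (intro exI[of _ r] allI impI left_ideal.gen UnI2)
      fix \<mu>' assume "\<forall>i\<in>{1..\<kappa>}. \<forall>r'\<le>r. \<mu>' i $ r' = \<mu> i $ r'"
      then have "\<mu>' i $ r = \<mu> i $ r" using diag by auto
      with diag(1) have x: "x = fsub (fgen (i, i, r)) (fscal (\<mu>' i $ r) fone)" by simp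
      show "x \<in> verma_gens \<kappa> \<epsilon> \<mu>'" unfolding verma_gens_def using diag(2-) x by blast
    qed
  next
    case const
    show ?thesis
    proof (intro exI[of _ 0] allI impI left_ideal.gen UnI2)
      fix \<mu>' assume "\<forall>i\<in>{1..\<kappa>}. \<forall>r'\<le>0. \<mu>' i $ r' = \<mu> i $ r'"
      then have "\<mu>' i $ 0 = \<mu> i $ 0" using const by auto
      with const(1) have x: "x = fscal (of_int (\<epsilon> i) - \<mu>' i $ 0) fone" by simp
      show "x \<in> verma_gens \<kappa> \<epsilon> \<mu>'" unfolding verma_gens_def using const(2-) x by blast
    qed
  qed
next
  case zero
  then show ?case by (auto intro: left_ideal.zero)
next
  case (add x y)
  then obtain N M where N: "\<And>\<mu>'. (\<forall>i\<in>{1..\<kappa>}. \<forall>r\<le>N. \<mu>' i $ r = \<mu> i $ r) \<Longrightarrow> x \<in> left_ideal \<kappa> (T \<union> verma_gens \<kappa> \<epsilon> \<mu>')"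
    and M: "\<And>\<mu>'. (\<forall>i\<in>{1..\<kappa>}. \<forall>r\<le>M. \<mu>' i $ r = \<mu> i $ r) \<Longrightarrow> y \<in> left_ideal \<kappa> (T \<union> verma_gens \<kappa> \<epsilon> \<mu>')" by blast
  show ?case
    \<comment> \<open>A derivation is finite, so the generators at its leaves bound the coefficients
      that matter.\<close>
    by (intro exI[of _ "max N M"] allI impI left_ideal.add N M) auto
next
  case (lmul x w c)
  then show ?case by (blast intro: left_ideal.lmul)
qed

lemma verma_nontrivial_approx:
  assumes "\<And>N. \<exists>\<mu>'. (\<forall>i\<in>{1..\<kappa>}. \<forall>r\<le>N. \<mu>' i $ r = \<mu> i $ r) \<and> verma_nontrivial \<kappa> s \<epsilon> \<mu>'"
  shows "verma_nontrivial \<kappa> s \<epsilon> \<mu>"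
  unfolding verma_nontrivial_def
proof
  assume "fone \<in> left_ideal \<kappa> (two_sided_ideal \<kappa> (defining_rels \<kappa> s \<epsilon>) \<union> verma_gens \<kappa> \<epsilon> \<mu>)"
  from left_ideal_truncate[OF this] assms show False unfolding verma_nontrivial_def by blast
qed

subsection \<open>Oscillators on a Fock space\<close>

type_synonym fock = "(nat \<Rightarrow> int) \<Rightarrow> complex"

text \<open>Linear maps form a type of their own, so that \<open>ring_1\<close> can be instantiated
  and power series over them make sense. The single axiom contains additivity (c = 1) and, since c =
  -1 gives F 0 = 0, also homogeneity.\<close>

typedef fock_op = "{F :: fock \<Rightarrow> fock. \<forall>x y c. F (\<lambda>n. x n + c * y n) = (\<lambda>n. F x n + c * F y n)}"
  morphisms apply_op Fock_op
  by (rule exI[of _ "\<lambda>x. x"]) simp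

setup_lifting type_definition_fock_op

instantiation fock_op :: ring_1
begin

lift_definition zero_fock_op :: fock_op is "\<lambda>x n. 0" by simp
lift_definition one_fock_op :: fock_op is "\<lambda>x. x" by simp
lift_definition plus_fock_op :: "fock_op \<Rightarrow> fock_op \<Rightarrow> fock_op" is "\<lambda>F G x n. F x n + G x n"
  by (simp add: algebra_simps)
lift_definition minus_fock_op :: "fock_op \<Rightarrow> fock_op \<Rightarrow> fock_op" is "\<lambda>F G x n. F x n - G x n"
  by (simp add: algebra_simps)
lift_definition uminus_fock_op :: "fock_op \<Rightarrow> fock_op" is "\<lambda>F x n. - F x n"
  by (simp add: algebra_simps)
lift_definition times_fock_op :: "fock_op \<Rightarrow> fock_op \<Rightarrow> fock_op" is "\<lambda>F G x. F (G x)"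
  by simp

instance
proof
  fix a b c :: fock_op
  show "a * b * c = a * (b * c)" by transfer simp
  show "1 * a = a" "a * 1 = a" by (transfer, simp)+
  show "a + b + c = a + (b + c)" "a + b = b + a" "0 + a = a" "- a + a = 0" "a - b = a + - b"
    by (transfer, simp add: algebra_simps)+
  show "(a + b) * c = a * c + b * c" by transfer simp
  show "a * (b + c) = a * b + a * c"
  proof transfer
    fix F G H :: "fock \<Rightarrow> fock"
    assume F: "\<forall>x y c. F (\<lambda>n. x n + c * y n) = (\<lambda>n. F x n + c * F y n)"
    show "(\<lambda>x. F (\<lambda>n. G x n + H x n)) = (\<lambda>x n. F (G x) n + F (H x) n)"
      using F[rule_format, of _ 1] by simp
  qed
  show "(0 :: fock_op) \<noteq> 1"
  proof transfer
    show "(\<lambda>(x :: fock) n. 0) \<noteq> (\<lambda>x. x)"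
    proof
      assume eq: "(\<lambda>(x :: fock) n. 0) = (\<lambda>x. x)"
      have "(\<lambda>n :: nat \<Rightarrow> int. 0 :: complex) = (\<lambda>n. 1)" by (rule fun_cong[OF eq])
      then show False by (metis zero_neq_one)
    qed
  qed
qed

end

text \<open>Weighted pullback along f. All oscillators have this shape and products keep it, so
  operator identities reduce to identities of weights and, where the weight is nonzero, of
  maps.\<close>

lift_definition wshift :: "((nat \<Rightarrow> int) \<Rightarrow> complex) \<Rightarrow> ((nat \<Rightarrow> int) \<Rightarrow> (nat \<Rightarrow> int)) \<Rightarrow> fock_op"
  is "\<lambda>w f x n. w n * x (f n)" by (simp add: algebra_simps)

lemma wshift_mult: "wshift w f * wshift w' f' = wshift (\<lambda>n. w n * w' (f n)) (\<lambda>n. f' (f n))"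
  by transfer (simp add: mult.assoc)

lemma wshift_add: "wshift w f + wshift w' f = wshift (\<lambda>n. w n + w' n) f"
  by transfer (simp add: algebra_simps)

lemma wshift_uminus: "- wshift w f = wshift (\<lambda>n. - w n) f"
  by transfer simp

lemma wshift_one: "1 = wshift (\<lambda>_. 1) (\<lambda>n. n)"
  by transfer simp

lemma wshift_zero: "(\<And>n. w n = 0) \<Longrightarrow> wshift w f = 0"
  by transfer simp

lemma wshift_eqI: "(\<And>n. w n = w' n) \<Longrightarrow> (\<And>n. w n \<noteq> 0 \<Longrightarrow> f n = f' n) \<Longrightarrow> wshift w f = wshift w' f'"
  by transfer (metis mult_eq_0_iff)

definition fock_scalar :: "complex \<Rightarrow> fock_op" where
  "fock_scalar c = wshift (\<lambda>_. c) (\<lambda>n. n)"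

definition vacuum :: fock where "vacuum = (\<lambda>n. if n = (\<lambda>_. 0) then 1 else 0)"

definition vacuum_ann :: "fock_op set" where
  "vacuum_ann = {F. apply_op F vacuum = (\<lambda>_. 0)}"

interpretation fock: scalar_ring fock_scalar vacuum_ann
proof
  fix c d :: complex and x y :: fock_op
  show "fock_scalar (c + d) = fock_scalar c + fock_scalar d" "fock_scalar (c * d) = fock_scalar c * fock_scalar d"
    "fock_scalar 1 = 1"
    unfolding fock_scalar_def by (simp_all add: wshift_mult wshift_add wshift_one)
  have zero: "apply_op F (\<lambda>_. 0) = (\<lambda>_. 0)" for F
  proof transfer
    fix F :: "fock \<Rightarrow> fock"
    assume F: "\<forall>x y c. F (\<lambda>n. x n + c * y n) = (\<lambda>n. F x n + c * F y n)"
    show "F (\<lambda>_. 0) = (\<lambda>_. 0)" using F[rule_format, of "\<lambda>_. 0" "-1" "\<lambda>_. 0"] by simp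
  qed
  show "central (fock_scalar c)"
    unfolding central_def fock_scalar_def
  proof (intro allI)
    fix F
    show "F * wshift (\<lambda>_. c) (\<lambda>n. n) = wshift (\<lambda>_. c) (\<lambda>n. n) * F"
    proof transfer
      fix F :: "fock \<Rightarrow> fock" and c
      assume F: "\<forall>x y c. F (\<lambda>n. x n + c * y n) = (\<lambda>n. F x n + c * F y n)"
      have "F (\<lambda>_. 0) = (\<lambda>_. 0)" using F[rule_format, of "\<lambda>_. 0" "-1" "\<lambda>_. 0"] by simp
      then show "(\<lambda>x. F (\<lambda>n. c * x n)) = (\<lambda>x n. c * F x n)"
        using F[rule_format, of "\<lambda>_. 0" c] by simp
    qed
  qed
  show "0 \<in> vacuum_ann" "x \<in> vacuum_ann \<Longrightarrow> y \<in> vacuum_ann \<Longrightarrow> x + y \<in> vacuum_ann"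
    unfolding vacuum_ann_def by (simp_all add: zero_fock_op.rep_eq plus_fock_op.rep_eq)
  show "y \<in> vacuum_ann \<Longrightarrow> x * y \<in> vacuum_ann"
    unfolding vacuum_ann_def by (simp add: times_fock_op.rep_eq zero)
  show "1 \<notin> vacuum_ann"
    unfolding vacuum_ann_def by (auto simp: one_fock_op.rep_eq vacuum_def dest!: fun_cong[of _ _ "\<lambda>_. 0"])
qed

text \<open>Even modes are bosonic and odd modes fermionic, the latter with Jordan--Wigner signs.
  Occupation numbers range over all integers; the weight of \<open>annihilate\<close> vanishes at the
  vacuum boundary.\<close>

definition jw_sign :: "nat \<Rightarrow> (nat \<Rightarrow> int) \<Rightarrow> complex" where
  "jw_sign t n = (\<Prod>r<t. if odd r \<and> odd (n r) then -1 else 1)"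

text \<open>Evaluated at the occupation after the step, because \<open>wshift\<close> pulls back: an
  odd creator has to end in an occupied state, an odd annihilator in an empty one, and a bosonic
  annihilator carries the previous occupation \<open>n t + 1\<close>. An odd mode counts as occupied
  when \<open>n t\<close> is odd.\<close>

definition osc_weight :: "bool \<Rightarrow> nat \<Rightarrow> (nat \<Rightarrow> int) \<Rightarrow> complex" where
  "osc_weight k t n = (if odd t then (if odd (n t) = k then jw_sign t n else 0) else if k then 1 else of_int (n t + 1))"

definition osc :: "bool \<Rightarrow> nat \<Rightarrow> fock_op" where
  "osc k t = wshift (osc_weight k t) (\<lambda>n. n(t := n t + (if k then -1 else 1)))"

abbreviation create :: "nat \<Rightarrow> fock_op" where "create \<equiv> osc True"
abbreviation annihilate :: "nat \<Rightarrow> fock_op" where "annihilate \<equiv> osc False"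

definition mode_sign :: "nat \<Rightarrow> nat \<Rightarrow> 'a::ring_1" where
  "mode_sign t r = (if odd t \<and> odd r then -1 else 1)"

lemma jw_sign_square [simp]: "jw_sign t n * jw_sign t n = 1"
  unfolding jw_sign_def prod.distrib[symmetric] by (rule prod.neutral) auto

lemma jw_sign_upd_ge [simp]: "t \<le> r \<Longrightarrow> jw_sign t (n(r := v)) = jw_sign t n"
  unfolding jw_sign_def by (rule prod.cong) auto

lemma jw_sign_upd_less:
  assumes "r < t" "odd v \<noteq> odd (n r)"
  shows "jw_sign t (n(r := v)) = (if odd r then - jw_sign t n else jw_sign t n)"
proof -
  have "{..<t} = insert r ({..<t} - {r})" using assms by auto
  then have split: "(\<Prod>q<t. f q) = f r * (\<Prod>q\<in>{..<t}-{r}. f q)" for f :: "nat \<Rightarrow> complex"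
    by (metis finite_Diff finite_lessThan insert_Diff_if Diff_iff insertI1 prod.insert)
  have "(\<Prod>q\<in>{..<t}-{r}. if odd q \<and> odd ((n(r := v)) q) then -1 else 1 :: complex) =
    (\<Prod>q\<in>{..<t}-{r}. if odd q \<and> odd (n q) then -1 else 1)"
    by (rule prod.cong) auto
  then show ?thesis unfolding jw_sign_def split using assms(2) by auto
qed

text \<open>Of two odd modes only the higher one has the other in its Jordan-Wigner string. A step
  of the lower mode flips the parity there and so changes exactly one sign.\<close>

lemma osc_supercommute:
  assumes "t \<noteq> r"
  shows "osc k t * osc l r = mode_sign t r * (osc l r * osc k t)"
proof -
  let ?sh = "\<lambda>k t n. n(t := n t + (if k then -1 else 1)) :: nat \<Rightarrow> int"
  have w: "osc_weight k t n * osc_weight l r (?sh k t n) =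
      (if odd t \<and> odd r then -1 else 1) * (osc_weight l r n * osc_weight k t (?sh l r n))" for n
  proof (cases "odd t \<and> odd r")
    case True
    show ?thesis
    proof (cases "t < r")
      case True
      then show ?thesis using \<open>odd t \<and> odd r\<close> by (simp add: osc_weight_def jw_sign_upd_less)
    next
      case False
      then have "r < t" using assms by simp
      then show ?thesis using \<open>odd t \<and> odd r\<close> by (simp add: osc_weight_def jw_sign_upd_less)
    qed
  next
    case False
    have *: "jw_sign t (?sh l r n) = jw_sign t n" if "even r"
      using that assms jw_sign_upd_less[of r t] by (cases "r < t") auto
    have **: "jw_sign r (?sh k t n) = jw_sign r n" if "even t"
      using that assms jw_sign_upd_less[of t r] by (cases "t < r") auto
    show ?thesis using False assms * ** by (auto simp: osc_weight_def)
  qed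
  have c: "?sh l r (?sh k t n) = ?sh k t (?sh l r n)" for n
    using assms by (auto simp: fun_upd_twist)
  have "osc k t * osc l r = wshift (\<lambda>n. (if odd t \<and> odd r then -1 else 1) * (osc_weight l r n * osc_weight k t (?sh l r n)))
     (\<lambda>n. ?sh k t (?sh l r n))"
    unfolding osc_def wshift_mult by (rule wshift_eqI) (use w c in auto)
  also have "\<dots> = mode_sign t r * (osc l r * osc k t)"
    unfolding osc_def wshift_mult mode_sign_def by (auto simp: wshift_uminus)
  finally show ?thesis .
qed

lemma osc_self: "osc k t * osc k t = mode_sign t t * (osc k t * osc k t)"
proof (cases "odd t")
  case True
  have "osc k t * osc k t = 0"
    unfolding osc_def wshift_mult by (rule wshift_zero) (use True in \<open>auto simp: osc_weight_def\<close>)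
  then show ?thesis by simp
qed (simp add: mode_sign_def)

lemma annihilate_create: "annihilate t * create t = mode_sign t t * (create t * annihilate t) + 1"
proof -
  have "annihilate t * create t = wshift (\<lambda>n. osc_weight False t n * osc_weight True t (n(t := n t + 1))) (\<lambda>n. n)"
    unfolding osc_def wshift_mult by (rule wshift_eqI) auto
  moreover have "create t * annihilate t = wshift (\<lambda>n. osc_weight True t n * osc_weight False t (n(t := n t - 1))) (\<lambda>n. n)"
    unfolding osc_def wshift_mult by (rule wshift_eqI) auto
  moreover have "wshift (\<lambda>n. osc_weight False t n * osc_weight True t (n(t := n t + 1))) (\<lambda>n. n) =
    wshift (\<lambda>n. (if odd t then -1 else 1) * (osc_weight True t n * osc_weight False t (n(t := n t - 1))) + 1) (\<lambda>n. n)"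
    by (rule wshift_eqI) (auto simp: osc_weight_def)
  moreover have "wshift (\<lambda>n. g n + 1) (\<lambda>n. n) = wshift g (\<lambda>n. n) + 1" for g
    by (simp only: wshift_one wshift_add)
  moreover have "wshift (\<lambda>n. 1 - g n) (\<lambda>n. n) = 1 - wshift g (\<lambda>n. n)" for g
    unfolding wshift_one diff_conv_add_uminus wshift_uminus wshift_add ..
  ultimately show ?thesis
    by (cases "odd t") (simp_all add: mode_sign_def)
qed

lemma annihilate_vacuum: "annihilate t \<in> vacuum_ann"
proof -
  have "osc_weight False t n * vacuum (n(t := n t + 1)) = 0" for n
  proof (cases "n(t := n t + 1) = (\<lambda>_. 0)")
    case True
    then have "n t + 1 = 0" by (metis fun_upd_same)
    \<comment> \<open>At -1 the weight vanishes for both statistics: \<open>n t + 1\<close> is 0 for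
      a boson, and -1 is odd, hence not empty, for a fermion.\<close>
    then have "n t = -1" by simp
    then show ?thesis by (simp add: osc_weight_def)
  qed (simp add: vacuum_def)
  then show ?thesis unfolding vacuum_ann_def osc_def by (simp add: wshift.rep_eq fun_eq_iff)
qed

subsection \<open>The Dyson realisation\<close>

text \<open>A rank one solution \<open>E\<^sub>k\<^sub>l \<sim> X\<^sub>k Y\<^sub>l\<close> of the commutation relations of the general linear Lie
  superalgebra, built from super-oscillators \<open>x\<^sub>k, y\<^sub>k\<close> (\<open>k \<noteq> i0\<close>) whose parities are taken
  relative to the index \<open>i0\<close>; the number operator is shifted so that it kills the vacuum.\<close>

context scalar_ring
begin

context
  fixes \<kappa> :: nat and s :: "nat \<Rightarrow> int" and i0 :: nat and c :: complex and x y :: "nat \<Rightarrow> 'a"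
begin

definition rel_sign :: "nat \<Rightarrow> int" where "rel_sign k = s k * s i0"

definition dyson_N :: 'a where
  "dyson_N = (\<Sum>k\<in>{1..\<kappa>} - {i0}. x k * y k + (if k < i0 then psg rel_sign k k else 0))"

definition dyson_X :: "nat \<Rightarrow> 'a" where "dyson_X k = (if k = i0 then 1 else x k)"
text \<open>In homogeneous form the total number operator commutes with all X_k Y_l. Setting X_{i0}
  = 1 and fixing that number determines Y_{i0}. The factor \<open>s i0\<close> cancels the sign in
  \<open>dyson_E\<close>, so that c is the vacuum eigenvalue of the diagonal entry at i0.\<close>

definition dyson_Y :: "nat \<Rightarrow> 'a" where "dyson_Y k = (if k = i0 then sc (of_int (s i0) * c) - dyson_N else y k)"
definition dyson_E :: "nat \<Rightarrow> nat \<Rightarrow> 'a" where "dyson_E k l = psg s l l * (dyson_X k * dyson_Y l)"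

lemma dyson_E_supercommute:
  assumes x: "\<And>k. k \<in> {1..\<kappa>} - {i0} \<Longrightarrow> z * x k = \<zeta> k * (x k * z)"
    and y: "\<And>k. k \<in> {1..\<kappa>} - {i0} \<Longrightarrow> z * y k = \<zeta> k * (y k * z)"
    and \<zeta>: "\<And>k. \<zeta> k = 1 \<or> \<zeta> k = -1" "\<zeta> i0 = 1"
    and kl: "k \<in> {1..\<kappa>}" "l \<in> {1..\<kappa>}"
  shows "z * dyson_E k l = \<zeta> k * (\<zeta> l * (dyson_E k l * z))"
proof -
  have \<zeta>_left: "a * (\<zeta> k * b) = \<zeta> k * (a * b)" for a b k using \<zeta>(1)[of k] by auto
  have \<zeta>_sq: "\<zeta> k * (\<zeta> k * b) = b" for b k using \<zeta>(1)[of k] by auto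
  have "z * (x k * y k + (if k < i0 then psg rel_sign k k else 0)) = (x k * y k + (if k < i0 then psg rel_sign k k else 0)) * z"
    if k: "k \<in> {1..\<kappa>} - {i0}" for k
  proof -
    have "z * (x k * y k) = (z * x k) * y k" by (simp add: mult.assoc)
    also have "\<dots> = \<zeta> k * (x k * (z * y k))" by (simp add: x[OF k] mult.assoc)
    also have "\<dots> = x k * y k * z" by (simp add: y[OF k] \<zeta>_left[of "x k"] \<zeta>_sq mult.assoc)
    finally show ?thesis by (simp add: distrib_left distrib_right psg_commute[of z])
  qed
  then have N: "z * dyson_N = dyson_N * z"
    unfolding dyson_N_def sum_distrib_left sum_distrib_right by (intro sum.cong) auto
  have Y: "z * dyson_Y k = \<zeta> k * (dyson_Y k * z)" if "k \<in> {1..\<kappa>}" for k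
    using that y \<zeta>(2) by (auto simp: dyson_Y_def right_diff_distrib left_diff_distrib N centralD(1)[OF sc_central, of z])
  have X: "z * dyson_X k = \<zeta> k * (dyson_X k * z)" if "k \<in> {1..\<kappa>}" for k
    using that x \<zeta>(2) by (auto simp: dyson_X_def)
  have "z * (dyson_X k * dyson_Y l) = (z * dyson_X k) * dyson_Y l" by (simp add: mult.assoc)
  also have "\<dots> = \<zeta> k * (dyson_X k * (z * dyson_Y l))" by (simp add: X[OF kl(1)] mult.assoc)
  also have "\<dots> = \<zeta> k * (\<zeta> l * (dyson_X k * dyson_Y l * z))" by (simp add: Y[OF kl(2)] \<zeta>_left[of "dyson_X k"] mult.assoc)
  finally show ?thesis by (simp add: dyson_E_def psg_commute[of z] mult.assoc psg_commute(2)[of "\<zeta> k"] psg_commute(2)[of "\<zeta> l"])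
qed

context
  assumes s: "\<forall>i\<in>{1..\<kappa>}. s i = 1 \<or> s i = -1" and i0: "i0 \<in> {1..\<kappa>}"
    and xx: "\<And>j k. j \<in> {1..\<kappa>} - {i0} \<Longrightarrow> k \<in> {1..\<kappa>} - {i0} \<Longrightarrow> x j * x k = psg rel_sign j k * (x k * x j)"
    and yy: "\<And>j k. j \<in> {1..\<kappa>} - {i0} \<Longrightarrow> k \<in> {1..\<kappa>} - {i0} \<Longrightarrow> y j * y k = psg rel_sign j k * (y k * y j)"
    and yx: "\<And>j k. j \<in> {1..\<kappa>} - {i0} \<Longrightarrow> k \<in> {1..\<kappa>} - {i0} \<Longrightarrow>
       y j * x k = psg rel_sign j k * (x k * y j) + (if j = k then 1 else 0)"
begin

abbreviation q :: "nat \<Rightarrow> nat \<Rightarrow> 'a" where "q \<equiv> psg rel_sign"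

lemma s_i0: "s i0 = 1 \<or> s i0 = -1" using s i0 by blast

lemma q_i0: "q i0 k = 1" "q k i0 = 1"
  using s_i0 by (auto simp: psg_def par_def rel_sign_def)

lemma N_x: "k \<in> {1..\<kappa>} - {i0} \<Longrightarrow> dyson_N * x k = x k * dyson_N + x k"
proof -
  assume k: "k \<in> {1..\<kappa>} - {i0}"
  have "(x j * y j + (if j < i0 then q j j else 0)) * x k = x k * (x j * y j + (if j < i0 then q j j else 0)) + (if j = k then x k else 0)"
    if j: "j \<in> {1..\<kappa>} - {i0}" for j
  proof -
    have "x j * y j * x k = q j k * (x j * x k * y j) + (if j = k then x k else 0)"
      by (simp add: mult.assoc yx[OF j k] distrib_left psg_commute[of "x j"])
    also have "x j * x k * y j = q j k * (x k * (x j * y j))" by (simp add: xx[OF j k] mult.assoc)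
    finally show ?thesis by (simp add: distrib_left distrib_right psg_commute[of "x k"])
  qed
  then have "dyson_N * x k = (\<Sum>j\<in>{1..\<kappa>} - {i0}. x k * (x j * y j + (if j < i0 then q j j else 0)) + (if j = k then x k else 0))"
    unfolding dyson_N_def sum_distrib_right by (intro sum.cong) auto
  also have "\<dots> = x k * dyson_N + (\<Sum>j\<in>{1..\<kappa>} - {i0}. if j = k then x k else 0)"
    unfolding dyson_N_def sum_distrib_left by (rule sum.distrib)
  finally show ?thesis using k by simp
qed

lemma y_N: "l \<in> {1..\<kappa>} - {i0} \<Longrightarrow> y l * dyson_N = dyson_N * y l + y l"
proof -
  assume l: "l \<in> {1..\<kappa>} - {i0}"
  have "y l * (x j * y j + (if j < i0 then q j j else 0)) = (x j * y j + (if j < i0 then q j j else 0)) * y l + (if j = l then y l else 0)"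
    if j: "j \<in> {1..\<kappa>} - {i0}" for j
  proof -
    have "y l * (x j * y j) = q l j * (x j * (y l * y j)) + (if j = l then y l else 0)"
      by (simp add: mult.assoc[symmetric] yx[OF l j] distrib_right)
    also have "y l * y j = q l j * (y j * y l)" by (rule yy[OF l j])
    finally show ?thesis by (simp add: distrib_left distrib_right psg_commute[of "x j"] psg_commute[of "y l"] mult.assoc)
  qed
  then have "y l * dyson_N = (\<Sum>j\<in>{1..\<kappa>} - {i0}. (x j * y j + (if j < i0 then q j j else 0)) * y l + (if j = l then y l else 0))"
    unfolding dyson_N_def sum_distrib_left by (intro sum.cong) auto
  also have "\<dots> = dyson_N * y l + (\<Sum>j\<in>{1..\<kappa>} - {i0}. if j = l then y l else 0)"
    unfolding dyson_N_def sum_distrib_right by (rule sum.distrib)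
  finally show ?thesis using l by simp
qed

lemma XX:
  assumes "j \<in> {1..\<kappa>}" "k \<in> {1..\<kappa>}"
  shows "dyson_X j * dyson_X k = q j k * (dyson_X k * dyson_X j)"
proof (cases "j = i0 \<or> k = i0")
  case True
  then show ?thesis by (auto simp: dyson_X_def q_i0)
next
  case False
  then show ?thesis using assms unfolding dyson_X_def by (simp only: if_False de_Morgan_disj) (rule xx, auto)
qed

lemma YX:
  assumes "j \<in> {1..\<kappa>}" "k \<in> {1..\<kappa>}"
  shows "dyson_Y j * dyson_X k =
    q j k * (dyson_X k * dyson_Y j) + (if j = k then 1 else 0) - (if j = i0 then dyson_X k else 0)"
proof (cases "j = i0"; cases "k = i0")
  assume "j = i0" "k \<noteq> i0"
  then show ?thesis using assms N_x[of k]
    by (simp add: dyson_X_def dyson_Y_def q_i0 left_diff_distrib right_diff_distrib centralD(1)[OF sc_central, of "x _"])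
next
  assume "j \<noteq> i0" "k \<noteq> i0"
  then show ?thesis using assms yx[of j k] by (simp add: dyson_X_def dyson_Y_def)
qed (auto simp: dyson_X_def dyson_Y_def q_i0)

lemma YY:
  assumes "j \<in> {1..\<kappa>}" "l \<in> {1..\<kappa>}"
  shows "dyson_Y j * dyson_Y l =
    q j l * (dyson_Y l * dyson_Y j) + (if j = i0 then dyson_Y l else 0) - (if l = i0 then dyson_Y j else 0)"
proof (cases "j = i0"; cases "l = i0")
  assume "j = i0" "l \<noteq> i0"
  then show ?thesis using assms y_N[of l]
    by (simp add: dyson_Y_def q_i0 left_diff_distrib right_diff_distrib centralD(1)[OF sc_central, of "y _"])
next
  assume "j \<noteq> i0" "l = i0"
  then show ?thesis using assms y_N[of j]
    by (simp add: dyson_Y_def q_i0 left_diff_distrib right_diff_distrib centralD(1)[OF sc_central, of "y _"])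
next
  assume "j \<noteq> i0" "l \<noteq> i0"
  then have "y j * y l = q j l * (y l * y j)" using assms by (intro yy) auto
  then show ?thesis unfolding dyson_Y_def using \<open>j \<noteq> i0\<close> \<open>l \<noteq> i0\<close> by (simp only: if_False add_0_right diff_zero)
qed (auto simp: dyson_Y_def q_i0)

text \<open>Y_{i0} is not an oscillator: it disturbs the free relations by the terms with j = i0 or
  l = i0 in \<open>YX\<close> and \<open>YY\<close>. In the supercommutator of two products these
  terms cancel.\<close>

lemma XY_commutator:
  assumes "i \<in> {1..\<kappa>}" "j \<in> {1..\<kappa>}" "k \<in> {1..\<kappa>}" "l \<in> {1..\<kappa>}"
  shows "(dyson_X i * dyson_Y j) * (dyson_X k * dyson_Y l)
      - q i k * (q i l * (q j k * (q j l * ((dyson_X k * dyson_Y l) * (dyson_X i * dyson_Y j)))))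
    = (if j = k then dyson_X i * dyson_Y l else 0) - (if i = l then q i k * (q i l * (q j k * (q j l * (dyson_X k * dyson_Y j)))) else 0)"
proof -
  let ?X = dyson_X and ?Y = dyson_Y
  define P where "P = ?X i * ?X k"
  have A: "(?X i * ?Y j) * (?X k * ?Y l) = q j k * (P * (?Y j * ?Y l)) + (if j = k then ?X i * ?Y l else 0) - (if j = i0 then P * ?Y l else 0)"
  proof -
    have "(?X i * ?Y j) * (?X k * ?Y l) = ?X i * (?Y j * ?X k) * ?Y l" by (simp add: mult.assoc)
    then show ?thesis unfolding YX[OF assms(2,3)]
      by (simp add: P_def distrib_left distrib_right left_diff_distrib right_diff_distrib mult.assoc psg_commute[of "?X i"])
  qed
  have X': "?X k * ?X i = q i k * P" unfolding P_def XX[OF assms(3,1)] by (simp add: psg_sym[of rel_sign k i])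
  have B: "(?X k * ?Y l) * (?X i * ?Y j) = q i l * (q i k * (P * (q j l * (?Y j * ?Y l) + (if l = i0 then ?Y j else 0) - (if j = i0 then ?Y l else 0))))
     + (if i = l then ?X k * ?Y j else 0) - (if l = i0 then q i k * (P * ?Y j) else 0)"
  proof -
    have "(?X k * ?Y l) * (?X i * ?Y j) = ?X k * (?Y l * ?X i) * ?Y j" by (simp add: mult.assoc)
    also have "\<dots> = q i l * (?X k * ?X i * (?Y l * ?Y j)) + (if i = l then ?X k * ?Y j else 0) - (if l = i0 then ?X k * ?X i * ?Y j else 0)"
      unfolding YX[OF assms(4,1)]
      by (simp add: distrib_left distrib_right left_diff_distrib right_diff_distrib mult.assoc psg_commute[of "?X k"] psg_sym[of rel_sign l i])
    finally show ?thesis unfolding X' YY[OF assms(4,2)] by (simp add: mult.assoc psg_sym[of rel_sign l j])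
  qed
  show ?thesis
    unfolding A B
    by (cases "j = i0"; cases "l = i0")
      (simp_all add: q_i0 distrib_left right_diff_distrib psg_psg_commute psg_commute[of P])
qed

text \<open>The four signs multiply to (-1)^((|i|+|j|)(|k|+|l|)), which does not change when all
  parities are shifted by that of i0.\<close>

lemma rel_sign_product:
  assumes "i \<in> {1..\<kappa>}" "j \<in> {1..\<kappa>}" "k \<in> {1..\<kappa>}" "l \<in> {1..\<kappa>}"
  shows "q i k * (q i l * (q j k * (q j l * z))) = psg s i k * (psg s i l * (psg s j k * (psg s j l * z)))"
proof -
  have "s i = 1 \<or> s i = -1" "s j = 1 \<or> s j = -1" "s k = 1 \<or> s k = -1" "s l = 1 \<or> s l = -1"
    using s assms by blast+
  with s_i0 show ?thesis by (elim disjE) (simp_all add: psg_def par_def rel_sign_def)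
qed

lemma dyson_E_commutator:
  assumes "i \<in> {1..\<kappa>}" "j \<in> {1..\<kappa>}" "k \<in> {1..\<kappa>}" "l \<in> {1..\<kappa>}"
  shows "psg s k i * (psg s k j * (dyson_E i j * dyson_E k l)) - psg s l i * (psg s l j * (dyson_E k l * dyson_E i j)) =
    (if k = j then psg s i k * dyson_E i l else 0) - (if i = l then psg s i j * dyson_E k j else 0)"
proof -
  let ?X = dyson_X and ?Y = dyson_Y
  define C where "C = (?X i * ?Y j) * (?X k * ?Y l)"
  define D where "D = (?X k * ?Y l) * (?X i * ?Y j)"
  have EE: "dyson_E i j * dyson_E k l = psg s j j * (psg s l l * C)" "dyson_E k l * dyson_E i j = psg s j j * (psg s l l * D)"
    unfolding dyson_E_def C_def D_def
    by (simp_all add: mult.assoc psg_commute[of "?X _"] psg_commute[of "?Y _"] psg_psg_commute)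
  have "C - psg s i k * (psg s i l * (psg s j k * (psg s j l * D))) =
     (if j = k then ?X i * ?Y l else 0) - (if i = l then psg s i k * (psg s i l * (psg s j k * (psg s j l * (?X k * ?Y j)))) else 0)"
    using XY_commutator[OF assms] unfolding rel_sign_product[OF assms] C_def D_def .
  then have C: "C = psg s i k * (psg s i l * (psg s j k * (psg s j l * D))) +
     ((if j = k then ?X i * ?Y l else 0) - (if i = l then psg s i k * (psg s i l * (psg s j k * (psg s j l * (?X k * ?Y j)))) else 0))"
    by (metis diff_eq_eq add.commute)
  show ?thesis
    unfolding EE C unfolding dyson_E_def psg_sym[of s k i] psg_sym[of s k j] psg_sym[of s l i] psg_sym[of s l j]
    by (cases "j = k"; cases "i = l") (simp_all add: distrib_left right_diff_distrib psg_psg_commute psg_sym)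
qed

lemma psg_rel_sign_diag:
  assumes "k \<in> {1..\<kappa>}"
  shows "psg s k k * q k k = psg s i0 i0" "psg s i0 i0 * q k k = psg s k k"
proof -
  have "s k = 1 \<or> s k = -1" using s assms by blast
  with s_i0 show "psg s k k * q k k = psg s i0 i0" "psg s i0 i0 * q k k = psg s k k"
    by (auto simp: psg_def par_def rel_sign_def)
qed

lemma psg_diag: "k \<in> {1..\<kappa>} \<Longrightarrow> psg s k k = sc (of_int (s k))"
  using bspec[OF s, of k] by (auto simp: psg_def par_def sc_minus)

text \<open>For j other than i0, reordering y_j x_j gives an oscillator part, cancelled by N inside
  Y_{i0}, and a constant s_j. The shift of N removes these constants for j < i0; those above i0
  remain and add up to \<open>rho \<kappa> s (i0 + 1)\<close>.\<close>

lemma sum_YX: "(\<Sum>j\<in>{1..\<kappa>}. psg s j j * (dyson_Y j * dyson_X j)) = sc (c + rho \<kappa> s (i0 + 1))"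
proof -
  let ?I = "{1..\<kappa>} - {i0}"
  have "(\<Sum>j\<in>{1..\<kappa>}. psg s j j * (dyson_Y j * dyson_X j)) =
     psg s i0 i0 * (dyson_Y i0 * dyson_X i0) + (\<Sum>j\<in>?I. psg s j j * (dyson_Y j * dyson_X j))"
    by (rule sum.remove) (use i0 in auto)
  also have "(\<Sum>j\<in>?I. psg s j j * (dyson_Y j * dyson_X j)) = (\<Sum>j\<in>?I. psg s i0 i0 * (x j * y j) + psg s j j)"
  proof (intro sum.cong refl)
    fix j assume j: "j \<in> ?I"
    have "psg s j j * (y j * x j) = (psg s j j * q j j) * (x j * y j) + psg s j j"
      by (simp add: yx[OF j j] distrib_left mult.assoc)
    then show "psg s j j * (dyson_Y j * dyson_X j) = psg s i0 i0 * (x j * y j) + psg s j j"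
      using j by (simp add: dyson_X_def dyson_Y_def psg_rel_sign_diag)
  qed
  also have "psg s i0 i0 * (dyson_Y i0 * dyson_X i0) = sc c - (\<Sum>j\<in>?I. psg s i0 i0 * (x j * y j) + (if j < i0 then psg s j j else 0))"
  proof -
    have "psg s i0 i0 * sc (of_int (s i0) * c) = sc c"
      using s_i0 psg_diag[OF i0] by (auto simp flip: sc_mult)
    moreover have "psg s i0 i0 * dyson_N = (\<Sum>j\<in>?I. psg s i0 i0 * (x j * y j) + (if j < i0 then psg s j j else 0))"
      unfolding dyson_N_def sum_distrib_left
      by (intro sum.cong refl) (auto simp: distrib_left psg_rel_sign_diag)
    ultimately show ?thesis by (simp add: dyson_X_def dyson_Y_def right_diff_distrib)
  qed
  also have "sc c - (\<Sum>j\<in>?I. psg s i0 i0 * (x j * y j) + (if j < i0 then psg s j j else 0)) + (\<Sum>j\<in>?I. psg s i0 i0 * (x j * y j) + psg s j j)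
    = sc c + (\<Sum>j\<in>?I. if j < i0 then 0 else psg s j j)"
  proof -
    have "(\<Sum>j\<in>?I. psg s i0 i0 * (x j * y j) + psg s j j) =
      (\<Sum>j\<in>?I. psg s i0 i0 * (x j * y j) + (if j < i0 then psg s j j else 0)) + (\<Sum>j\<in>?I. if j < i0 then 0 else psg s j j)"
      unfolding sum.distrib[symmetric] by (rule sum.cong) auto
    then show ?thesis by simp
  qed
  also have "(\<Sum>j\<in>?I. if j < i0 then 0 else psg s j j) = (\<Sum>j\<in>{i0+1..\<kappa>}. sc (of_int (s j)))"
    using i0 psg_diag by (intro sum.mono_neutral_cong_right) auto
  finally show ?thesis by (simp add: sc_add rho_def sc_sum)
qed

text \<open>E is a column times a row, so its square contains the row times the column, which is
  scalar by \<open>sum_YX\<close>.\<close>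

lemma dyson_E_square:
  "mat_mul \<kappa> dyson_E dyson_E k l = sc (c + rho \<kappa> s (i0 + 1)) * dyson_E k l"
proof -
  have "mat_mul \<kappa> dyson_E dyson_E k l = psg s l l * (dyson_X k * ((\<Sum>j\<in>{1..\<kappa>}. psg s j j * (dyson_Y j * dyson_X j)) * dyson_Y l))"
    unfolding mat_mul_def dyson_E_def sum_distrib_left sum_distrib_right
    by (intro sum.cong refl) (simp add: mult.assoc psg_commute[of "dyson_X _"] psg_commute[of "dyson_Y _"] psg_psg_commute)
  then show ?thesis unfolding sum_YX dyson_E_def
    by (simp add: centralD(2)[OF sc_central])
qed

context
  assumes xJ: "\<And>k. k \<in> {1..\<kappa>} \<Longrightarrow> k < i0 \<Longrightarrow> x k \<in> J" and yJ: "\<And>k. k \<in> {1..\<kappa>} \<Longrightarrow> i0 < k \<Longrightarrow> y k \<in> J"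
begin

lemma dyson_N_J: "dyson_N \<in> J"
  unfolding dyson_N_def
proof (rule J_sum)
  fix k assume k: "k \<in> {1..\<kappa>} - {i0}"
  show "x k * y k + (if k < i0 then q k k else 0) \<in> J"
  proof (cases "k < i0")
    case True
    have "x k * y k + q k k = q k k * (y k * x k)"
      using psg_cases[of rel_sign k k, where 'a = 'a] by (auto simp: yx[OF k k])
    moreover have "q k k * (y k * x k) \<in> J" using xJ k True by (intro J_mult) auto
    ultimately show ?thesis using True by simp
  next
    case False
    then show ?thesis using k yJ by (auto intro!: J_mult)
  qed
qed

text \<open>If l > i0, the right factor Y_l annihilates. Otherwise k < i0 and X_k does, once moved
  to the right, where l = i0 costs only another X_k.\<close>

lemma dyson_E_J: "k \<in> {1..\<kappa>} \<Longrightarrow> l \<in> {1..\<kappa>} \<Longrightarrow> k < l \<Longrightarrow> dyson_E k l \<in> J"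
proof -
  assume kl: "k \<in> {1..\<kappa>}" "l \<in> {1..\<kappa>}" "k < l"
  have "dyson_X k * dyson_Y l \<in> J"
  proof (cases "i0 < l")
    case True
    then show ?thesis using yJ[of l] kl by (auto simp: dyson_Y_def intro!: J_mult)
  next
    case False
    then have X: "dyson_X k \<in> J" using xJ[of k] kl by (auto simp: dyson_X_def)
    have "dyson_X k * dyson_Y l = q l k * (dyson_Y l * dyson_X k + (if l = i0 then dyson_X k else 0))"
      using YX[OF kl(2,1)] kl(3) by simp
    also have "\<dots> \<in> J" using X by (intro J_mult J_add) (auto simp: J_0)
    finally show ?thesis .
  qed
  then show ?thesis unfolding dyson_E_def by (rule J_mult)
qed

text \<open>Below i0 the eigenvalue is not zero although x_k kills the vacuum: moving x_k to the
  right of y_k leaves a constant, which the signs turn into -s_{i0}.\<close>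

lemma dyson_E_diag_J:
  assumes k: "k \<in> {1..\<kappa>}"
  shows "dyson_E k k - sc (if k = i0 then c else if i0 < k then 0 else - of_int (s i0)) \<in> J"
proof -
  consider "k = i0" | "i0 < k" | "k < i0" by linarith
  then show ?thesis
  proof cases
    case 1
    have "psg s i0 i0 * sc (of_int (s i0) * c) = sc c"
      using s_i0 psg_diag[OF i0] by (auto simp flip: sc_mult)
    then have "dyson_E k k - sc c = - (psg s i0 i0 * dyson_N)"
      using 1 by (simp add: dyson_E_def dyson_X_def dyson_Y_def right_diff_distrib)
    then show ?thesis using 1 dyson_N_J by (auto intro: J_minus J_mult)
  next
    case 2
    then show ?thesis using yJ[OF k] by (auto simp: dyson_E_def dyson_Y_def intro!: J_mult)
  next
    case 3
    with k have k': "k \<in> {1..\<kappa>} - {i0}" by auto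
    have "x k * y k + q k k = q k k * (y k * x k)"
      using psg_cases[of rel_sign k k, where 'a = 'a] by (auto simp: yx[OF k' k'])
    then have "psg s k k * (x k * y k) + psg s k k * q k k = psg s k k * (q k k * (y k * x k))"
      by (metis distrib_left)
    then have "dyson_E k k + sc (of_int (s i0)) = psg s k k * (q k k * (y k * x k))"
      using 3 by (simp add: dyson_E_def dyson_X_def dyson_Y_def psg_rel_sign_diag[OF k] psg_diag[OF i0])
    then show ?thesis using 3 xJ[OF k] by (auto simp: sc_minus intro!: J_mult)
  qed
qed

end

end

end

end

subsection \<open>Dressing by a rank one solution\<close>

text \<open>The L operator with x = 1/u. The variable is left free because 1/u, 1/v and -1/u all
  occur.\<close>

definition lop :: "(nat \<Rightarrow> nat \<Rightarrow> 'b::ring_1) \<Rightarrow> 'b \<Rightarrow> 'b \<Rightarrow> nat \<Rightarrow> nat \<Rightarrow> 'b" where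
  "lop E x \<alpha> i j = (if i = j then 1 + \<alpha> * x else 0) + x * E i j"

context
  fixes \<kappa> :: nat and s :: "nat \<Rightarrow> int" and E :: "nat \<Rightarrow> nat \<Rightarrow> 'b::ring_1" and \<nu> :: 'b
  assumes commutator: "\<And>i j k l. i \<in> {1..\<kappa>} \<Longrightarrow> j \<in> {1..\<kappa>} \<Longrightarrow> k \<in> {1..\<kappa>} \<Longrightarrow> l \<in> {1..\<kappa>} \<Longrightarrow>
      psg s k i * (psg s k j * (E i j * E k l)) - psg s l i * (psg s l j * (E k l * E i j)) =
      (if k = j then psg s i k * E i l else 0) - (if i = l then psg s i j * E k j else 0)"
    and square: "\<And>k l. k \<in> {1..\<kappa>} \<Longrightarrow> l \<in> {1..\<kappa>} \<Longrightarrow> mat_mul \<kappa> E E k l = \<nu> * E k l"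
begin

text \<open>E^2 = \<nu> E keeps the product in the span of 1 and E. The case \<alpha> + \<beta> +
  \<nu> = 0 removes the term in x y, and y = -x then leaves a scalar.\<close>

lemma lop_product:
  assumes central: "central x" "central y" "central \<alpha>" "central \<beta>"
    and il: "i \<in> {1..\<kappa>}" "l \<in> {1..\<kappa>}"
  shows "mat_mul \<kappa> (lop E x \<alpha>) (lop E y \<beta>) i l =
    (if i = l then (1 + \<alpha> * x) * (1 + \<beta> * y) else 0) + (x + y + (\<alpha> + \<beta> + \<nu>) * (x * y)) * E i l"
proof -
  note c = centralD[OF central(1), of "E _ _"] centralD[OF central(2), of "E _ _"] centralD[OF central(3), of "E _ _"] centralD[OF central(4), of "E _ _"]
    centralD[OF central(1), of y] centralD[OF central(1), of \<alpha>] centralD[OF central(1), of \<beta>] centralD[OF central(2), of \<alpha>] centralD[OF central(2), of \<beta>]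
  have "mat_mul \<kappa> (lop E x \<alpha>) (lop E y \<beta>) i l =
    (\<Sum>a\<in>{1..\<kappa>}. (if a = i then (1 + \<alpha> * x) * lop E y \<beta> i l else 0)
      + (if a = l then (x * E i l) * (1 + \<beta> * y) else 0) + x * (y * (E i a * E a l)))"
    unfolding mat_mul_def
  proof (intro sum.cong refl)
    fix a
    have "lop E x \<alpha> i a * lop E y \<beta> a l = (if i = a then 1 + \<alpha> * x else 0) * lop E y \<beta> a l
       + x * E i a * (if a = l then 1 + \<beta> * y else 0) + x * E i a * (y * E a l)"
      unfolding lop_def[of E x] by (simp add: lop_def[of E y] distrib_left distrib_right)
    then show "lop E x \<alpha> i a * lop E y \<beta> a l = (if a = i then (1 + \<alpha> * x) * lop E y \<beta> i l else 0)
      + (if a = l then (x * E i l) * (1 + \<beta> * y) else 0) + x * (y * (E i a * E a l))"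
      by (simp add: mult.assoc c)
  qed
  also have "\<dots> = (1 + \<alpha> * x) * lop E y \<beta> i l + (x * E i l) * (1 + \<beta> * y) + x * (y * mat_mul \<kappa> E E i l)"
    using il by (simp add: sum.distrib sum_distrib_left mat_mul_def)
  also have "\<dots> = (if i = l then (1 + \<alpha> * x) * (1 + \<beta> * y) else 0) + (x + y + (\<alpha> + \<beta> + \<nu>) * (x * y)) * E i l"
  proof -
    have "x * (y * (\<nu> * E i l)) = \<nu> * (x * (y * E i l))"
      by (simp only: centralD(2)[OF central(1), of \<nu>] centralD(2)[OF central(2), of \<nu>])
    then show ?thesis unfolding square[OF il] lop_def
      by (simp add: distrib_left distrib_right mult.assoc c add_ac)
  qed
  finally show ?thesis .
qed

context
  fixes x y :: 'b
  assumes central: "central x" "central y"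
begin

text \<open>The scalar parts are central and sit on the diagonal, where the two sign factors agree,
  so only the supercommutator of the E's survives.\<close>

lemma lop_commutator:
  assumes "central \<alpha>" "central \<beta>"
    and ijkl: "i \<in> {1..\<kappa>}" "j \<in> {1..\<kappa>}" "k \<in> {1..\<kappa>}" "l \<in> {1..\<kappa>}"
  shows "psg s k i * (psg s k j * (lop E x \<alpha> i j * lop E y \<beta> k l)) - psg s l i * (psg s l j * (lop E y \<beta> k l * lop E x \<alpha> i j))
    = x * (y * ((if k = j then psg s i k * E i l else 0) - (if i = l then psg s i j * E k j else 0)))"
proof -
  note c = centralD[OF central(1), of "E _ _"] centralD[OF central(2), of "E _ _"]
    centralD[OF central(1), of y] centralD[OF central(1), of "psg s _ _"] centralD[OF central(2), of "psg s _ _"]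
  define p where "p = (if i = j then 1 + \<alpha> * x else 0)"
  define r where "r = (if k = l then 1 + \<beta> * y else 0)"
  have "central (1 + \<alpha> * x)" "central (1 + \<beta> * y)" "central 0" for z :: 'b
    using assms central by (auto intro!: central_add central_mult simp: central_def[of 1] central_def[of 0])
  then have pr: "central p" "central r" by (auto simp: p_def r_def)
  have p: "psg s k i * (psg s k j * (p * z)) = p * z" "psg s l i * (psg s l j * (z * p)) = p * z" for z
    unfolding centralD(1)[OF pr(1)] by (auto simp: p_def)
  have r: "psg s l i * (psg s l j * (r * z)) = psg s k i * (psg s k j * (r * z))" for z
    by (auto simp: r_def)
  have "lop E x \<alpha> i j * lop E y \<beta> k l = p * (r + y * E k l) + r * (x * E i j) + x * (y * (E i j * E k l))"
    unfolding lop_def p_def[symmetric] r_def[symmetric]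
    by (simp add: distrib_left distrib_right mult.assoc c centralD[OF pr(2), of "E _ _"] centralD[OF pr(2), of x])
  moreover have "lop E y \<beta> k l * lop E x \<alpha> i j = (r + y * E k l) * p + r * (x * E i j) + x * (y * (E k l * E i j))"
    unfolding lop_def p_def[symmetric] r_def[symmetric]
    by (simp add: distrib_left distrib_right mult.assoc c)
  ultimately have "psg s k i * (psg s k j * (lop E x \<alpha> i j * lop E y \<beta> k l)) - psg s l i * (psg s l j * (lop E y \<beta> k l * lop E x \<alpha> i j))
    = psg s k i * (psg s k j * (x * (y * (E i j * E k l)))) - psg s l i * (psg s l j * (x * (y * (E k l * E i j))))"
    by (simp only: distrib_left[of "psg s _ _"] p r) simp
  also have "\<dots> = x * (y * (psg s k i * (psg s k j * (E i j * E k l)) - psg s l i * (psg s l j * (E k l * E i j))))"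
    by (simp only: c right_diff_distrib)
  finally show ?thesis unfolding commutator[OF ijkl] .
qed

text \<open>Both sides reduce to the supercommutator of the E's: the flip terms differ by T T' - T'
  T with exchanged indices, and this is linear in E because the quadratic terms agree.\<close>

lemma lop_RTT:
  assumes "central \<alpha>"
  shows "mat4_mul \<kappa> (Rop s (y - x) (x * y)) (mat4_mul \<kappa> (first_factor s (lop E x \<alpha>)) (second_factor (lop E y \<alpha>))) =
    mat4_mul \<kappa> (second_factor (lop E y \<alpha>)) (mat4_mul \<kappa> (first_factor s (lop E x \<alpha>)) (Rop s (y - x) (x * y)))"
  unfolding mat4_mul_assoc[symmetric, of \<kappa> "second_factor _"]
proof (rule mat4_mul_eqI)
  fix i j k l assume h: "i \<in> {1..\<kappa>}" "j \<in> {1..\<kappa>}" "k \<in> {1..\<kappa>}" "l \<in> {1..\<kappa>}"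
  let ?T = "lop E x \<alpha>" and ?T' = "lop E y \<alpha>"
  have cd: "central (y - x)" using central by (intro central_diff)
  have cxy: "central (x * y)" using central by (intro central_mult)
  note c = centralD[OF central(1), of "E _ _"] centralD[OF central(2), of "E _ _"]
    centralD[OF central(1), of y] centralD[OF central(1), of "psg s _ _"] centralD[OF central(2), of "psg s _ _"]
    centralD[OF assms, of x] centralD[OF assms, of y] centralD[OF assms, of "E _ _"]
  have "?T k j * ?T' i l - ?T' k j * ?T i l = (y - x) * ((if k = j then E i l else 0) - (if i = l then E k j else 0))"
    unfolding lop_def by (simp add: distrib_left distrib_right left_diff_distrib right_diff_distrib mult.assoc c)
  then have "x * (y * (psg s i j * (?T k j * ?T' i l))) - x * (y * (psg s i j * (?T' k j * ?T i l))) =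
     x * (y * (psg s i j * ((y - x) * ((if k = j then E i l else 0) - (if i = l then E k j else 0)))))"
    by (simp only: right_diff_distrib[symmetric])
  also have "\<dots> = (y - x) * (x * (y * ((if k = j then psg s i k * E i l else 0) - (if i = l then psg s i j * E k j else 0))))"
    by (auto simp: distrib_left distrib_right left_diff_distrib right_diff_distrib mult.assoc c)
  also have "\<dots> = (y - x) * (psg s k i * (psg s k j * (?T i j * ?T' k l))) - (y - x) * (psg s l i * (psg s l j * (?T' k l * ?T i j)))"
    unfolding lop_commutator[OF assms assms h, symmetric] by (rule right_diff_distrib)
  finally have main: "(y - x) * (psg s k i * (psg s k j * (?T i j * ?T' k l))) - x * (y * (psg s i j * (?T k j * ?T' i l))) =
     (y - x) * (psg s l i * (psg s l j * (?T' k l * ?T i j))) - x * (y * (psg s i j * (?T' k j * ?T i l)))"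
    by (simp add: algebra_simps)
  have "mat4_mul \<kappa> (Rop s (y - x) (x * y)) (mat4_mul \<kappa> (first_factor s ?T) (second_factor ?T')) i j k l =
     (y - x) * (psg s k i * (psg s k j * (?T i j * ?T' k l))) - x * (y * (psg s i j * (?T k j * ?T' i l)))"
    unfolding Rop_mul[OF h] first_second[OF h] first_second[OF h(3,2,1,4)] by (simp add: mult.assoc)
  moreover have "mat4_mul \<kappa> (mat4_mul \<kappa> (second_factor ?T') (first_factor s ?T)) (Rop s (y - x) (x * y)) i j k l =
     (y - x) * (psg s l i * (psg s l j * (?T' k l * ?T i j))) - x * (y * (psg s i j * (?T' k j * ?T i l)))"
    unfolding mul_Rop[OF h] first_second[OF h] first_second[OF h(1,4,3,2)]
      centralD(2)[OF cxy] centralD(1)[OF cd]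
    by (simp add: mult.assoc psg_commute[of "lop _ _ _ _ _"] psg_sym)
  ultimately show "mat4_mul \<kappa> (Rop s (y - x) (x * y)) (mat4_mul \<kappa> (first_factor s ?T) (second_factor ?T')) i j k l =
    mat4_mul \<kappa> (mat4_mul \<kappa> (second_factor ?T') (first_factor s ?T)) (Rop s (y - x) (x * y)) i j k l"
    using main by simp
qed

text \<open>The flip terms contain S T and T S. By the condition on \<alpha> + \<beta> their E-part
  is exactly x + y times E, and this balances the supercommutator multiplied by the coefficient x +
  y of the identity in R(u + v).\<close>

lemma lop_SRT:
  assumes "central \<alpha>" "central \<beta>" "\<alpha> + \<beta> + \<nu> = 0"
  shows "mat4_mul \<kappa> (first_factor s (lop E x \<alpha>)) (mat4_mul \<kappa> (Rop s (x + y) (x * y)) (second_factor (lop E y \<beta>))) =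
    mat4_mul \<kappa> (second_factor (lop E y \<beta>)) (mat4_mul \<kappa> (Rop s (x + y) (x * y)) (first_factor s (lop E x \<alpha>)))"
proof (rule mat4_mul_eqI)
  fix i j k l assume h: "i \<in> {1..\<kappa>}" "j \<in> {1..\<kappa>}" "k \<in> {1..\<kappa>}" "l \<in> {1..\<kappa>}"
  let ?S = "lop E x \<alpha>" and ?T = "lop E y \<beta>"
  have ca: "central (x + y)" using central by (intro central_add)
  have cb: "central (x * y)" using central by (intro central_mult)
  have c1: "central (1 + \<alpha> * x)" "central (1 + \<beta> * y)"
    using assms central by (auto intro!: central_add central_mult simp: central_def[of 1])
  note c = centralD[OF ca, of "lop _ _ _ _ _"] centralD[OF cb, of "lop _ _ _ _ _"] centralD[OF ca, of "psg s _ _"] centralD[OF cb, of "psg s _ _"]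
    psg_commute[of "lop _ _ _ _ _"]
  have L: "mat4_mul \<kappa> (first_factor s ?S) (mat4_mul \<kappa> (Rop s (x + y) (x * y)) (second_factor ?T)) i j k l =
     (x + y) * (psg s k i * (psg s k j * (?S i j * ?T k l))) - (x * y) * (if k = j then psg s k i * mat_mul \<kappa> ?S ?T i l else 0)"
  proof -
    have "mat4_mul \<kappa> (first_factor s ?S) (mat4_mul \<kappa> (Rop s (x + y) (x * y)) (second_factor ?T)) i j k l =
      (\<Sum>p\<in>{1..\<kappa>}. (if p = j then (x + y) * (psg s k i * (psg s k j * (?S i j * ?T k l))) else 0)
        - (if k = j then (x * y) * (psg s k i * (?S i p * ?T p l)) else 0))"
      unfolding first_mul[OF h]
    proof (intro sum.cong refl)
      fix p assume p: "p \<in> {1..\<kappa>}"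
      show "psg s k i * (psg s k p * (?S i p * mat4_mul \<kappa> (Rop s (x + y) (x * y)) (second_factor ?T) p j k l)) =
        (if p = j then (x + y) * (psg s k i * (psg s k j * (?S i j * ?T k l))) else 0)
        - (if k = j then (x * y) * (psg s k i * (?S i p * ?T p l)) else 0)"
        unfolding Rop_mul[OF p h(2,3,4)] second_factor_def
        by (cases "p = j"; cases "k = j") (simp_all add: c right_diff_distrib psg_sym)
    qed
    then show ?thesis using h by (simp add: sum_subtractf sum_distrib_left mat_mul_def)
  qed
  have R: "mat4_mul \<kappa> (second_factor ?T) (mat4_mul \<kappa> (Rop s (x + y) (x * y)) (first_factor s ?S)) i j k l =
     (x + y) * (psg s l i * (psg s l j * (?T k l * ?S i j))) - (x * y) * (if i = l then psg s l j * mat_mul \<kappa> ?T ?S k j else 0)"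
  proof -
    have "mat4_mul \<kappa> (second_factor ?T) (mat4_mul \<kappa> (Rop s (x + y) (x * y)) (first_factor s ?S)) i j k l =
      (\<Sum>p\<in>{1..\<kappa>}. (if p = l then (x + y) * (psg s l i * (psg s l j * (?T k l * ?S i j))) else 0)
        - (if i = l then (x * y) * (psg s l j * (?T k p * ?S p j)) else 0))"
      unfolding second_mul[OF h]
    proof (intro sum.cong refl)
      fix p assume p: "p \<in> {1..\<kappa>}"
      show "?T k p * mat4_mul \<kappa> (Rop s (x + y) (x * y)) (first_factor s ?S) i j p l =
        (if p = l then (x + y) * (psg s l i * (psg s l j * (?T k l * ?S i j))) else 0)
        - (if i = l then (x * y) * (psg s l j * (?T k p * ?S p j)) else 0)"
        unfolding Rop_mul[OF h(1,2) p h(4)] first_factor_def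
        by (cases "p = l"; cases "i = l") (simp_all add: c right_diff_distrib psg_sym)
    qed
    then show ?thesis using h by (simp add: sum_subtractf sum_distrib_left mat_mul_def)
  qed
  have ST: "mat_mul \<kappa> ?S ?T i l = (if i = l then (1 + \<alpha> * x) * (1 + \<beta> * y) else 0) + (x + y) * E i l"
    using lop_product[OF central assms(1,2) h(1,4)] assms(3) by simp
  have TS: "mat_mul \<kappa> ?T ?S k j = (if k = j then (1 + \<alpha> * x) * (1 + \<beta> * y) else 0) + (x + y) * E k j"
    using lop_product[OF central(2,1) assms(2,1) h(3,2)] assms(3) centralD(1)[OF c1(1), of "1 + \<beta> * y"]
    by (simp add: add.commute)
  have "(x + y) * (psg s k i * (psg s k j * (?S i j * ?T k l))) - (x + y) * (psg s l i * (psg s l j * (?T k l * ?S i j))) =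
     (x + y) * ((x * y) * ((if k = j then psg s i k * E i l else 0) - (if i = l then psg s i j * E k j else 0)))"
    unfolding right_diff_distrib[symmetric] lop_commutator[OF assms(1,2) h] by (simp only: mult.assoc)
  also have "\<dots> = (x * y) * (if k = j then psg s k i * mat_mul \<kappa> ?S ?T i l else 0) - (x * y) * (if i = l then psg s l j * mat_mul \<kappa> ?T ?S k j else 0)"
    unfolding ST TS right_diff_distrib[symmetric] centralD(2)[OF cb, of "x + y"]
    by (rule arg_cong[of _ _ "(*) (x * y)"])
      (cases "k = j"; cases "i = l"; simp add: distrib_left right_diff_distrib centralD[OF ca, of "psg s _ _"] psg_sym)
  finally show "mat4_mul \<kappa> (first_factor s ?S) (mat4_mul \<kappa> (Rop s (x + y) (x * y)) (second_factor ?T)) i j k l =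
    mat4_mul \<kappa> (second_factor ?T) (mat4_mul \<kappa> (Rop s (x + y) (x * y)) (first_factor s ?S)) i j k l"
    unfolding L R by (simp add: algebra_simps)
qed

end

end

section \<open>Arithmetic modulo the annihilator of the highest weight vector\<close>

locale left_ideal_ring =
  fixes L :: "'b::ring_1 set"
  assumes L_0: "0 \<in> L" and L_add: "a \<in> L \<Longrightarrow> b \<in> L \<Longrightarrow> a + b \<in> L" and L_mult: "b \<in> L \<Longrightarrow> a * b \<in> L"
begin

lemma L_minus: "a \<in> L \<Longrightarrow> - a \<in> L" using L_mult[of a "-1"] by simp
lemma L_diff: "a \<in> L \<Longrightarrow> b \<in> L \<Longrightarrow> a - b \<in> L" using L_add[of a "- b"] L_minus by simp

definition eqL :: "'b \<Rightarrow> 'b \<Rightarrow> bool" where "eqL a b \<longleftrightarrow> a - b \<in> L"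

lemma eqL_refl: "eqL a a" by (simp add: eqL_def L_0)
lemma eqL_0: "eqL a 0 \<longleftrightarrow> a \<in> L" by (simp add: eqL_def)
lemma eqL_trans: "eqL a b \<Longrightarrow> eqL b c \<Longrightarrow> eqL a c"
  unfolding eqL_def using L_add[of "a - b" "b - c"] by simp
lemma eqL_add: "eqL a b \<Longrightarrow> eqL c d \<Longrightarrow> eqL (a + c) (b + d)"
  unfolding eqL_def using L_add[of "a - b" "c - d"] by (simp add: algebra_simps)
lemma eqL_diff: "eqL a b \<Longrightarrow> eqL c d \<Longrightarrow> eqL (a - c) (b - d)"
  unfolding eqL_def using L_diff[of "a - b" "c - d"] by (simp add: algebra_simps)
lemma eqL_mult: "eqL a b \<Longrightarrow> eqL (c * a) (c * b)"
  unfolding eqL_def using L_mult[of "a - b" c] by (simp add: algebra_simps)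
lemma eqL_sum: "(\<And>a. a \<in> A \<Longrightarrow> eqL (f a) (g a)) \<Longrightarrow> eqL (sum f A) (sum g A)"
  by (induction A rule: infinite_finite_induct) (auto simp: eqL_refl eqL_add)

text \<open>Congruence modulo a left ideal survives left multiplication only. The right factor is
  evaluated first; its value n moves to the left by centrality, and then the other factor can be
  replaced.\<close>

lemma eqL_mult_central: "eqL a m \<Longrightarrow> eqL b n \<Longrightarrow> central n \<Longrightarrow> eqL (a * b) (n * m)"
proof -
  assume am: "eqL a m" and bn: "eqL b n" and n: "central n"
  have "eqL (a * b) (a * n)" using bn by (rule eqL_mult)
  moreover have "eqL (a * n) (n * m)" unfolding centralD(1)[OF n, of a] using am by (rule eqL_mult)
  ultimately show ?thesis by (rule eqL_trans)
qed

context
  fixes \<kappa> :: nat and s :: "nat \<Rightarrow> int" and E b :: "nat \<Rightarrow> nat \<Rightarrow> 'b" and M e :: "nat \<Rightarrow> 'b"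
  assumes commutator: "\<And>i j k l. i \<in> {1..\<kappa>} \<Longrightarrow> j \<in> {1..\<kappa>} \<Longrightarrow> k \<in> {1..\<kappa>} \<Longrightarrow> l \<in> {1..\<kappa>} \<Longrightarrow>
      psg s k i * (psg s k j * (E i j * E k l)) - psg s l i * (psg s l j * (E k l * E i j)) =
      (if k = j then psg s i k * E i l else 0) - (if i = l then psg s i j * E k j else 0)"
    and supercommute: "\<And>i j k l. i \<in> {1..\<kappa>} \<Longrightarrow> j \<in> {1..\<kappa>} \<Longrightarrow> k \<in> {1..\<kappa>} \<Longrightarrow> l \<in> {1..\<kappa>} \<Longrightarrow>
      psg s k i * (psg s k j * (b i j * E k l)) = psg s l i * (psg s l j * (E k l * b i j))"
    and E_upper: "\<And>k l. k \<in> {1..\<kappa>} \<Longrightarrow> l \<in> {1..\<kappa>} \<Longrightarrow> k < l \<Longrightarrow> E k l \<in> L"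
    and E_diag: "\<And>k. k \<in> {1..\<kappa>} \<Longrightarrow> eqL (E k k) (e k)"
    and b_upper: "\<And>k l. k \<in> {1..\<kappa>} \<Longrightarrow> l \<in> {1..\<kappa>} \<Longrightarrow> k < l \<Longrightarrow> b k l \<in> L"
    and b_diag: "\<And>k. k \<in> {1..\<kappa>} \<Longrightarrow> eqL (b k k) (M k)"
    and central_M: "\<And>k. central (M k)" and central_e: "\<And>k. central (e k)"
begin

lemma bE: "i \<in> {1..\<kappa>} \<Longrightarrow> j \<in> {1..\<kappa>} \<Longrightarrow> k \<in> {1..\<kappa>} \<Longrightarrow> l \<in> {1..\<kappa>} \<Longrightarrow>
    b i j * E k l = psg s k i * (psg s k j * (psg s l i * (psg s l j * (E k l * b i j))))"
  using arg_cong[OF supercommute[of i j k l], of "\<lambda>z. psg s k j * (psg s k i * z)"]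
  by (simp add: psg_psg_commute)

lemma Eb: "i \<in> {1..\<kappa>} \<Longrightarrow> j \<in> {1..\<kappa>} \<Longrightarrow> k \<in> {1..\<kappa>} \<Longrightarrow> l \<in> {1..\<kappa>} \<Longrightarrow>
    E k l * b i j = psg s k i * (psg s k j * (psg s l i * (psg s l j * (b i j * E k l))))"
  using arg_cong[OF supercommute[of i j k l], of "\<lambda>z. psg s l j * (psg s l i * z)"]
  by (simp add: psg_psg_commute)

lemma EE:
  assumes "i \<in> {1..\<kappa>}" "j \<in> {1..\<kappa>}" "k \<in> {1..\<kappa>}" "l \<in> {1..\<kappa>}"
  shows "E i j * E k l = psg s k j * (psg s k i * (psg s l i * (psg s l j * (E k l * E i j)) +
     ((if k = j then psg s i k * E i l else 0) - (if i = l then psg s i j * E k j else 0))))"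
proof -
  have "E i j * E k l = psg s k j * (psg s k i * (psg s k i * (psg s k j * (E i j * E k l))))" by simp
  also have "psg s k i * (psg s k j * (E i j * E k l)) = psg s l i * (psg s l j * (E k l * E i j)) +
     ((if k = j then psg s i k * E i l else 0) - (if i = l then psg s i j * E k j else 0))"
    unfolding commutator[OF assms, symmetric] by simp
  finally show ?thesis .
qed

lemma eqL_EbM: "i \<in> {1..\<kappa>} \<Longrightarrow> u \<in> {1..\<kappa>} \<Longrightarrow> eqL (E i i * b u u) (M u * e i)"
  by (intro eqL_mult_central E_diag b_diag central_M)

text \<open>Unless u = i = j, one of the two letters is raising. It may be brought to the right end,
  because E and b supercommute.\<close>

lemma Eb_eqL:
  assumes "i \<in> {1..\<kappa>}" "j \<in> {1..\<kappa>}" "u \<in> {1..\<kappa>}" "i \<le> j"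
  shows "eqL (E i u * b u j) (if u = i \<and> i = j then M i * e i else 0)"
proof -
  consider "i < u" | "u < j" | "u = i" "i = j" using assms(4) by linarith
  then show ?thesis
  proof cases
    case 1
    then have "E i u * b u j \<in> L"
      unfolding Eb[OF assms(3,2,1,3)] using E_upper assms by (intro L_mult) auto
    then show ?thesis using 1 by (simp add: eqL_0)
  next
    case 2
    then have "E i u * b u j \<in> L" using b_upper assms by (intro L_mult) auto
    then show ?thesis using 2 by (auto simp: eqL_0)
  next
    case 3
    then show ?thesis using eqL_EbM[of i i] assms by simp
  qed
qed

lemma bE_eqL:
  assumes "i \<in> {1..\<kappa>}" "j \<in> {1..\<kappa>}" "v \<in> {1..\<kappa>}" "i \<le> j"
  shows "eqL (b i v * E v j) (if v = i \<and> i = j then M i * e i else 0)"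
proof -
  consider "v < j" | "i < v" | "v = i" "i = j" using assms(4) by linarith
  then show ?thesis
  proof cases
    case 1
    then have "b i v * E v j \<in> L" using E_upper assms by (intro L_mult) auto
    then show ?thesis using 1 by (auto simp: eqL_0)
  next
    case 2
    then have "b i v * E v j \<in> L"
      unfolding bE[OF assms(1,3,3,2)] using b_upper assms by (intro L_mult) auto
    then show ?thesis using 2 by (auto simp: eqL_0)
  next
    case 3
    then show ?thesis
      using eqL_mult_central[OF b_diag[of i] E_diag[of i] central_e] assms centralD(1)[OF central_e[of i], of "M i"] by simp
  qed
qed

text \<open>Unless i = j and u = v with u at least i, a raising letter can be brought to the right
  end, possibly after exchanging the two E's. In the exceptional case u > i this exchange of E_iu
  and E_ui produces E_ii and E_uu, whose eigenvalues enter as a difference.\<close>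

lemma EbE_eqL:
  assumes i: "i \<in> {1..\<kappa>}" and j: "j \<in> {1..\<kappa>}" and u: "u \<in> {1..\<kappa>}" and v: "v \<in> {1..\<kappa>}" and ij: "i \<le> j"
  shows "eqL (E i u * (b u v * E v j)) (if i = j \<and> u = v then
     if u = i then e i * (M i * e i) else if i < u then psg s u u * (M u * e i - M u * e u) else 0 else 0)"
proof -
  consider (a) "v < j" | (b) "u < v" | (c) "u = i" "v = i" "j = i" | (d) "j \<le> v" "v \<le> u" "i < u"
    using ij by linarith
  then show ?thesis
  proof cases
    case a
    then have "E i u * (b u v * E v j) \<in> L" using E_upper v j by (intro L_mult) auto
    then show ?thesis using a ij by (auto simp: eqL_0)
  next
    case b
    then have "E i u * (b u v * E v j) \<in> L"
      unfolding bE[OF u v v j] using b_upper u v by (intro L_mult) auto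
    then show ?thesis using b by (auto simp: eqL_0)
  next
    case c
    have "eqL (b i i * E i i) (e i * M i)" by (rule eqL_mult_central[OF b_diag[OF i] E_diag[OF i] central_e])
    from eqL_mult_central[OF E_diag[OF i] this central_mult[OF central_e central_M]]
    have "eqL (E i i * (b i i * E i i)) (e i * M i * e i)" .
    then show ?thesis using c by (simp add: mult.assoc)
  next
    case d
    have iu: "E i u * b u v \<in> L"
      unfolding Eb[OF u v i u] using E_upper[OF i u d(3)] by (intro L_mult)
    \<comment> \<open>g and h collect the signs of moving b_uv to the right and of reordering the
      two E's. For u = v and i = j everything combines to \<open>psg s u u\<close>.\<close>
    define g where "g = psg s v u * (psg s v v * (psg s j u * (psg s j v * (1 :: 'b))))"
    define h where "h = psg s v u * (psg s v i * (1 :: 'b))"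
    have "E i u * (b u v * E v j) = g * (E i u * E v j * b u v)"
      unfolding bE[OF u v v j] g_def by (simp add: mult.assoc psg_commute[of "E i u"])
    also have "E i u * E v j * b u v = h * ((psg s j i * psg s j u * E v j) * (E i u * b u v)
       + (if v = u then psg s i v * (E i j * b u v) else 0) - (if i = j then psg s i u * (E v u * b u v) else 0))"
      unfolding EE[OF i u v j] h_def by (simp add: mult.assoc distrib_left distrib_right left_diff_distrib right_diff_distrib)
    finally have eq: "E i u * (b u v * E v j) = g * (h * ((psg s j i * psg s j u * E v j) * (E i u * b u v)
       + (if v = u then psg s i v * (E i j * b u v) else 0) - (if i = j then psg s i u * (E v u * b u v) else 0)))" .
    show ?thesis
    proof (cases "v = u")
      case False
      then have "v < u" using d by simp
      then have "E v u * b u v \<in> L"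
        unfolding Eb[OF u v v u] using E_upper v u by (intro L_mult) auto
      then have "E i u * (b u v * E v j) \<in> L"
        unfolding eq using False iu by (auto intro!: L_mult L_diff L_add L_0)
      then show ?thesis using False by (auto simp: eqL_0)
    next
      case True
      show ?thesis
      proof (cases "i = j")
        case False
        then have "i < j" using ij by simp
        then have "E i j * b u v \<in> L"
          unfolding Eb[OF u v i j] using E_upper i j by (intro L_mult) auto
        then have "E i u * (b u v * E v j) \<in> L"
          unfolding eq using False iu by (auto intro!: L_mult L_diff L_add L_0)
        then show ?thesis using False by (auto simp: eqL_0)
      next
        case ij: True
        have "eqL (E i u * (b u v * E v j)) (g * (h * (0 + psg s i u * (M u * e i) - psg s i u * (M u * e u))))"
        proof -
          have "eqL ((psg s j i * psg s j u * E v j) * (E i u * b u v)) 0"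
            unfolding eqL_0 using iu by (rule L_mult)
          moreover have "E i u * (b u v * E v j) = g * (h * ((psg s j i * psg s j u * E v j) * (E i u * b u v)
             + psg s i u * (E i i * b u u) - psg s i u * (E u u * b u u)))"
            using eq True ij by simp
          ultimately show ?thesis
            by (simp only:) (intro eqL_mult eqL_diff eqL_add eqL_EbM i u)
        qed
        moreover have "g * (h * (0 + psg s i u * (M u * e i) - psg s i u * (M u * e u))) = psg s u u * (M u * e i - M u * e u)"
          using psg_cases[of s i u, where 'a = 'b] psg_cases[of s u u, where 'a = 'b]
          unfolding g_def h_def True ij[symmetric] by (auto simp: psg_sym[of s u i])
        ultimately show ?thesis using True ij d by simp
      qed
    qed
  qed
qed

context
  fixes x \<alpha> \<beta> :: 'b
  assumes central: "central x" "central \<alpha>" "central \<beta>"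
begin

lemma dressed_expand:
  assumes "i \<in> {1..\<kappa>}" "j \<in> {1..\<kappa>}"
  shows "mat_mul \<kappa> (lop E x \<alpha>) (mat_mul \<kappa> b (lop E x \<beta>)) i j =
    (1 + \<beta> * x) * ((1 + \<alpha> * x) * b i j + x * (\<Sum>u\<in>{1..\<kappa>}. E i u * b u j))
    + x * ((1 + \<alpha> * x) * (\<Sum>v\<in>{1..\<kappa>}. b i v * E v j) + x * (\<Sum>u\<in>{1..\<kappa>}. \<Sum>v\<in>{1..\<kappa>}. E i u * (b u v * E v j)))"
proof -
  define p where "p = 1 + \<alpha> * x"
  define r where "r = 1 + \<beta> * x"
  have pr: "central p" "central r"
    unfolding p_def r_def using central by (auto intro!: central_add central_mult simp: central_def[of 1])
  note c = centralD[OF central(1), of "E _ _"] centralD[OF central(1), of "b _ _"] centralD[OF central(1), of p]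
    centralD[OF pr(1), of "E _ _"] centralD[OF pr(1), of "b _ _"] centralD[OF pr(2), of "E _ _"] centralD[OF pr(2), of "b _ _"]
    centralD[OF pr(2), of p] centralD[OF pr(2), of x]
  have inner: "mat_mul \<kappa> b (lop E x \<beta>) u j = r * b u j + x * (\<Sum>v\<in>{1..\<kappa>}. b u v * E v j)" for u
  proof -
    have "mat_mul \<kappa> b (lop E x \<beta>) u j = (\<Sum>v\<in>{1..\<kappa>}. (if v = j then r * b u j else 0) + x * (b u v * E v j))"
      unfolding mat_mul_def lop_def r_def[symmetric] by (intro sum.cong refl) (simp add: distrib_left c)
    then show ?thesis using assms by (simp add: sum.distrib sum_distrib_left)
  qed
  have "mat_mul \<kappa> (lop E x \<alpha>) (mat_mul \<kappa> b (lop E x \<beta>)) i j =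
    (\<Sum>u\<in>{1..\<kappa>}. (if u = i then p * (r * b i j + x * (\<Sum>v\<in>{1..\<kappa>}. b i v * E v j)) else 0)
      + (r * (x * (E i u * b u j)) + x * (x * (\<Sum>v\<in>{1..\<kappa>}. E i u * (b u v * E v j)))))"
    unfolding mat_mul_def[of \<kappa> "lop E x \<alpha>"] inner
    by (intro sum.cong refl) (simp add: lop_def p_def[symmetric] distrib_left distrib_right mult.assoc c sum_distrib_left[symmetric])
  also have "\<dots> = p * (r * b i j + x * (\<Sum>v\<in>{1..\<kappa>}. b i v * E v j)) + (r * (x * (\<Sum>u\<in>{1..\<kappa>}. E i u * b u j))
      + x * (x * (\<Sum>u\<in>{1..\<kappa>}. \<Sum>v\<in>{1..\<kappa>}. E i u * (b u v * E v j))))"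
    using assms by (simp add: sum.distrib sum_distrib_left)
  also have "\<dots> = r * (p * b i j + x * (\<Sum>u\<in>{1..\<kappa>}. E i u * b u j))
     + x * (p * (\<Sum>v\<in>{1..\<kappa>}. b i v * E v j) + x * (\<Sum>u\<in>{1..\<kappa>}. \<Sum>v\<in>{1..\<kappa>}. E i u * (b u v * E v j)))"
    by (simp add: distrib_left c add_ac)
  finally show ?thesis unfolding p_def r_def .
qed

lemma dressed_upper:
  assumes i: "i \<in> {1..\<kappa>}" and j: "j \<in> {1..\<kappa>}" and ij: "i < j"
  shows "mat_mul \<kappa> (lop E x \<alpha>) (mat_mul \<kappa> b (lop E x \<beta>)) i j \<in> L"
proof -
  have ne: "(i = j) = False" using ij by simp
  have le: "i \<le> j" using ij by simp
  have "eqL (\<Sum>u\<in>{1..\<kappa>}. E i u * b u j) (\<Sum>u\<in>{1..\<kappa>}. 0)"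
    using Eb_eqL[OF i j _ le, unfolded ne simp_thms if_False] by (rule eqL_sum)
  moreover have "eqL (\<Sum>v\<in>{1..\<kappa>}. b i v * E v j) (\<Sum>v\<in>{1..\<kappa>}. 0)"
    using bE_eqL[OF i j _ le, unfolded ne simp_thms if_False] by (rule eqL_sum)
  moreover have "eqL (\<Sum>u\<in>{1..\<kappa>}. \<Sum>v\<in>{1..\<kappa>}. E i u * (b u v * E v j)) (\<Sum>u\<in>{1..\<kappa>}. \<Sum>v\<in>{1..\<kappa>}. 0)"
    using EbE_eqL[OF i j _ _ le, unfolded ne simp_thms if_False] by (intro eqL_sum)
  ultimately show ?thesis
    unfolding dressed_expand[OF i j] using b_upper[OF i j ij] by (auto simp: eqL_0 intro!: L_add L_mult)
qed

text \<open>The sum over u > i comes from the triple products: it is what makes the dressed weight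
  depend on the weights above i, in the combination that also enters the tilde series.\<close>

lemma dressed_diag:
  assumes i: "i \<in> {1..\<kappa>}"
  shows "eqL (mat_mul \<kappa> (lop E x \<alpha>) (mat_mul \<kappa> b (lop E x \<beta>)) i i)
     ((1 + \<beta> * x) * ((1 + \<alpha> * x) * M i + x * (M i * e i)) + x * ((1 + \<alpha> * x) * (M i * e i)
       + x * (e i * (M i * e i) + (\<Sum>u\<in>{i+1..\<kappa>}. psg s u u * (M u * e i - M u * e u)))))"
proof -
  have 1: "eqL (\<Sum>u\<in>{1..\<kappa>}. E i u * b u i) (\<Sum>u\<in>{1..\<kappa>}. if u = i then M i * e i else 0)"
    using Eb_eqL[OF i i] by (intro eqL_sum) simp
  have 2: "eqL (\<Sum>v\<in>{1..\<kappa>}. b i v * E v i) (\<Sum>v\<in>{1..\<kappa>}. if v = i then M i * e i else 0)"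
    using bE_eqL[OF i i] by (intro eqL_sum) simp
  let ?h = "\<lambda>u. if u = i then e i * (M i * e i) else if i < u then psg s u u * (M u * e i - M u * e u) else 0"
  have 3: "eqL (\<Sum>u\<in>{1..\<kappa>}. \<Sum>v\<in>{1..\<kappa>}. E i u * (b u v * E v i)) (\<Sum>u\<in>{1..\<kappa>}. \<Sum>v\<in>{1..\<kappa>}. if v = u then ?h u else 0)"
  proof (intro eqL_sum)
    fix u v assume uv: "u \<in> {1..\<kappa>}" "v \<in> {1..\<kappa>}"
    show "eqL (E i u * (b u v * E v i)) (if v = u then ?h u else 0)"
      using EbE_eqL[OF i i uv] by (auto split: if_splits)
  qed
  have "(\<Sum>u\<in>{1..\<kappa>}. \<Sum>v\<in>{1..\<kappa>}. if v = u then ?h u else 0) = (\<Sum>u\<in>{1..\<kappa>}. ?h u)"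
    by (intro sum.cong refl) simp
  also have "\<dots> = ?h i + (\<Sum>u\<in>{1..\<kappa>} - {i}. ?h u)"
    by (rule sum.remove) (use i in auto)
  also have "(\<Sum>u\<in>{1..\<kappa>} - {i}. ?h u) = (\<Sum>u\<in>{i+1..\<kappa>}. psg s u u * (M u * e i - M u * e u))"
    using i by (intro sum.mono_neutral_cong_right) auto
  finally have 3: "eqL (\<Sum>u\<in>{1..\<kappa>}. \<Sum>v\<in>{1..\<kappa>}. E i u * (b u v * E v i))
     (e i * (M i * e i) + (\<Sum>u\<in>{i+1..\<kappa>}. psg s u u * (M u * e i - M u * e u)))"
    using 3 by simp
  have 1: "eqL (\<Sum>u\<in>{1..\<kappa>}. E i u * b u i) (M i * e i)" using 1 i by simp
  have 2: "eqL (\<Sum>v\<in>{1..\<kappa>}. b i v * E v i) (M i * e i)" using 2 i by simp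
  show ?thesis
    unfolding dressed_expand[OF i i] by (intro eqL_add eqL_mult 1 2 3 b_diag i)
qed

end

end

end

context
  fixes \<kappa> :: nat and s :: "nat \<Rightarrow> int" and E U V :: "nat \<Rightarrow> nat \<Rightarrow> 'b::ring_1" and \<nu> x y \<alpha> \<beta> :: 'b
  assumes commutator: "\<And>i j k l. i \<in> {1..\<kappa>} \<Longrightarrow> j \<in> {1..\<kappa>} \<Longrightarrow> k \<in> {1..\<kappa>} \<Longrightarrow> l \<in> {1..\<kappa>} \<Longrightarrow>
      psg s k i * (psg s k j * (E i j * E k l)) - psg s l i * (psg s l j * (E k l * E i j)) =
      (if k = j then psg s i k * E i l else 0) - (if i = l then psg s i j * E k j else 0)"
    and square: "\<And>k l. k \<in> {1..\<kappa>} \<Longrightarrow> l \<in> {1..\<kappa>} \<Longrightarrow> mat_mul \<kappa> E E k l = \<nu> * E k l"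
    and UE: "\<And>i j k l. i \<in> {1..\<kappa>} \<Longrightarrow> j \<in> {1..\<kappa>} \<Longrightarrow> k \<in> {1..\<kappa>} \<Longrightarrow> l \<in> {1..\<kappa>} \<Longrightarrow>
      psg s k i * (psg s k j * (U i j * E k l)) = psg s l i * (psg s l j * (E k l * U i j))"
    and VE: "\<And>i j k l. i \<in> {1..\<kappa>} \<Longrightarrow> j \<in> {1..\<kappa>} \<Longrightarrow> k \<in> {1..\<kappa>} \<Longrightarrow> l \<in> {1..\<kappa>} \<Longrightarrow>
      psg s k i * (psg s k j * (V i j * E k l)) = psg s l i * (psg s l j * (E k l * V i j))"
    and central: "central x" "central y" "central \<alpha>" "central \<beta>" and zero: "\<alpha> + \<beta> + \<nu> = 0"
begin

lemma lop_supercommute: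
  assumes WE: "\<And>i j k l. i \<in> {1..\<kappa>} \<Longrightarrow> j \<in> {1..\<kappa>} \<Longrightarrow> k \<in> {1..\<kappa>} \<Longrightarrow> l \<in> {1..\<kappa>} \<Longrightarrow>
      psg s k i * (psg s k j * (W i j * E k l)) = psg s l i * (psg s l j * (E k l * W i j))"
    and z: "central z" "central \<gamma>"
  shows "mat4_mul \<kappa> (first_factor s W) (second_factor (lop E z \<gamma>)) = mat4_mul \<kappa> (second_factor (lop E z \<gamma>)) (first_factor s W)"
    and "mat4_mul \<kappa> (first_factor s (lop E z \<gamma>)) (second_factor W) = mat4_mul \<kappa> (second_factor W) (first_factor s (lop E z \<gamma>))"
proof -
  have p: "central (1 + \<gamma> * z)" using z by (intro central_add central_mult) (auto simp: central_def[of 1])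
  note c = centralD[OF z(1), of "W _ _"] centralD[OF z(1), of "psg s _ _"] centralD[OF z(2), of "W _ _"]
  have 1: "psg s k i * (psg s k j * (W i j * lop E z \<gamma> k l)) = psg s l i * (psg s l j * (lop E z \<gamma> k l * W i j))"
    if "i \<in> {1..\<kappa>}" "j \<in> {1..\<kappa>}" "k \<in> {1..\<kappa>}" "l \<in> {1..\<kappa>}" for i j k l
    using arg_cong[OF WE[OF that], of "\<lambda>w. z * w"] unfolding lop_def
    by (cases "k = l") (simp_all add: distrib_left distrib_right mult.assoc c)
  show "mat4_mul \<kappa> (first_factor s W) (second_factor (lop E z \<gamma>)) = mat4_mul \<kappa> (second_factor (lop E z \<gamma>)) (first_factor s W)"
    by (rule mat4_mul_eqI) (simp only: first_second 1)
  have 2: "psg s k i * (psg s k j * (lop E z \<gamma> i j * W k l)) = psg s l i * (psg s l j * (W k l * lop E z \<gamma> i j))"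
    if "i \<in> {1..\<kappa>}" "j \<in> {1..\<kappa>}" "k \<in> {1..\<kappa>}" "l \<in> {1..\<kappa>}" for i j k l
    using arg_cong[OF 1[OF that(3,4,1,2)], of "\<lambda>w. psg s l j * (psg s k i * w)"]
    by (simp add: psg_psg_commute psg_sym)
  show "mat4_mul \<kappa> (first_factor s (lop E z \<gamma>)) (second_factor W) = mat4_mul \<kappa> (second_factor W) (first_factor s (lop E z \<gamma>))"
    by (rule mat4_mul_eqI) (simp only: first_second 2)
qed

lemma reflection_dress:
  assumes "reflection_eq \<kappa> s (y - x) (x + y) (x * y) U V"
  shows "reflection_eq \<kappa> s (y - x) (x + y) (x * y) (mat_mul \<kappa> (lop E x \<alpha>) (mat_mul \<kappa> U (lop E x \<beta>)))
     (mat_mul \<kappa> (lop E y \<alpha>) (mat_mul \<kappa> V (lop E y \<beta>)))"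
proof -
  interpret mat4: semigroup "mat4_mul \<kappa>" by unfold_locales (rule mat4_mul_assoc)
  let ?r = "Rop s (y - x) (x * y)" and ?q = "Rop s (x + y) (x * y)"
  let ?f = "first_factor s" and ?g = "second_factor :: _ \<Rightarrow> 'b mat4"
  \<comment> \<open>The exchange of the right factor with the left one through R(u + v) has the
    parameters in the opposite order.\<close>
  have zero': "\<beta> + \<alpha> + \<nu> = 0" using zero by (simp add: add_ac)
  have d: "mat4_mul \<kappa> ?r (mat4_mul \<kappa> (mat4_mul \<kappa> (?f (lop E x \<alpha>)) (mat4_mul \<kappa> (?f U) (?f (lop E x \<beta>))))
      (mat4_mul \<kappa> ?q (mat4_mul \<kappa> (?g (lop E y \<alpha>)) (mat4_mul \<kappa> (?g V) (?g (lop E y \<beta>)))))) =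
    mat4_mul \<kappa> (mat4_mul \<kappa> (?g (lop E y \<alpha>)) (mat4_mul \<kappa> (?g V) (?g (lop E y \<beta>))))
      (mat4_mul \<kappa> ?q (mat4_mul \<kappa> (mat4_mul \<kappa> (?f (lop E x \<alpha>)) (mat4_mul \<kappa> (?f U) (?f (lop E x \<beta>)))) ?r))"
    by (rule mat4.dressing[OF lop_RTT[OF commutator square central(1,2,3)] lop_RTT[OF commutator square central(1,2,4)]
        lop_SRT[OF commutator square central(1,2,4,3) zero'] lop_SRT[OF commutator square central(1,2,3,4) zero]
        lop_supercommute(1)[OF UE central(2,3)] lop_supercommute(1)[OF UE central(2,4)]
        lop_supercommute(2)[OF VE central(1,3)] lop_supercommute(2)[OF VE central(1,4)]
        assms[unfolded reflection_eq_def]])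
  have f': "mat4_mul \<kappa> (?f (lop E x \<alpha>)) (?f (mat_mul \<kappa> U (lop E x \<beta>))) =
      mat4_mul \<kappa> (?f (lop E x \<alpha>)) (mat4_mul \<kappa> (?f U) (?f (lop E x \<beta>)))"
    by (rule mat4_mul_cong) (simp_all only: first_factor_mul)
  have g': "mat4_mul \<kappa> (?g (lop E y \<alpha>)) (?g (mat_mul \<kappa> V (lop E y \<beta>))) =
      mat4_mul \<kappa> (?g (lop E y \<alpha>)) (mat4_mul \<kappa> (?g V) (?g (lop E y \<beta>)))"
    by (rule mat4_mul_cong) (simp_all only: second_factor_mul)
  have f: "?f (mat_mul \<kappa> (lop E x \<alpha>) (mat_mul \<kappa> U (lop E x \<beta>))) i j k l =
      mat4_mul \<kappa> (?f (lop E x \<alpha>)) (mat4_mul \<kappa> (?f U) (?f (lop E x \<beta>))) i j k l"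
    if "i \<in> {1..\<kappa>}" "j \<in> {1..\<kappa>}" "k \<in> {1..\<kappa>}" "l \<in> {1..\<kappa>}" for i j k l
    unfolding first_factor_mul[OF that] f' ..
  have g: "?g (mat_mul \<kappa> (lop E y \<alpha>) (mat_mul \<kappa> V (lop E y \<beta>))) i j k l =
      mat4_mul \<kappa> (?g (lop E y \<alpha>)) (mat4_mul \<kappa> (?g V) (?g (lop E y \<beta>))) i j k l"
    if "i \<in> {1..\<kappa>}" "j \<in> {1..\<kappa>}" "k \<in> {1..\<kappa>}" "l \<in> {1..\<kappa>}" for i j k l
    unfolding second_factor_mul[OF that] g' ..
  have F: "mat4_mul \<kappa> (?f (mat_mul \<kappa> (lop E x \<alpha>) (mat_mul \<kappa> U (lop E x \<beta>)))) Z =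
      mat4_mul \<kappa> (mat4_mul \<kappa> (?f (lop E x \<alpha>)) (mat4_mul \<kappa> (?f U) (?f (lop E x \<beta>)))) Z" for Z
    by (rule mat4_mul_cong) (simp_all only: f)
  have G: "mat4_mul \<kappa> Z (?g (mat_mul \<kappa> (lop E y \<alpha>) (mat_mul \<kappa> V (lop E y \<beta>)))) =
      mat4_mul \<kappa> Z (mat4_mul \<kappa> (?g (lop E y \<alpha>)) (mat4_mul \<kappa> (?g V) (?g (lop E y \<beta>))))"
    "mat4_mul \<kappa> (?g (mat_mul \<kappa> (lop E y \<alpha>) (mat_mul \<kappa> V (lop E y \<beta>)))) Z =
      mat4_mul \<kappa> (mat4_mul \<kappa> (?g (lop E y \<alpha>)) (mat4_mul \<kappa> (?g V) (?g (lop E y \<beta>)))) Z" for Z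
    by (rule mat4_mul_cong, simp_all only: g)+
  show ?thesis unfolding reflection_eq_def F G by (rule d)
qed

end

lemma reflection_eq_scale:
  assumes "central c" "central d" "reflection_eq \<kappa> s a a' b U V"
  shows "reflection_eq \<kappa> s a a' b (\<lambda>i j. c * U i j) (\<lambda>i j. d * V i j)"
proof -
  have f: "first_factor s (\<lambda>i j. c * U i j) = (\<lambda>i j k l. c * first_factor s U i j k l)"
    by (auto simp: first_factor_def fun_eq_iff centralD(2)[OF assms(1), of "psg s _ _"])
  have g: "second_factor (\<lambda>i j. d * V i j) = (\<lambda>i j k l. d * second_factor V i j k l)"
    by (auto simp: second_factor_def fun_eq_iff)
  have l: "mat4_mul \<kappa> (\<lambda>i j k l. z * X i j k l) Y = (\<lambda>i j k l. z * mat4_mul \<kappa> X Y i j k l)" for z X Y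
    by (auto simp: mat4_mul_def fun_eq_iff sum_distrib_left mult.assoc)
  have r: "mat4_mul \<kappa> X (\<lambda>i j k l. z * Y i j k l) = (\<lambda>i j k l. z * mat4_mul \<kappa> X Y i j k l)" if "central z" for z X Y
    by (auto simp: mat4_mul_def fun_eq_iff sum_distrib_left centralD(2)[OF that])
  show ?thesis
    using assms(3) unfolding reflection_eq_def f g l r[OF assms(1)] r[OF assms(2)]
    by (auto simp: fun_eq_iff centralD(2)[OF assms(1), of d])
qed

lemma fps_neg_arg_mult: "fps_neg_arg (f * g) = fps_neg_arg f * fps_neg_arg g" for f g :: "'a::ring_1 fps"
proof (rule fps_ext)
  fix n
  have "(-1) ^ n * (f $ i * g $ (n - i)) = (-1) ^ i * f $ i * ((-1) ^ (n - i) * g $ (n - i))" if "i \<in> {0..n}" for i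
    using that by (auto simp: minus_one_power_iff)
  then show "fps_neg_arg (f * g) $ n = (fps_neg_arg f * fps_neg_arg g) $ n"
    by (simp add: fps_neg_arg_def fps_mult_nth sum_distrib_left)
qed

lemma fps_neg_arg_add: "fps_neg_arg (f + g) = fps_neg_arg f + fps_neg_arg g" for f g :: "'a::ring_1 fps"
  by (simp add: fps_neg_arg_def fps_eq_iff distrib_left)

lemma fps_neg_arg_sum: "fps_neg_arg (sum f A) = (\<Sum>a\<in>A. fps_neg_arg (f a))" for f :: "_ \<Rightarrow> 'a::ring_1 fps"
  by (simp add: fps_neg_arg_def fps_eq_iff fps_sum_nth sum_distrib_left)

lemma fps_neg_arg_simps: "fps_neg_arg (1 :: 'a::ring_1 fps) = 1" "fps_neg_arg (0 :: 'a fps) = 0"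
  "fps_neg_arg (fps_const c) = fps_const (c :: 'a)" "fps_neg_arg (fps_X :: 'a fps) = - fps_X"
  by (auto simp: fps_neg_arg_def fps_eq_iff)

lemma ser_in_Y_mult: "ser_in_Y (f * g) = ser_in_Y f * ser_in_Y g" for f g :: "'a::ring_1 fps"
  by (simp add: ser_in_Y_def fps_eq_iff fps_mult_nth fps_sum_nth)

lemma ser_in_Y_add: "ser_in_Y (f + g) = ser_in_Y f + ser_in_Y g" for f g :: "'a::ring_1 fps"
  by (simp add: ser_in_Y_def fps_eq_iff)

lemma ser_in_Y_sum: "ser_in_Y (sum f A) = (\<Sum>a\<in>A. ser_in_Y (f a))" for f :: "_ \<Rightarrow> 'a::ring_1 fps"
  by (simp add: ser_in_Y_def fps_eq_iff fps_sum_nth)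

lemma ser_in_Y_simps: "ser_in_Y (1 :: 'a::ring_1 fps) = 1" "ser_in_Y (0 :: 'a fps) = 0"
  "ser_in_Y (fps_const c) = fps_const (fps_const (c :: 'a))" "ser_in_Y (fps_X :: 'a fps) = fps_X"
  by (auto simp: ser_in_Y_def fps_eq_iff)

lemma psg_nth: "(psg s i j * f) $ r = psg s i j * f $ r" for f :: "'a::ring_1 fps"
  unfolding psg_def by (cases "even (par s i * par s j)") (simp_all add: minus_one_power_iff)

lemma fps_const_psg: "fps_const (psg s i j * c) = psg s i j * fps_const c" for c :: "'a::ring_1"
  unfolding psg_def by (cases "even (par s i * par s j)") (simp_all add: minus_one_power_iff fps_eq_iff)

lemma ser_in_Y_psg: "ser_in_Y (psg s i j * f) = psg s i j * ser_in_Y f" for f :: "'a::ring_1 fps"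
  unfolding psg_def ser_in_Y_def
  by (cases "even (par s i * par s j)") (simp_all add: minus_one_power_iff fps_eq_iff)

definition gl_commutator :: "nat \<Rightarrow> (nat \<Rightarrow> int) \<Rightarrow> (nat \<Rightarrow> nat \<Rightarrow> 'a::ring_1) \<Rightarrow> bool" where
  "gl_commutator \<kappa> s E \<longleftrightarrow> (\<forall>i\<in>{1..\<kappa>}. \<forall>j\<in>{1..\<kappa>}. \<forall>k\<in>{1..\<kappa>}. \<forall>l\<in>{1..\<kappa>}.
      psg s k i * (psg s k j * (E i j * E k l)) - psg s l i * (psg s l j * (E k l * E i j)) =
      (if k = j then psg s i k * E i l else 0) - (if i = l then psg s i j * E k j else 0))"

definition gl_supercommute :: "nat \<Rightarrow> (nat \<Rightarrow> int) \<Rightarrow> (nat \<Rightarrow> nat \<Rightarrow> 'a::ring_1) \<Rightarrow> (nat \<Rightarrow> nat \<Rightarrow> 'a) \<Rightarrow> bool" where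
  "gl_supercommute \<kappa> s b E \<longleftrightarrow> (\<forall>i\<in>{1..\<kappa>}. \<forall>j\<in>{1..\<kappa>}. \<forall>k\<in>{1..\<kappa>}. \<forall>l\<in>{1..\<kappa>}.
      psg s k i * (psg s k j * (b i j * E k l)) = psg s l i * (psg s l j * (E k l * b i j)))"

lemma gl_commutator_fps_const:
  assumes "gl_commutator \<kappa> s E"
  shows "gl_commutator \<kappa> s (\<lambda>i j. fps_const (E i j))"
  unfolding gl_commutator_def
proof (intro ballI)
  fix i j k l assume "i \<in> {1..\<kappa>}" "j \<in> {1..\<kappa>}" "k \<in> {1..\<kappa>}" "l \<in> {1..\<kappa>}"
  then have "psg s k i * (psg s k j * (E i j * E k l)) - psg s l i * (psg s l j * (E k l * E i j)) =
      (if k = j then psg s i k * E i l else 0) - (if i = l then psg s i j * E k j else 0)"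
    using assms unfolding gl_commutator_def by blast
  from arg_cong[OF this, of fps_const]
  show "psg s k i * (psg s k j * (fps_const (E i j) * fps_const (E k l))) - psg s l i * (psg s l j * (fps_const (E k l) * fps_const (E i j))) =
      (if k = j then psg s i k * fps_const (E i l) else 0) - (if i = l then psg s i j * fps_const (E k j) else 0)"
    by (simp flip: fps_const_sub add: fps_const_psg if_distrib[of fps_const] cong: if_cong)
qed

lemma mat_mul_fps_const: "mat_mul \<kappa> (\<lambda>i j. fps_const (x i j)) (\<lambda>i j. fps_const (y i j)) k l = fps_const (mat_mul \<kappa> x y k l)"
  by (simp add: mat_mul_def fps_const_sum)

lemma mat_mul_scalar_left:
  assumes "\<And>l. l \<in> {1..\<kappa>} \<Longrightarrow> P i l = (if i = l then c else 0)" "i \<in> {1..\<kappa>}"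
  shows "mat_mul \<kappa> P W i j = c * W i j"
proof -
  have "mat_mul \<kappa> P W i j = (\<Sum>l\<in>{1..\<kappa>}. if l = i then c * W i j else 0)"
    unfolding mat_mul_def using assms(1) by (intro sum.cong) auto
  then show ?thesis using assms(2) by simp
qed

text \<open>The right-hand side of \<open>dressed_diag\<close> as a complex series, with
  \<open>e k\<close> the eigenvalue of E_kk and f the factor that restores unitarity.\<close>

definition dressed_weight :: "nat \<Rightarrow> (nat \<Rightarrow> int) \<Rightarrow> (nat \<Rightarrow> complex) \<Rightarrow> complex \<Rightarrow> complex \<Rightarrow> complex fps \<Rightarrow> (nat \<Rightarrow> complex fps) \<Rightarrow> nat \<Rightarrow> complex fps" where
  "dressed_weight \<kappa> s e a a' f \<mu> i = (let A = fps_const a; A' = fps_const a'; c = (\<lambda>i. fps_const (e i)) in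
     f * ((1 + A' * fps_X) * ((1 + A * fps_X) * \<mu> i + fps_X * (\<mu> i * c i)) + fps_X * ((1 + A * fps_X) * (\<mu> i * c i)
       + fps_X * (c i * (\<mu> i * c i) + (\<Sum>u\<in>{i+1..\<kappa>}. fps_const (of_int (s u)) * (\<mu> u * c i - \<mu> u * c u))))))"

context scalar_ring
begin

definition scs :: "complex fps \<Rightarrow> 'a fps" where "scs g = Abs_fps (\<lambda>n. sc (g $ n))"

lemma scs_nth: "scs g $ n = sc (g $ n)" by (simp add: scs_def)
lemma scs_mult: "scs (f * g) = scs f * scs g" by (simp add: fps_eq_iff scs_nth fps_mult_nth sc_sum sc_mult)
lemma scs_add: "scs (f + g) = scs f + scs g" by (simp add: fps_eq_iff scs_nth sc_add)
lemma scs_diff: "scs (f - g) = scs f - scs g" by (simp add: fps_eq_iff scs_nth sc_diff)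
lemma scs_sum: "scs (sum f A) = (\<Sum>a\<in>A. scs (f a))" by (simp add: fps_eq_iff scs_nth fps_sum_nth sc_sum)
lemma scs_simps: "scs 1 = 1" "scs 0 = 0" "scs (fps_const c) = fps_const (sc c)" "scs fps_X = fps_X"
  by (auto simp: fps_eq_iff scs_nth)
lemma scs_neg: "fps_neg_arg (scs f) = scs (fps_neg_arg f)"
  by (simp add: fps_eq_iff fps_neg_arg_def scs_nth sc_mult sc_power sc_minus)

lemma central_scs: "central (scs g)"
  unfolding central_def
proof (intro allI fps_ext)
  fix F n
  have "(F * scs g) $ n = (\<Sum>i=0..n. sc (g $ i) * F $ (n - i))"
    unfolding fps_mult_nth scs_nth
    by (rule sum.reindex_bij_witness[of _ "\<lambda>i. n - i" "\<lambda>i. n - i"]) (auto simp: centralD(1)[OF sc_central])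
  then show "(F * scs g) $ n = (scs g * F) $ n" by (simp add: fps_mult_nth scs_nth)
qed

lemma psg_scs: "s u = 1 \<or> s u = -1 \<Longrightarrow> psg s u u = scs (fps_const (of_int (s u)))"
  by (auto simp: psg_def par_def scs_simps sc_minus fps_eq_iff)

definition JF :: "'a fps set" where "JF = {g. \<forall>n. g $ n \<in> J}"

lemma JF_left_ideal: "left_ideal_ring JF"
  by unfold_locales (auto simp: JF_def J_0 J_add fps_mult_nth intro!: J_sum J_mult)

definition dress :: "nat \<Rightarrow> (nat \<Rightarrow> nat \<Rightarrow> 'a) \<Rightarrow> complex \<Rightarrow> complex \<Rightarrow> complex fps \<Rightarrow> (nat \<Rightarrow> nat \<Rightarrow> 'a fps) \<Rightarrow> nat \<Rightarrow> nat \<Rightarrow> 'a fps" where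
  "dress \<kappa> E a a' f b i j = scs f * mat_mul \<kappa> (lop (\<lambda>i j. fps_const (E i j)) fps_X (fps_const (sc a)))
     (mat_mul \<kappa> b (lop (\<lambda>i j. fps_const (E i j)) fps_X (fps_const (sc a')))) i j"

lemma hw_dress:
  assumes s: "\<forall>i\<in>{1..\<kappa>}. s i = 1 \<or> s i = -1" and rep: "hw_rep \<kappa> s \<epsilon> \<mu> b"
    and comm: "gl_commutator \<kappa> s E"
    and square: "\<And>k l. mat_mul \<kappa> E E k l = sc \<nu> * E k l"
    and bE: "gl_supercommute \<kappa> s b (\<lambda>i j. fps_const (E i j))"
    and E_upper: "\<And>k l. k \<in> {1..\<kappa>} \<Longrightarrow> l \<in> {1..\<kappa>} \<Longrightarrow> k < l \<Longrightarrow> E k l \<in> J"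
    and E_diag: "\<And>k. k \<in> {1..\<kappa>} \<Longrightarrow> E k k - sc (e k) \<in> J"
    and a: "a + a' + \<nu> = 0"
    and f: "f * ((1 + fps_const a * fps_X) * (1 + fps_const a' * fps_X)) = 1"
  shows "hw_rep \<kappa> s \<epsilon> (dressed_weight \<kappa> s e a a' f \<mu>) (dress \<kappa> E a a' f b)"
proof -
  let ?E = "\<lambda>i j. fps_const (E i j)" and ?A = "fps_const (sc a)" and ?A' = "fps_const (sc a')" and ?N = "fps_const (sc \<nu>)"
  let ?T = "lop ?E fps_X ?A" and ?S = "lop ?E fps_X ?A'"
  have cA: "central (fps_const (sc c))" for c by (intro central_fps_const sc_central)
  have zero: "?A + ?A' + ?N = 0" using a by (simp flip: sc_add)
  have zero': "?A' + ?A + ?N = 0" using zero by (simp add: add_ac)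
  have b0: "b i j $ 0 = (if i = j then sc (of_int (\<epsilon> i)) else 0)" if "i \<in> {1..\<kappa>}" "j \<in> {1..\<kappa>}" for i j
    using rep that unfolding hw_rep_def by blast
  have sqF: "mat_mul \<kappa> ?E ?E k l = ?N * ?E k l" for k l
    by (simp add: mat_mul_fps_const square)
  have commF: "gl_commutator \<kappa> s ?E" by (rule gl_commutator_fps_const[OF comm])
  note commF' = commF[unfolded gl_commutator_def, rule_format]
  note bE' = bE[unfolded gl_supercommute_def, rule_format]

  have zeroth: "dress \<kappa> E a a' f b i j $ 0 = (if i = j then sc (of_int (\<epsilon> i)) else 0)"
    if ij: "i \<in> {1..\<kappa>}" "j \<in> {1..\<kappa>}" for i j
  proof -
    have l0: "lop ?E fps_X (fps_const (sc c)) u v $ 0 = (if u = v then 1 else 0)" for u v c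
      by (simp add: lop_def)
    have "f $ 0 = 1" using arg_cong[OF f, of "\<lambda>g. g $ 0"] by simp
    then show ?thesis
      using ij b0[OF ij] unfolding dress_def mat_mul_def
      by (simp add: scs_nth fps_sum_nth l0 mult_delta_left mult_delta_right)
  qed

  \<comment> \<open>Entries are lifted to double series: \<open>?U\<close> is constant in Y,
    \<open>?V\<close> has the same coefficients as a series in Y, and X and Y are central
    there.\<close>
  have refl: "refl_XY \<kappa> s (dress \<kappa> E a a' f b)"
  proof -
    let ?EZ = "\<lambda>i j. fps_const (?E i j)" and ?x = "XY 1 0 :: 'a fps fps" and ?y = "XY 0 1 :: 'a fps fps"
    let ?U = "\<lambda>i j. fps_const (b i j)" and ?V = "\<lambda>i j. ser_in_Y (b i j)"
    have xy: "?x = fps_const fps_X" "?y = fps_X" by (simp_all add: XY_def)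
    have xy1: "XY 1 1 = ?x * ?y" by (simp add: XY_def)
    have commZ: "gl_commutator \<kappa> s ?EZ" by (rule gl_commutator_fps_const[OF commF])
    have sqZ: "mat_mul \<kappa> ?EZ ?EZ k l = fps_const ?N * ?EZ k l" for k l
      using mat_mul_fps_const[of \<kappa> ?E ?E] by (simp add: sqF)
    have UE: "psg s k i * (psg s k j * (?U i j * ?EZ k l)) = psg s l i * (psg s l j * (?EZ k l * ?U i j))"
      if "i \<in> {1..\<kappa>}" "j \<in> {1..\<kappa>}" "k \<in> {1..\<kappa>}" "l \<in> {1..\<kappa>}" for i j k l
      using arg_cong[OF bE'[OF that], of fps_const] by (simp add: fps_const_psg)
    have VE: "psg s k i * (psg s k j * (?V i j * ?EZ k l)) = psg s l i * (psg s l j * (?EZ k l * ?V i j))"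
      if "i \<in> {1..\<kappa>}" "j \<in> {1..\<kappa>}" "k \<in> {1..\<kappa>}" "l \<in> {1..\<kappa>}" for i j k l
      using arg_cong[OF bE'[OF that], of ser_in_Y] unfolding ser_in_Y_psg unfolding ser_in_Y_mult ser_in_Y_simps .
    have zeroZ: "fps_const ?A + fps_const ?A' + fps_const ?N = 0"
      using arg_cong[OF zero, of fps_const] by simp
    have "reflection_eq \<kappa> s (?y - ?x) (?x + ?y) (?x * ?y) ?U ?V"
      using rep unfolding hw_rep_def xy1 by blast
    from reflection_dress[OF commZ[unfolded gl_commutator_def, rule_format] sqZ UE VE central_XY central_XY
        central_fps_const[OF cA[of a]] central_fps_const[OF cA[of a']] zeroZ this]
    have R: "reflection_eq \<kappa> s (?y - ?x) (?x + ?y) (?x * ?y)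
       (mat_mul \<kappa> (lop ?EZ ?x (fps_const ?A)) (mat_mul \<kappa> ?U (lop ?EZ ?x (fps_const ?A'))))
       (mat_mul \<kappa> (lop ?EZ ?y (fps_const ?A)) (mat_mul \<kappa> ?V (lop ?EZ ?y (fps_const ?A'))))" .
    have cY: "central (ser_in_Y (scs f))"
      unfolding central_def
    proof (intro allI)
      fix F :: "'a fps fps"
      have c: "central (ser_in_Y (scs f) $ q)" for q
        by (simp add: ser_in_Y_def scs_nth cA)
      show "F * ser_in_Y (scs f) = ser_in_Y (scs f) * F"
      proof (rule fps_ext)
        fix n
        show "(F * ser_in_Y (scs f)) $ n = (ser_in_Y (scs f) * F) $ n"
          unfolding fps_mult_nth
          by (rule sum.reindex_bij_witness[of _ "\<lambda>i. n - i" "\<lambda>i. n - i"]) (auto simp: centralD(1)[OF c])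
      qed
    qed
    have u: "fps_const (dress \<kappa> E a a' f b i j) =
        fps_const (scs f) * mat_mul \<kappa> (lop ?EZ ?x (fps_const ?A)) (mat_mul \<kappa> ?U (lop ?EZ ?x (fps_const ?A'))) i j" for i j
    proof -
      have l: "fps_const (lop ?E fps_X c i j) = lop ?EZ ?x (fps_const c) i j" for c i j
        unfolding lop_def xy by (simp flip: fps_const_add fps_const_mult)
      show ?thesis unfolding dress_def fps_const_mult[symmetric] mat_mul_fps_const[symmetric] l ..
    qed
    have v: "ser_in_Y (dress \<kappa> E a a' f b i j) =
        ser_in_Y (scs f) * mat_mul \<kappa> (lop ?EZ ?y (fps_const ?A)) (mat_mul \<kappa> ?V (lop ?EZ ?y (fps_const ?A'))) i j" for i j
    proof -
      have l: "ser_in_Y (lop ?E fps_X (fps_const c) i j) = lop ?EZ ?y (fps_const (fps_const c)) i j" for c i j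
        unfolding lop_def xy by (simp add: ser_in_Y_add ser_in_Y_mult ser_in_Y_simps)
      show ?thesis unfolding dress_def mat_mul_def ser_in_Y_mult ser_in_Y_sum l ..
    qed
    show ?thesis unfolding u v xy1
      by (rule reflection_eq_scale[OF central_fps_const[OF central_scs] cY R])
  qed

  have unit: "mat_mul \<kappa> (dress \<kappa> E a a' f b) (\<lambda>i j. fps_neg_arg (dress \<kappa> E a a' f b i j)) i j = (if i = j then 1 else 0)"
    if ij: "i \<in> {1..\<kappa>}" "j \<in> {1..\<kappa>}" for i j
  proof -
    let ?T' = "lop ?E (- fps_X) ?A" and ?S' = "lop ?E (- fps_X) ?A'" and ?bn = "\<lambda>i j. fps_neg_arg (b i j)"
    define F where "F = scs f"
    define F' where "F' = scs (fps_neg_arg f)"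
    have cX: "central (fps_X :: 'a fps)" "central (- fps_X :: 'a fps)"
      using central_fps_X by (auto simp: central_def)
    \<comment> \<open>L'(u) L(-u) and L(u) L'(-u) are the scalars c1 and c2, since the parameters
      add up to -\<nu>. The product of the dressed matrices collapses from the inside: c1, then the
      old unitarity, then c2.\<close>
    define c1 where "c1 = (1 + ?A' * fps_X) * (1 + ?A * (- fps_X))"
    define c2 where "c2 = (1 + ?A * fps_X) * (1 + ?A' * (- fps_X))"
    have ST: "mat_mul \<kappa> ?S ?T' k l = (if k = l then c1 else 0)" if "k \<in> {1..\<kappa>}" "l \<in> {1..\<kappa>}" for k l
      using lop_product[where E = ?E and \<nu> = ?N and x = fps_X and y = "- fps_X" and \<alpha> = ?A' and \<beta> = ?A, OF commF' sqF cX cA cA that]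
      unfolding zero' c1_def by simp
    have TS: "mat_mul \<kappa> ?T ?S' k l = (if k = l then c2 else 0)" if "k \<in> {1..\<kappa>}" "l \<in> {1..\<kappa>}" for k l
      using lop_product[where E = ?E and \<nu> = ?N and x = fps_X and y = "- fps_X" and \<alpha> = ?A and \<beta> = ?A', OF commF' sqF cX cA cA that]
      unfolding zero c2_def by simp
    have bb: "mat_mul \<kappa> b ?bn k l = (if k = l then 1 else 0)" if "k \<in> {1..\<kappa>}" "l \<in> {1..\<kappa>}" for k l
      using rep that unfolding hw_rep_def by blast
    have cc: "central c1" unfolding c1_def by (intro central_mult central_add cX cA) (auto simp: central_def[of 1])
    have neg: "fps_neg_arg (dress \<kappa> E a a' f b k l) = F' * mat_mul \<kappa> ?T' (mat_mul \<kappa> ?bn ?S') k l" for k l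
    proof -
      have "fps_neg_arg (lop ?E fps_X (fps_const c) i j) = lop ?E (- fps_X) (fps_const c) i j" for c i j
        unfolding lop_def by (simp add: fps_neg_arg_add fps_neg_arg_mult fps_neg_arg_simps)
      then show ?thesis unfolding dress_def mat_mul_def
        by (simp add: fps_neg_arg_mult fps_neg_arg_sum scs_neg F'_def)
    qed
    have inner: "mat_mul \<kappa> b (mat_mul \<kappa> ?S (mat_mul \<kappa> ?T' (mat_mul \<kappa> ?bn ?S'))) k l = c1 * ?S' k l" if k: "k \<in> {1..\<kappa>}" for k l
    proof -
      have "mat_mul \<kappa> b (mat_mul \<kappa> ?S (mat_mul \<kappa> ?T' (mat_mul \<kappa> ?bn ?S'))) k l = (\<Sum>m\<in>{1..\<kappa>}. b k m * (c1 * mat_mul \<kappa> ?bn ?S' m l))"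
        unfolding mat_mul_assoc[symmetric, of \<kappa> ?S] unfolding mat_mul_def[of \<kappa> b]
        by (intro sum.cong HOL.refl arg_cong2[where f = "(*)"] mat_mul_scalar_left ST)
      also have "\<dots> = c1 * mat_mul \<kappa> b (mat_mul \<kappa> ?bn ?S') k l"
        by (simp add: centralD(2)[OF cc] sum_distrib_left mat_mul_def[of \<kappa> b])
      also have "mat_mul \<kappa> b (mat_mul \<kappa> ?bn ?S') k l = 1 * ?S' k l"
        unfolding mat_mul_assoc[symmetric] by (intro mat_mul_scalar_left bb k)
      finally show ?thesis by simp
    qed
    have "mat_mul \<kappa> (dress \<kappa> E a a' f b) (\<lambda>i j. fps_neg_arg (dress \<kappa> E a a' f b i j)) i j =
       F * (F' * mat_mul \<kappa> (mat_mul \<kappa> ?T (mat_mul \<kappa> b ?S)) (mat_mul \<kappa> ?T' (mat_mul \<kappa> ?bn ?S')) i j)"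
      unfolding mat_mul_def[of \<kappa> "dress \<kappa> E a a' f b"] neg unfolding dress_def F_def[symmetric]
        mat_mul_def[of \<kappa> "mat_mul \<kappa> ?T (mat_mul \<kappa> b ?S)"] sum_distrib_left
      by (intro sum.cong HOL.refl) (simp add: F'_def mult.assoc centralD(2)[OF central_scs])
    also have "mat_mul \<kappa> (mat_mul \<kappa> ?T (mat_mul \<kappa> b ?S)) (mat_mul \<kappa> ?T' (mat_mul \<kappa> ?bn ?S')) i j =
       (\<Sum>m\<in>{1..\<kappa>}. ?T i m * (c1 * ?S' m j))"
      unfolding mat_mul_assoc unfolding mat_mul_def[of \<kappa> ?T] by (intro sum.cong HOL.refl arg_cong2[where f = "(*)"] inner)
    also have "\<dots> = c1 * mat_mul \<kappa> ?T ?S' i j"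
      by (simp add: centralD(2)[OF cc] sum_distrib_left mat_mul_def)
    also have "\<dots> = c1 * (if i = j then c2 else 0)" using TS[OF ij] by simp
    also have "F * (F' * (c1 * (if i = j then c2 else 0))) = (if i = j then F * (F' * (c1 * c2)) else 0)" by simp
    \<comment> \<open>Regrouped, c1 c2 is (1 + a X)(1 + a' X) times the same expression at -X; f
      inverts the first and its reflection the second.\<close>
    also have "F * (F' * (c1 * c2)) = 1"
    proof -
      let ?a = "fps_const a" and ?a' = "fps_const a'"
      have "c1 = scs ((1 + ?a' * fps_X) * (1 - ?a * fps_X))" "c2 = scs ((1 + ?a * fps_X) * (1 - ?a' * fps_X))"
        unfolding c1_def c2_def by (simp_all add: scs_mult scs_add scs_diff scs_simps)
      then have "F * (F' * (c1 * c2)) = scs (f * (fps_neg_arg f * (((1 + ?a' * fps_X) * (1 - ?a * fps_X)) * ((1 + ?a * fps_X) * (1 - ?a' * fps_X)))))"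
        unfolding F_def F'_def by (simp add: scs_mult)
      also have "f * (fps_neg_arg f * (((1 + ?a' * fps_X) * (1 - ?a * fps_X)) * ((1 + ?a * fps_X) * (1 - ?a' * fps_X)))) =
         (f * ((1 + ?a * fps_X) * (1 + ?a' * fps_X))) * (fps_neg_arg f * ((1 - ?a * fps_X) * (1 - ?a' * fps_X)))"
        by (simp only: mult_ac)
      also have "fps_neg_arg f * ((1 - ?a * fps_X) * (1 - ?a' * fps_X)) = 1"
        using arg_cong[OF f, of fps_neg_arg] by (simp add: fps_neg_arg_mult fps_neg_arg_add fps_neg_arg_simps)
      finally show ?thesis by (simp add: f scs_simps)
    qed
    finally show ?thesis .
  qed

  interpret jf: left_ideal_ring JF by (rule JF_left_ideal)
  have eqL_nth: "jf.eqL g h \<longleftrightarrow> (\<forall>n. g $ n - h $ n \<in> J)" for g h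
    unfolding jf.eqL_def by (simp add: JF_def)
  have J1: "?E k l \<in> JF" if "k \<in> {1..\<kappa>}" "l \<in> {1..\<kappa>}" "k < l" for k l
    using E_upper[OF that] by (auto simp: JF_def J_0)
  have J2: "jf.eqL (?E k k) (fps_const (sc (e k)))" if "k \<in> {1..\<kappa>}" for k
    unfolding eqL_nth using E_diag[OF that] by (auto simp: J_0)
  have J3: "b k l \<in> JF" if "k \<in> {1..\<kappa>}" "l \<in> {1..\<kappa>}" "k < l" for k l
    using rep that unfolding hw_rep_def JF_def by blast
  have J4: "jf.eqL (b k k) (scs (\<mu> k))" if "k \<in> {1..\<kappa>}" for k
    using rep that unfolding hw_rep_def eqL_nth scs_nth by blast
  note J_facts = commF' bE' J1 J2 J3 J4 central_scs cA central_fps_X cA[of a] cA[of a']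
  have upper: "dress \<kappa> E a a' f b i j \<in> JF" if "i \<in> {1..\<kappa>}" "j \<in> {1..\<kappa>}" "i < j" for i j
    unfolding dress_def by (rule jf.L_mult, rule jf.dressed_upper[OF J_facts that])
  have diag: "jf.eqL (dress \<kappa> E a a' f b i i) (scs (dressed_weight \<kappa> s e a a' f \<mu> i))" if i: "i \<in> {1..\<kappa>}" for i
  proof -
    have sgn: "(\<Sum>u\<in>{i+1..\<kappa>}. psg s u u * (scs (\<mu> u) * fps_const (sc (e i)) - scs (\<mu> u) * fps_const (sc (e u)))) =
       scs (\<Sum>u\<in>{i+1..\<kappa>}. fps_const (of_int (s u)) * (\<mu> u * fps_const (e i) - \<mu> u * fps_const (e u)))"
      unfolding scs_sum using i bspec[OF s] by (intro sum.cong HOL.refl) (simp add: psg_scs scs_mult scs_diff scs_simps)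
    have "scs (dressed_weight \<kappa> s e a a' f \<mu> i) = scs f * ((1 + ?A' * fps_X) * ((1 + ?A * fps_X) * scs (\<mu> i) + fps_X * (scs (\<mu> i) * fps_const (sc (e i))))
       + fps_X * ((1 + ?A * fps_X) * (scs (\<mu> i) * fps_const (sc (e i)))
       + fps_X * (fps_const (sc (e i)) * (scs (\<mu> i) * fps_const (sc (e i))) +
          (\<Sum>u\<in>{i+1..\<kappa>}. psg s u u * (scs (\<mu> u) * fps_const (sc (e i)) - scs (\<mu> u) * fps_const (sc (e u)))))))"
      unfolding sgn dressed_weight_def Let_def by (simp only: scs_mult scs_add scs_simps)
    then show ?thesis
      unfolding dress_def by (simp only:) (rule jf.eqL_mult, rule jf.dressed_diag[OF J_facts i])
  qed
  show ?thesis
    unfolding hw_rep_def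
    using zeroth refl unit upper[unfolded JF_def] diag[unfolded eqL_nth scs_nth] by blast
qed

end

subsection \<open>Realisable highest weights\<close>

text \<open>U and V are the same constant diagonal matrix with square 1, so each of the four terms
  vanishes by itself.\<close>

lemma reflection_eq_diag:
  fixes a a' b :: "'b::ring_1"
  assumes central: "central a" "central a'" "central b" and eps: "\<forall>i\<in>{1..\<kappa>}. \<epsilon> i = 1 \<or> \<epsilon> i = (-1 :: int)"
  shows "reflection_eq \<kappa> s a a' b (\<lambda>i j. if i = j then of_int (\<epsilon> i) else 0) (\<lambda>i j. if i = j then of_int (\<epsilon> i) else 0)"
proof (rule reflection_eqI[OF central])
  fix i j k l assume h: "i \<in> {1..\<kappa>}" "j \<in> {1..\<kappa>}" "k \<in> {1..\<kappa>}" "l \<in> {1..\<kappa>}"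
  let ?D = "\<lambda>i j. if i = j then of_int (\<epsilon> i) else (0 :: 'b)"
  have sq: "mat_mul \<kappa> ?D ?D p q = (if p = q then 1 else 0)" if "p \<in> {1..\<kappa>}" for p q
  proof -
    have "mat_mul \<kappa> ?D ?D p q = of_int (\<epsilon> p) * ?D p q"
      by (rule mat_mul_scalar_left[OF _ that]) simp
    then show ?thesis using bspec[OF eps that] by auto
  qed
  have comm: "of_int (\<epsilon> p) * of_int (\<epsilon> q) = of_int (\<epsilon> q) * (of_int (\<epsilon> p) :: 'b)" for p q
    by (simp flip: of_int_mult add: mult.commute)
  have 1: "psg s k i * (psg s k j * (?D i j * ?D k l)) - psg s l i * (psg s l j * (?D k l * ?D i j)) = 0"
    using comm[of i k] by auto
  have 2: "?D k j * ?D i l - ?D k j * ?D i l = 0" by simp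
  have 3: "(if k = j then psg s i j * mat_mul \<kappa> ?D ?D i l else 0) - (if i = l then psg s i j * mat_mul \<kappa> ?D ?D k j else 0) = 0"
    using h by (simp add: sq)
  show "a * (a' * (psg s k i * (psg s k j * (?D i j * ?D k l)) - psg s l i * (psg s l j * (?D k l * ?D i j))))
    - a' * (b * (psg s i j * (?D k j * ?D i l - ?D k j * ?D i l)))
    - a * (b * ((if k = j then psg s i j * mat_mul \<kappa> ?D ?D i l else 0) - (if i = l then psg s i j * mat_mul \<kappa> ?D ?D k j else 0)))
    + b * (b * (if i = j then mat_mul \<kappa> ?D ?D k l - mat_mul \<kappa> ?D ?D k l else 0)) = 0"
    unfolding 1 2 3 by simp
qed

context scalar_ring
begin

lemma sc_of_int: "sc (of_int z) = of_int z"
proof -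
  have nat: "sc (of_nat n) = of_nat n" for n by (induction n) (simp_all add: sc_add)
  show ?thesis by (cases z) (simp_all add: sc_minus sc_diff nat del: of_nat_Suc)
qed

text \<open>All operators are scalars, so every vector is a highest weight vector; g is the only
  freedom and will be used to prescribe the weight at the top index.\<close>

lemma hw_base:
  assumes eps: "\<forall>i\<in>{1..\<kappa>}. \<epsilon> i = 1 \<or> \<epsilon> i = (-1 :: int)" and g: "g * fps_neg_arg g = 1" "g $ 0 = 1"
  shows "hw_rep \<kappa> s \<epsilon> (\<lambda>i. fps_const (of_int (\<epsilon> i)) * g) (\<lambda>i j. if i = j then scs (fps_const (of_int (\<epsilon> i)) * g) else 0)"
proof -
  let ?b = "\<lambda>i j. if i = j then scs (fps_const (of_int (\<epsilon> i)) * g) else 0"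
  let ?D = "\<lambda>i j. if i = j then of_int (\<epsilon> i) else (0 :: 'a fps fps)"
  have oi: "scs (fps_const (of_int z) * g) = of_int z * scs g" for z
    unfolding scs_mult scs_simps(3) sc_of_int unfolding fps_of_int ..
  have R: "reflection_eq \<kappa> s (XY 0 1 - XY 1 0) (XY 1 0 + XY 0 1) (XY 1 1) ?D ?D"
    by (intro reflection_eq_diag eps central_XY central_add central_diff)
  have cY: "central (ser_in_Y (scs g))"
  proof -
    have c: "central (ser_in_Y (scs g) $ q)" for q
      by (simp add: ser_in_Y_def scs_nth central_fps_const sc_central)
    have "(F * ser_in_Y (scs g)) $ n = (ser_in_Y (scs g) * F) $ n" for F :: "'a fps fps" and n
    proof -
      have "F $ i * ser_in_Y (scs g) $ j = ser_in_Y (scs g) $ j * F $ i" for i j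
        using c[of j] unfolding central_def by auto
      then show ?thesis unfolding fps_mult_nth
        by (intro sum.reindex_bij_witness[of _ "\<lambda>i. n - i" "\<lambda>i. n - i"]) auto
    qed
    then show ?thesis unfolding central_def by (auto intro!: fps_ext)
  qed
  have sY: "ser_in_Y (of_int z) = of_int z" for z
  proof -
    have "ser_in_Y (fps_const (of_int z)) = fps_const (fps_const (of_int z))" by (simp add: ser_in_Y_simps)
    then show ?thesis by (simp only: fps_of_int)
  qed
  have "fps_const (?b i j) = fps_const (scs g) * ?D i j" for i j
    unfolding oi by (simp add: mult_of_int_commute fps_of_int flip: fps_const_mult)
  moreover have "ser_in_Y (?b i j) = ser_in_Y (scs g) * ?D i j" for i j
    unfolding oi by (simp add: mult_of_int_commute ser_in_Y_mult ser_in_Y_simps sY)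
  ultimately have "refl_XY \<kappa> s ?b"
    using reflection_eq_scale[OF central_fps_const[OF central_scs] cY R] by simp
  moreover have "mat_mul \<kappa> ?b (\<lambda>i j. fps_neg_arg (?b i j)) i j = (if i = j then 1 else 0)" if i: "i \<in> {1..\<kappa>}" for i j
  proof -
    have "mat_mul \<kappa> ?b (\<lambda>i j. fps_neg_arg (?b i j)) i j = scs (fps_const (of_int (\<epsilon> i)) * g) * fps_neg_arg (?b i j)"
      by (rule mat_mul_scalar_left[OF _ i]) simp
    also have "\<dots> = (if i = j then 1 else 0)"
    proof (cases "i = j")
      case True
      have "\<epsilon> i = 1 \<or> \<epsilon> i = -1" using eps i by blast
      moreover have neg: "fps_neg_arg (- g) = - fps_neg_arg g" by (simp add: fps_eq_iff fps_neg_arg_def)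
      ultimately have "fps_const (of_int (\<epsilon> i)) * g * fps_neg_arg (fps_const (of_int (\<epsilon> i)) * g) = 1"
        using g(1) neg by (elim disjE) (simp_all add: fps_neg_arg_mult fps_neg_arg_simps flip: fps_const_neg)
      then show ?thesis using True by (simp add: scs_neg scs_simps flip: scs_mult)
    qed (simp add: fps_neg_arg_simps)
    finally show ?thesis .
  qed
  ultimately show ?thesis
    unfolding hw_rep_def using g(2) by (simp add: J_0 scs_nth)
qed

text \<open>A nonzero scalar in J would be invertible and put 1 into J.\<close>

lemma hw_rep_weight_0:
  assumes rep: "hw_rep \<kappa> s \<epsilon> \<mu> b" and i: "i \<in> {1..\<kappa>}"
  shows "\<mu> i $ 0 = of_int (\<epsilon> i)"
proof (rule ccontr)
  assume ne: "\<mu> i $ 0 \<noteq> of_int (\<epsilon> i)"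
  have "b i i $ 0 - sc (\<mu> i $ 0) \<in> J" using rep i unfolding hw_rep_def by blast
  moreover have "b i i $ 0 = sc (of_int (\<epsilon> i))" using rep i unfolding hw_rep_def by auto
  ultimately have "sc (inverse (of_int (\<epsilon> i) - \<mu> i $ 0)) * sc (of_int (\<epsilon> i) - \<mu> i $ 0) \<in> J"
    by (auto simp: sc_diff intro: J_mult)
  then have "1 \<in> J" using ne by (simp flip: sc_mult)
  then show False using J_proper by simp
qed

end

definition graded_by :: "nat \<Rightarrow> (nat \<Rightarrow> 'a::ring_1) \<Rightarrow> 'a \<Rightarrow> (nat \<Rightarrow> nat \<Rightarrow> 'a) \<Rightarrow> bool" where
  "graded_by \<kappa> \<sigma> z A \<longleftrightarrow> (\<forall>i\<in>{1..\<kappa>}. \<forall>j\<in>{1..\<kappa>}. z * A i j = \<sigma> i * (\<sigma> j * (A i j * z)))"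

lemma graded_mat_mul:
  assumes \<sigma>: "\<And>i. \<sigma> i = 1 \<or> \<sigma> i = -1" and AB: "graded_by \<kappa> \<sigma> z A" "graded_by \<kappa> \<sigma> z B"
  shows "graded_by \<kappa> \<sigma> z (mat_mul \<kappa> A B)"
  unfolding graded_by_def
proof (intro ballI)
  fix i j assume ij: "i \<in> {1..\<kappa>}" "j \<in> {1..\<kappa>}"
  have "z * (A i a * B a j) = \<sigma> i * (\<sigma> j * (A i a * B a j * z))" if a: "a \<in> {1..\<kappa>}" for a
  proof -
    have l: "x * (\<sigma> i * y) = \<sigma> i * (x * y)" "\<sigma> i * (\<sigma> i * y) = y" for i x y
      using \<sigma>[of i] by auto
    have "z * (A i a * B a j) = (z * A i a) * B a j" by (simp add: mult.assoc)
    also have "\<dots> = \<sigma> i * (\<sigma> a * (A i a * (z * B a j)))"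
      using AB(1) ij a unfolding graded_by_def by (simp add: mult.assoc)
    also have "z * B a j = \<sigma> a * (\<sigma> j * (B a j * z))" using AB(2) ij a unfolding graded_by_def by simp
    also have "\<sigma> i * (\<sigma> a * (A i a * (\<sigma> a * (\<sigma> j * (B a j * z))))) = \<sigma> i * (\<sigma> j * (A i a * B a j * z))"
      unfolding l(1)[of "A i a" a] l(2) l(1)[of "A i a" j] by (simp add: mult.assoc)
    finally show ?thesis .
  qed
  then show "z * mat_mul \<kappa> A B i j = \<sigma> i * (\<sigma> j * (mat_mul \<kappa> A B i j * z))"
    by (simp add: mat_mul_def sum_distrib_left sum_distrib_right)
qed

lemma graded_lop:
  assumes \<sigma>: "\<And>i. \<sigma> i = 1 \<or> \<sigma> i = -1" and E: "graded_by \<kappa> \<sigma> z E" and c: "central x" "central \<alpha>"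
  shows "graded_by \<kappa> \<sigma> z (lop E x \<alpha>)"
  unfolding graded_by_def
proof (intro ballI)
  fix i j assume ij: "i \<in> {1..\<kappa>}" "j \<in> {1..\<kappa>}"
  have l: "x * (\<sigma> i * y) = \<sigma> i * (x * y)" "\<sigma> i * (\<sigma> i * y) = y" for i x y
    using \<sigma>[of i] by auto
  have p: "central (1 + \<alpha> * x)" using c by (intro central_add central_mult) (auto simp: central_def[of 1])
  have "z * (x * E i j) = x * (\<sigma> i * (\<sigma> j * (E i j * z)))"
    using E ij unfolding graded_by_def centralD(2)[OF c(1), of z] by simp
  then have "z * (x * E i j) = \<sigma> i * (\<sigma> j * (x * E i j * z))" by (simp only: l(1)[of x] mult.assoc)
  then show "z * lop E x \<alpha> i j = \<sigma> i * (\<sigma> j * (lop E x \<alpha> i j * z))"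
  proof -
    define P where "P = (if i = j then 1 + \<alpha> * x else 0)"
    have "z * P = P * z" unfolding P_def using centralD(1)[OF p, of z] by (cases "i = j") simp_all
    moreover have "\<sigma> i * (\<sigma> j * (P * z)) = P * z" unfolding P_def by (auto simp: l(2))
    ultimately show ?thesis
      using \<open>z * (x * E i j) = \<sigma> i * (\<sigma> j * (x * E i j * z))\<close>
      unfolding lop_def P_def[symmetric] by (simp add: distrib_left distrib_right)
  qed
qed

definition mode_parity :: "(nat \<Rightarrow> int) \<Rightarrow> nat \<Rightarrow> nat \<Rightarrow> 'a::ring_1" where
  "mode_parity s t i = (if odd t then psg s i i else 1)"

text \<open>From M on all oscillator modes supercommute with b and are free for the next dressing;
  this is what lets dressings be iterated on one fixed Fock space. M is even, so that an offset
  selects a mode of either parity.\<close>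

definition realizable :: "nat \<Rightarrow> (nat \<Rightarrow> int) \<Rightarrow> (nat \<Rightarrow> int) \<Rightarrow> (nat \<Rightarrow> complex fps) \<Rightarrow> bool" where
  "realizable \<kappa> s \<epsilon> \<mu> \<longleftrightarrow> (\<exists>b M. even M \<and> fock.hw_rep \<kappa> s \<epsilon> \<mu> b \<and>
     (\<forall>t\<ge>M. \<forall>k. graded_by \<kappa> (mode_parity s t) (fps_const (osc k t)) b))"

lemma mode_parity_cases: "mode_parity s t i = (1 :: 'a::ring_1) \<or> mode_parity s t i = (-1 :: 'a)"
  using psg_cases[of s i i, where 'a = 'a] by (auto simp: mode_parity_def)

lemma realizable_base:
  assumes "\<forall>i\<in>{1..\<kappa>}. \<epsilon> i = 1 \<or> \<epsilon> i = (-1 :: int)" "g * fps_neg_arg g = 1" "g $ 0 = 1"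
  shows "realizable \<kappa> s \<epsilon> (\<lambda>i. fps_const (of_int (\<epsilon> i)) * g)"
  unfolding realizable_def
proof (intro exI[of _ "\<lambda>i j. if i = j then fock.scs (fps_const (of_int (\<epsilon> i)) * g) else 0"] exI[of _ "0 :: nat"] conjI allI impI)
  fix t :: nat and k
  show "graded_by \<kappa> (mode_parity s t) (fps_const (osc k t)) (\<lambda>i j. if i = j then fock.scs (fps_const (of_int (\<epsilon> i)) * g) else 0)"
    unfolding graded_by_def
  proof (intro ballI)
    fix i j
    have "mode_parity s t i * (mode_parity s t i * w) = w" for i and w :: "fock_op fps"
      using mode_parity_cases[of s t i, where 'a = "fock_op fps"] by auto
    then show "fps_const (osc k t) * (if i = j then fock.scs (fps_const (of_int (\<epsilon> i)) * g) else 0) =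
      mode_parity s t i * (mode_parity s t j * ((if i = j then fock.scs (fps_const (of_int (\<epsilon> i)) * g) else 0) * fps_const (osc k t)))"
      by (simp add: centralD(1)[OF fock.central_scs])
  qed
qed (use fock.hw_base[OF assms] in auto)

lemma realizable_dress:
  assumes s: "\<forall>i\<in>{1..\<kappa>}. s i = 1 \<or> s i = -1" and real: "realizable \<kappa> s \<epsilon> \<mu>" and i0: "i0 \<in> {1..\<kappa>}"
    and a: "a + a' + (c + rho \<kappa> s (i0 + 1)) = 0"
    and f: "f * ((1 + fps_const a * fps_X) * (1 + fps_const a' * fps_X)) = 1"
  shows "realizable \<kappa> s \<epsilon> (dressed_weight \<kappa> s (\<lambda>k. if k = i0 then c else if i0 < k then 0 else - of_int (s i0)) a a' f \<mu>)"
proof -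
  obtain b M where M: "even M" and rep: "fock.hw_rep \<kappa> s \<epsilon> \<mu> b"
    and graded: "\<And>t k. t \<ge> M \<Longrightarrow> graded_by \<kappa> (mode_parity s t) (fps_const (osc k t)) b"
    using real unfolding realizable_def by blast
  let ?q = "psg (fock.rel_sign s i0)"
  \<comment> \<open>Two consecutive modes beyond M are reserved for each index k; the one is taken
    whose parity is that of k relative to i0.\<close>
  define mode where "mode = (\<lambda>k. M + 2 * k + par (fock.rel_sign s i0) k)"
  have odd_mode: "odd (mode k) \<longleftrightarrow> par (fock.rel_sign s i0) k = 1" for k
    using M by (auto simp: mode_def par_def)
  have mode_inj: "mode j = mode k \<longleftrightarrow> j = k" for j k
    by (auto simp: mode_def par_def)
  have sgn: "mode_sign (mode j) (mode k) = (?q j k :: fock_op)" for j k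
    unfolding mode_sign_def odd_mode psg_def by (auto simp: par_def)
  \<comment> \<open>Below i0 creator and annihilator are exchanged, so that x_k kills the vacuum
    there. The factor -q_kk in y_k restores the relation between y_k and x_k.\<close>
  define x where "x = (\<lambda>k. if i0 < k then create (mode k) else annihilate (mode k))"
  define y where "y = (\<lambda>k. if i0 < k then annihilate (mode k) else - (?q k k * create (mode k)))"
  have oo: "osc p (mode j) * osc r (mode k) = ?q j k * (osc r (mode k) * osc p (mode j))" if "j \<noteq> k \<or> p = r" for p r j k
  proof (cases "j = k")
    case True
    then have "p = r" using that by simp
    then show ?thesis using True osc_self[of p "mode k"] by (simp only: sgn)
  next
    case False
    then have "mode j \<noteq> mode k" by (simp add: mode_inj)
    then show ?thesis using osc_supercommute[OF \<open>mode j \<noteq> mode k\<close>, of p r] unfolding sgn by simp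
  qed
  have ac: "annihilate (mode k) * create (mode k) = ?q k k * (create (mode k) * annihilate (mode k)) + 1" for k
    using annihilate_create[of "mode k"] by (simp only: sgn)
  have xx: "x j * x k = ?q j k * (x k * x j)" for j k
    unfolding x_def using oo[of j k] by (cases "j = k") auto
  have yy: "y j * y k = ?q j k * (y k * y j)" for j k
    unfolding y_def using oo[of j k]
    by (cases "j = k") (auto simp: psg_commute[of "osc _ _"] mult.assoc psg_psg_commute)
  have yx: "y j * x k = ?q j k * (x k * y j) + (if j = k then 1 else 0)" for j k
  proof (cases "j = k")
    case True
    show ?thesis unfolding x_def y_def True
      using ac[of k] by (auto simp: psg_commute[of "osc _ _"] mult.assoc)
  next
    case False
    then show ?thesis unfolding x_def y_def
      using oo[of j k] by (auto simp: psg_commute[of "osc _ _"] mult.assoc psg_psg_commute)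
  qed
  have xJ: "k < i0 \<Longrightarrow> x k \<in> vacuum_ann" and yJ: "i0 < k \<Longrightarrow> y k \<in> vacuum_ann" for k
    by (simp_all add: x_def y_def annihilate_vacuum)
  let ?E = "fock.dyson_E \<kappa> s i0 c x y"
  let ?e = "\<lambda>k. if k = i0 then c else if i0 < k then 0 else - of_int (s i0)"
  note dys = s i0 xx yy yx
  have comm: "gl_commutator \<kappa> s ?E"
    unfolding gl_commutator_def using fock.dyson_E_commutator[OF dys] by blast
  have square: "mat_mul \<kappa> ?E ?E k l = fock_scalar (c + rho \<kappa> s (i0 + 1)) * ?E k l" for k l
    by (rule fock.dyson_E_square[OF dys])
  have upper: "?E k l \<in> vacuum_ann" if "k \<in> {1..\<kappa>}" "l \<in> {1..\<kappa>}" "k < l" for k l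
    by (rule fock.dyson_E_J[OF dys xJ yJ that])
  have diag: "?E k k - fock_scalar (?e k) \<in> vacuum_ann" if "k \<in> {1..\<kappa>}" for k
    by (rule fock.dyson_E_diag_J[OF dys xJ yJ that])
  have s0: "s i0 = 1 \<or> s i0 = -1" using s i0 by blast
  have bE: "gl_supercommute \<kappa> s b (\<lambda>i j. fps_const (?E i j))"
    unfolding gl_supercommute_def
  proof (intro ballI fps_ext)
    fix i j k l r assume h: "i \<in> {1..\<kappa>}" "j \<in> {1..\<kappa>}" "k \<in> {1..\<kappa>}" "l \<in> {1..\<kappa>}"
    define z where "z = b i j $ r"
    \<comment> \<open>A coefficient of b_ij passes an odd mode with the sign (-1)^(|i|+|j|), here a
      product of two diagonal signs.\<close>
    define \<zeta> where "\<zeta> = (\<lambda>k. if odd (mode k) then psg s i i * psg s j j else (1 :: fock_op))"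
    have oz: "z * osc p (mode k) = \<zeta> k * (osc p (mode k) * z)" for p k
    proof -
      have "fps_const (osc p (mode k)) * b i j = mode_parity s (mode k) i * (mode_parity s (mode k) j * (b i j * fps_const (osc p (mode k))))"
        using graded[of "mode k" p] h unfolding graded_by_def by (auto simp: mode_def)
      from arg_cong[OF this, of "\<lambda>g. g $ r"] have "osc p (mode k) * z = \<zeta> k * (z * osc p (mode k))"
        unfolding mode_parity_def \<zeta>_def z_def by (auto simp: psg_nth mult.assoc)
      then show ?thesis
        unfolding \<zeta>_def by (auto simp: mult.assoc psg_psg_commute)
    qed
    have \<zeta>: "\<zeta> k = 1 \<or> \<zeta> k = -1" "\<zeta> i0 = 1" for k
      using psg_cases[of s i i, where 'a = fock_op] psg_cases[of s j j, where 'a = fock_op] s0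
      unfolding \<zeta>_def odd_mode by (auto simp: par_def fock.rel_sign_def)
    have comm_q: "\<zeta> k * (?q u u * w) = ?q u u * (\<zeta> k * w)" for k u w
      using \<zeta>(1)[of k] by auto
    have "z * ?E k l = \<zeta> k * (\<zeta> l * (?E k l * z))"
      by (rule fock.dyson_E_supercommute[where \<zeta> = \<zeta> and ?i0.0 = i0, OF _ _ \<zeta> h(3,4)])
        (simp_all add: x_def y_def oz psg_commute[of z] comm_q mult.assoc)
    moreover have "\<zeta> k * (\<zeta> l * w) = psg s k i * (psg s k j * (psg s l i * (psg s l j * w)))" for w
    proof -
      have "s i = 1 \<or> s i = -1" "s j = 1 \<or> s j = -1" "s k = 1 \<or> s k = -1" "s l = 1 \<or> s l = -1"
        using s h by blast+
      with s0 show ?thesis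
        unfolding \<zeta>_def odd_mode by (elim disjE) (simp_all add: psg_def par_def fock.rel_sign_def)
    qed
    ultimately have "z * ?E k l = psg s k i * (psg s k j * (psg s l i * (psg s l j * (?E k l * z))))" by simp
    then show "(psg s k i * (psg s k j * (b i j * fps_const (?E k l)))) $ r = (psg s l i * (psg s l j * (fps_const (?E k l) * b i j))) $ r"
      unfolding psg_nth by (simp add: z_def psg_psg_commute)
  qed
  have rep': "fock.hw_rep \<kappa> s \<epsilon> (dressed_weight \<kappa> s ?e a a' f \<mu>) (fock.dress \<kappa> ?E a a' f b)"
    by (rule fock.hw_dress[OF s rep comm square bE upper diag a f])
  \<comment> \<open>\<open>mode k\<close> is at most M + 2k + 1, so from M + 2\<kappa> + 2 on, again
    an even bound, no mode has been used.\<close>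
  have graded': "graded_by \<kappa> (mode_parity s t) (fps_const (osc p t)) (fock.dress \<kappa> ?E a a' f b)" if t: "t \<ge> M + 2 * \<kappa> + 2" for t p
  proof -
    have t': "t \<noteq> mode k" if "k \<in> {1..\<kappa>}" for k
      using t that by (auto simp: mode_def par_def)
    define \<zeta> where "\<zeta> = (\<lambda>k. mode_sign t (mode k) :: fock_op)"
    have \<zeta>: "\<zeta> k = 1 \<or> \<zeta> k = -1" "\<zeta> i0 = 1" for k
      using s0 unfolding \<zeta>_def mode_sign_def odd_mode by (auto simp: par_def fock.rel_sign_def)
    have comm_q: "\<zeta> k * (?q u u * w) = ?q u u * (\<zeta> k * w)" for k u w
      using \<zeta>(1)[of k] by auto
    have oz: "osc p t * osc r (mode k) = \<zeta> k * (osc r (mode k) * osc p t)" if "k \<in> {1..\<kappa>} - {i0}" for k r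
      unfolding \<zeta>_def using t' that by (intro osc_supercommute) auto
    have E: "graded_by \<kappa> (mode_parity s t) (fps_const (osc p t)) (\<lambda>i j. fps_const (?E i j))"
      unfolding graded_by_def
    proof (intro ballI)
      fix k l assume h: "k \<in> {1..\<kappa>}" "l \<in> {1..\<kappa>}"
      have "osc p t * ?E k l = \<zeta> k * (\<zeta> l * (?E k l * osc p t))"
        by (rule fock.dyson_E_supercommute[where \<zeta> = \<zeta> and ?i0.0 = i0, OF _ _ \<zeta> h])
          (simp_all add: x_def y_def oz psg_commute[of "osc p t"] comm_q mult.assoc)
      moreover have "\<zeta> k * (\<zeta> l * w) = mode_parity s t k * (mode_parity s t l * w)" for w
      proof -
        have "s k = 1 \<or> s k = -1" "s l = 1 \<or> s l = -1" using s h by blast+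
        with s0 show ?thesis
          unfolding \<zeta>_def mode_sign_def odd_mode mode_parity_def
          by (elim disjE) (simp_all add: psg_def par_def fock.rel_sign_def)
      qed
      ultimately have "osc p t * ?E k l = mode_parity s t k * (mode_parity s t l * (?E k l * osc p t))" by simp
      from arg_cong[OF this, of fps_const]
      show "fps_const (osc p t) * fps_const (?E k l) = mode_parity s t k * (mode_parity s t l * (fps_const (?E k l) * fps_const (osc p t)))"
        unfolding mode_parity_def by (auto simp: fps_const_psg)
    qed
    have cA: "central (fps_const (fock_scalar d))" for d by (intro central_fps_const fock.sc_central)
    have "graded_by \<kappa> (mode_parity s t) (fps_const (osc p t)) (mat_mul \<kappa> (lop (\<lambda>i j. fps_const (?E i j)) fps_X (fps_const (fock_scalar a)))
     (mat_mul \<kappa> b (lop (\<lambda>i j. fps_const (?E i j)) fps_X (fps_const (fock_scalar a')))))"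
      using t by (intro graded_mat_mul mode_parity_cases graded_lop E central_fps_X cA graded) auto
    then show ?thesis
      unfolding graded_by_def fock.dress_def
      by (simp add: centralD(2)[OF fock.central_scs] mult.assoc)
  qed
  show ?thesis unfolding realizable_def
    using rep' graded' M by (intro exI[of _ "fock.dress \<kappa> ?E a a' f b"] exI[of _ "M + 2 * \<kappa> + 2"]) auto
qed

text \<open>With \<open>a = - \<rho> / 2\<close> the ratio of two consecutive \<open>\<mu>\<close>-tilde series is multiplied by
  \<open>(z + c) / (z - c)\<close> where \<open>z = u - \<rho> / 2\<close>.\<close>

lemma realizable_step:
  assumes s: "\<forall>i\<in>{1..\<kappa>}. s i = 1 \<or> s i = -1" and real: "realizable \<kappa> s \<epsilon> \<mu>" and i0: "i0 \<in> {1..\<kappa>}"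
    and \<rho>: "\<rho> = rho \<kappa> s (i0 + 1)"
  obtains \<mu>' where "realizable \<kappa> s \<epsilon> \<mu>'" "\<And>k. k \<in> {1..\<kappa>} \<Longrightarrow> i0 < k \<Longrightarrow> \<mu>' k = \<mu> k"
    "(1 - fps_const (c + \<rho> / 2) * fps_X) * Qser \<kappa> s \<mu>' i0 = (1 + fps_const (c - \<rho> / 2) * fps_X) * Qser \<kappa> s \<mu> i0"
proof -
  \<comment> \<open>E^2 = (c + \<rho>) E fixes the sum a + a'. With a = -\<rho>/2 the coefficient 2
    - \<rho> X is twice 1 + a X, one of the two factors inverted by f, and this common factor
    cancels at the end.\<close>
  define a where "a = - \<rho> / 2"
  define a' where "a' = - c - \<rho> / 2"
  define A where "A = fps_const a"
  define A' where "A' = fps_const a'"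
  define C where "C = fps_const c"
  define f where "f = inverse ((1 + A * fps_X) * (1 + A' * fps_X))"
  define e where "e = (\<lambda>k. if k = i0 then c else if i0 < k then 0 else - of_int (s i0))"
  have f: "f * ((1 + A * fps_X) * (1 + A' * fps_X)) = 1"
    unfolding f_def by (rule inverse_mult_eq_1) simp
  have zero: "a + a' + (c + rho \<kappa> s (i0 + 1)) = 0" by (simp add: a_def a'_def \<rho>)
  define \<mu>' where "\<mu>' = dressed_weight \<kappa> s e a a' f \<mu>"
  have real': "realizable \<kappa> s \<epsilon> \<mu>'"
    unfolding \<mu>'_def e_def by (rule realizable_dress[OF s real i0 zero f[unfolded A_def A'_def]])
  \<comment> \<open>Above i0 all eigenvalues of E vanish, so the dressing only multiplies by (1 + a
    X)(1 + a' X), which f undoes.\<close>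
  have gt: "\<mu>' k = \<mu> k" if "k \<in> {1..\<kappa>}" "i0 < k" for k
  proof -
    have "\<mu>' k = f * ((1 + A * fps_X) * (1 + A' * fps_X)) * \<mu> k"
      unfolding \<mu>'_def dressed_weight_def Let_def A_def A'_def using that by (simp add: e_def mult_ac)
    then show ?thesis by (simp add: f)
  qed
  define S where "S = (\<Sum>u\<in>{i0+1..\<kappa>}. fps_const (of_int (s u)) * \<mu> u)"
  have Q: "Qser \<kappa> s \<mu> i0 = (2 - fps_const \<rho> * fps_X) * \<mu> i0 + fps_X * S"
    unfolding Qser_def S_def \<rho> ..
  have "(\<Sum>u\<in>{i0+1..\<kappa>}. fps_const (of_int (s u)) * \<mu>' u) = S"
    unfolding S_def using gt i0 by (intro sum.cong) auto
  then have Q': "Qser \<kappa> s \<mu>' i0 = (2 - fps_const \<rho> * fps_X) * \<mu>' i0 + fps_X * S"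
    unfolding Qser_def \<rho> by simp
  have "(\<Sum>u\<in>{i0+1..\<kappa>}. fps_const (of_int (s u)) * (\<mu> u * fps_const (e i0) - \<mu> u * fps_const (e u))) = S * C"
    unfolding S_def sum_distrib_right by (intro sum.cong) (auto simp: e_def C_def)
  then have m: "\<mu>' i0 = f * ((1 + A' * fps_X) * ((1 + A * fps_X) * \<mu> i0 + fps_X * (\<mu> i0 * C)) + fps_X * ((1 + A * fps_X) * (\<mu> i0 * C)
       + fps_X * (C * (\<mu> i0 * C) + S * C)))"
    unfolding \<mu>'_def dressed_weight_def Let_def A_def A'_def by (simp add: e_def C_def)
  have rA: "fps_const \<rho> = - (2 * A)"
    unfolding A_def a_def numeral_fps_const by simp
  have CA: "C = A - A'" unfolding C_def A_def A'_def a_def a'_def by simp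
  define P where "P = (1 + A * fps_X) * (1 + A' * fps_X)"
  have P: "P * \<mu>' i0 = (1 + A' * fps_X) * ((1 + A * fps_X) * \<mu> i0 + fps_X * (\<mu> i0 * C)) + fps_X * ((1 + A * fps_X) * (\<mu> i0 * C)
       + fps_X * (C * (\<mu> i0 * C) + S * C))" (is "_ = ?R")
  proof -
    have "P * \<mu>' i0 = (f * P) * ?R" unfolding m by (simp only: mult_ac)
    then show ?thesis using f unfolding P_def by simp
  qed
  have A'2: "fps_const (c + \<rho> / 2) = - A'" and AC: "fps_const (c - \<rho> / 2) = A + C"
    unfolding A_def A'_def C_def a_def a'_def by simp_all
  have "(1 + A * fps_X) * ((1 + A' * fps_X) * Qser \<kappa> s \<mu>' i0) = (2 - fps_const \<rho> * fps_X) * (P * \<mu>' i0) + P * (fps_X * S)"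
    unfolding Q' P_def by (simp add: algebra_simps)
  also have "\<dots> = (1 + A * fps_X) * ((1 + (A + C) * fps_X) * Qser \<kappa> s \<mu> i0)"
    unfolding P Q rA CA unfolding P_def by (simp add: algebra_simps)
  finally have eq: "(1 + A * fps_X) * ((1 + A' * fps_X) * Qser \<kappa> s \<mu>' i0) = (1 + A * fps_X) * ((1 + (A + C) * fps_X) * Qser \<kappa> s \<mu> i0)" .
  have nz: "1 + A * fps_X \<noteq> 0"
  proof
    assume "1 + A * fps_X = 0"
    then have "(1 + A * fps_X) $ 0 = 0" by simp
    then show False by simp
  qed
  have "(1 - fps_const (c + \<rho> / 2) * fps_X) * Qser \<kappa> s \<mu>' i0 = (1 + fps_const (c - \<rho> / 2) * fps_X) * Qser \<kappa> s \<mu> i0"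
    using eq nz unfolding A'2 AC by simp
  with real' gt show thesis by (rule that)
qed

lemma realizable_nontrivial:
  assumes "\<forall>i\<in>{1..\<kappa>}. s i = 1 \<or> s i = -1" "realizable \<kappa> s \<epsilon> \<mu>"
  shows "verma_nontrivial \<kappa> s \<epsilon> \<mu>" "i \<in> {1..\<kappa>} \<Longrightarrow> \<mu> i $ 0 = of_int (\<epsilon> i)"
  using assms(2) fock.hw_rep_nontrivial[OF assms(1)] fock.hw_rep_weight_0 unfolding realizable_def by blast+

subsection \<open>Approximating the remaining weights\<close>

definition fps_eq_upto :: "nat \<Rightarrow> 'a::zero fps \<Rightarrow> 'a fps \<Rightarrow> bool" where
  "fps_eq_upto N f g \<longleftrightarrow> (\<forall>r\<le>N. f $ r = g $ r)"

lemma fps_eq_upto_same [simp]: "fps_eq_upto N f f"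
  by (simp add: fps_eq_upto_def)

lemma fps_eq_upto_sym: "fps_eq_upto N f g \<Longrightarrow> fps_eq_upto N g f"
  by (simp add: fps_eq_upto_def)

lemma fps_eq_upto_trans [trans]: "fps_eq_upto N f g \<Longrightarrow> fps_eq_upto N g h \<Longrightarrow> fps_eq_upto N f h"
  by (simp add: fps_eq_upto_def)

lemma fps_eq_upto_add: "fps_eq_upto N f g \<Longrightarrow> fps_eq_upto N f' g' \<Longrightarrow> fps_eq_upto N (f + f') (g + g')"
  by (simp add: fps_eq_upto_def)

lemma fps_eq_upto_diff:
  "fps_eq_upto N f g \<Longrightarrow> fps_eq_upto N f' g' \<Longrightarrow> fps_eq_upto N (f - f') (g - (g' :: 'a::group_add fps))"
  by (simp add: fps_eq_upto_def)

lemma fps_eq_upto_mult: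
  "fps_eq_upto N f g \<Longrightarrow> fps_eq_upto N f' g' \<Longrightarrow> fps_eq_upto N (f * f') (g * (g' :: 'a::comm_ring_1 fps))"
  unfolding fps_eq_upto_def fps_mult_nth by (auto intro!: sum.cong)

lemma fps_eq_upto_sum: "(\<And>a. a \<in> A \<Longrightarrow> fps_eq_upto N (f a) (g a)) \<Longrightarrow> fps_eq_upto N (sum f A) (sum g A)"
  unfolding fps_eq_upto_def fps_sum_nth by (auto intro!: sum.cong)

lemma fps_eq_upto_compose:
  "fps_eq_upto N f g \<Longrightarrow> fps_eq_upto N (f oo h) (g oo (h :: 'a::comm_ring_1 fps))"
  unfolding fps_eq_upto_def fps_compose_nth by (auto intro!: sum.cong)

lemma fps_eq_upto_cancel:
  fixes f g h :: "'a::field fps"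
  assumes "fps_eq_upto N (f * h) (g * h)" "h $ 0 \<noteq> 0"
  shows "fps_eq_upto N f g"
proof -
  have "x * h * inverse h = x" for x
    unfolding mult.assoc inverse_mult_eq_1'[OF assms(2)] by simp
  then show ?thesis
    using fps_eq_upto_mult[OF assms(1) fps_eq_upto_same[of N "inverse h"]] by (simp only:)
qed

text \<open>The constant term 1 excludes the root 0, so every linear factor can be normalised to 1 +
  c X.\<close>

lemma poly_linear_factors:
  fixes p :: "complex poly"
  assumes "poly p 0 = 1"
  shows "\<exists>cs. p = prod_list (map (\<lambda>c. [:1, c:]) cs)"
  using assms
proof (induction "degree p" arbitrary: p rule: less_induct)
  case less
  show ?case
  proof (cases "degree p = 0")
    case True
    then obtain a where "p = [:a:]" by (auto elim: degree_eq_zeroE)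
    with less.prems show ?thesis by (intro exI[of _ "[]"]) (simp add: one_pCons)
  next
    case False
    then have "\<not> constant (poly p)" by (simp add: constant_degree)
    then obtain z where z: "poly p z = 0" using fundamental_theorem_of_algebra by blast
    then have z0: "z \<noteq> 0" using less.prems by auto
    from z obtain r where r: "p = [:-z, 1:] * r" by (auto simp: poly_eq_0_iff_dvd elim: dvdE)
    define r' where "r' = smult (-z) r"
    have "[:-z, 1:] = smult (-z) [:1, -1/z:]" using z0 by simp
    then have p: "p = [:1, -1/z:] * r'" unfolding r r'_def by (simp only: mult_smult_left mult_smult_right)
    have "poly r' 0 = 1" using less.prems unfolding p by simp
    moreover have "degree r' < degree p"
    proof -
      have "r' \<noteq> 0" using \<open>poly r' 0 = 1\<close> by auto
      then have "degree p = degree [:1, -1/z:] + degree r'" unfolding p by (intro degree_mult_eq) auto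
      then show ?thesis using z0 by simp
    qed
    ultimately obtain cs where "r' = prod_list (map (\<lambda>c. [:1, c:]) cs)" using less.hyps by blast
    then show ?thesis using p by (intro exI[of _ "-1/z # cs"]) simp
  qed
qed

lemma fps_linear_factors_compose:
  fixes h k :: "'a::idom fps"
  assumes "k $ 0 = 0"
  shows "prod_list (map (\<lambda>c. 1 + fps_const c * h) cs) oo k = prod_list (map (\<lambda>c. 1 + fps_const c * (h oo k)) cs)"
  by (induction cs) (simp_all add: fps_compose_mult_distrib[OF assms] fps_compose_add_distrib)

lemma fps_linear_factors_approx:
  fixes q :: "complex fps"
  assumes "q $ 0 = 1"
  shows "\<exists>cs. fps_eq_upto N q (prod_list (map (\<lambda>c. 1 + fps_const c * fps_X) cs))"
proof -
  define p where "p = (\<Sum>r\<le>N. monom (q $ r) r)"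
  have c: "coeff p r = q $ r" if "r \<le> N" for r
    using that by (simp add: p_def coeff_sum)
  have "poly p 0 = 1" using c[of 0] assms by (simp add: poly_0_coeff_0)
  then obtain cs where p: "p = prod_list (map (\<lambda>c. [:1, c:]) cs)" using poly_linear_factors by blast
  have "fps_of_poly (prod_list (map (\<lambda>c. [:1, c:]) cs)) = prod_list (map (\<lambda>c. 1 + fps_const c * fps_X) cs)"
    by (induction cs) (simp_all only: list.map prod_list.Nil prod_list.Cons fps_of_poly_mult fps_of_poly_pCons
      fps_of_poly_0 fps_of_poly_1 fps_const_1_eq_1 mult_zero_left add_0_right)
  then show ?thesis
    using c p unfolding fps_eq_upto_def by (intro exI[of _ cs]) (metis fps_of_poly_nth)
qed

text \<open>In terms of \<open>X = 1 / u\<close> this is \<open>1 / (u - \<rho> / 2)\<close>, which the reflection \<open>u \<mapsto> \<rho> - u\<close> negates.\<close>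

definition centred_inv :: "complex \<Rightarrow> complex fps" where
  "centred_inv \<rho> = fps_X * inverse (1 - fps_const (\<rho> / 2) * fps_X)"

lemma centred_inv_eq: "(1 - fps_const (\<rho> / 2) * fps_X) * centred_inv \<rho> = fps_X"
proof -
  have "(1 - fps_const (\<rho> / 2) * fps_X) * inverse (1 - fps_const (\<rho> / 2) * fps_X) = 1"
    by (rule inverse_mult_eq_1') simp
  then show ?thesis unfolding centred_inv_def by (simp add: mult.left_commute)
qed

lemma centred_inv_0 [simp]: "centred_inv \<rho> $ 0 = 0"
  by (simp add: centred_inv_def)

lemma fps_one_plus_nz: "h $ 0 = 0 \<Longrightarrow> 1 + h \<noteq> (0 :: 'a::ring_1 fps)"
  by (metis add.right_neutral fps_add_nth fps_one_nth fps_zero_nth zero_neq_one)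

lemma centred_inv_shift_neg: "centred_inv \<rho> oo shift_neg \<rho> = - centred_inv \<rho>"
proof -
  define A where "A = fps_const (\<rho> / 2)"
  have A2: "fps_const \<rho> = 2 * A" unfolding A_def numeral_fps_const by simp
  have z: "(1 - A * fps_X) * centred_inv \<rho> = fps_X" unfolding A_def by (rule centred_inv_eq)
  have sn: "(1 - 2 * A * fps_X) * shift_neg \<rho> = - fps_X" using shift_neg_eq[of \<rho>] unfolding A2 .
  have "(1 - A * fps_X) * centred_inv \<rho> oo shift_neg \<rho> = shift_neg \<rho>" unfolding z by simp
  then have comp: "(1 - A * shift_neg \<rho>) * (centred_inv \<rho> oo shift_neg \<rho>) = shift_neg \<rho>"
    by (simp add: fps_compose_mult_distrib fps_compose_sub_distrib A_def)
  have "(1 - 2 * A * fps_X) * ((1 - A * shift_neg \<rho>) * - centred_inv \<rho>)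
      = - ((1 - 2 * A * fps_X) - A * ((1 - 2 * A * fps_X) * shift_neg \<rho>)) * centred_inv \<rho>"
    by (simp add: algebra_simps)
  also have "\<dots> = - ((1 - A * fps_X) * centred_inv \<rho>)" unfolding sn by (simp add: algebra_simps)
  also have "\<dots> = (1 - 2 * A * fps_X) * shift_neg \<rho>" unfolding z sn ..
  finally have "(1 - 2 * A * fps_X) * ((1 - A * shift_neg \<rho>) * - centred_inv \<rho>) = (1 - 2 * A * fps_X) * shift_neg \<rho>" .
  moreover have "1 - 2 * A * fps_X \<noteq> 0" using fps_one_plus_nz[of "- (2 * A * fps_X)"] by simp
  ultimately have "(1 - A * shift_neg \<rho>) * - centred_inv \<rho> = shift_neg \<rho>" by (metis mult_left_cancel)
  moreover have "1 - A * shift_neg \<rho> \<noteq> 0" using fps_one_plus_nz[of "- (A * shift_neg \<rho>)"] by simp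
  ultimately show ?thesis using comp by (metis mult_left_cancel)
qed

text \<open>\<open>centred_inv (- \<rho>)\<close> is the compositional inverse of
  \<open>centred_inv \<rho>\<close>. Thus q is rewritten as a series in the centred variable,
  truncated and factored there, and substituted back; composition respects agreement up to order
  N.\<close>

lemma centred_factors_approx:
  fixes q :: "complex fps"
  assumes "q $ 0 = 1"
  shows "\<exists>cs. fps_eq_upto N q (prod_list (map (\<lambda>c. 1 + fps_const c * centred_inv \<rho>) cs))"
proof -
  let ?z = "centred_inv \<rho>" and ?x = "centred_inv (- \<rho>)"
  define A where "A = fps_const (\<rho> / 2)"
  have z: "(1 - A * fps_X) * ?z = fps_X" unfolding A_def by (rule centred_inv_eq)
  have "(1 + A * fps_X) * ?x = fps_X" using centred_inv_eq[of "- \<rho>"] unfolding A_def by (simp flip: fps_const_neg)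
  then have "(1 + A * fps_X) * ?x oo ?z = ?z" by simp
  then have "(1 + A * ?z) * (?x oo ?z) = ?z"
    by (simp add: fps_compose_mult_distrib fps_compose_add_distrib A_def)
  also have "?z = (1 + A * ?z) * fps_X" using z by (simp add: algebra_simps)
  finally have "(1 + A * ?z) * (?x oo ?z) = (1 + A * ?z) * fps_X" .
  moreover have "1 + A * ?z \<noteq> 0" by (rule fps_one_plus_nz) simp
  ultimately have xz: "?x oo ?z = fps_X" by (metis mult_left_cancel)
  have q: "q = (q oo ?x) oo ?z"
    using fps_compose_assoc[of ?z ?x q] xz by simp
  obtain cs where "fps_eq_upto N (q oo ?x) (prod_list (map (\<lambda>c. 1 + fps_const c * fps_X) cs))"
    using fps_linear_factors_approx[of "q oo ?x"] assms by auto
  then have "fps_eq_upto N ((q oo ?x) oo ?z) (prod_list (map (\<lambda>c. 1 + fps_const c * fps_X) cs) oo ?z)"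
    by (rule fps_eq_upto_compose)
  then show ?thesis unfolding q[symmetric] by (auto simp: fps_linear_factors_compose)
qed

text \<open>One dressing at i0 per linear factor: a step with parameter c multiplies by (1 + c/z)/(1
  - c/z), where \<open>centred_inv \<rho>\<close> is 1/z. The result is kept as an identity of
  products, so that no quotient has to be formed.\<close>

lemma realizable_steps:
  assumes s: "\<forall>i\<in>{1..\<kappa>}. s i = 1 \<or> s i = -1" and real: "realizable \<kappa> s \<epsilon> \<mu>" and i0: "i0 \<in> {1..\<kappa>}"
    and \<rho>: "\<rho> = rho \<kappa> s (i0 + 1)"
  shows "\<exists>\<mu>'. realizable \<kappa> s \<epsilon> \<mu>' \<and> (\<forall>k\<in>{1..\<kappa>}. i0 < k \<longrightarrow> \<mu>' k = \<mu> k) \<and>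
    Qser \<kappa> s \<mu>' i0 * prod_list (map (\<lambda>c. 1 - fps_const c * centred_inv \<rho>) cs)
      = Qser \<kappa> s \<mu> i0 * prod_list (map (\<lambda>c. 1 + fps_const c * centred_inv \<rho>) cs)"
proof (induction cs)
  case Nil
  show ?case using real by (intro exI[of _ \<mu>]) simp
next
  case (Cons c cs)
  let ?z = "centred_inv \<rho>"
  define Pm where "Pm = prod_list (map (\<lambda>c. 1 - fps_const c * ?z) cs)"
  define Pp where "Pp = prod_list (map (\<lambda>c. 1 + fps_const c * ?z) cs)"
  obtain \<mu>1 where 1: "realizable \<kappa> s \<epsilon> \<mu>1" "\<forall>k\<in>{1..\<kappa>}. i0 < k \<longrightarrow> \<mu>1 k = \<mu> k"
    "Qser \<kappa> s \<mu>1 i0 * Pm = Qser \<kappa> s \<mu> i0 * Pp"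
    using Cons.IH unfolding Pm_def Pp_def by blast
  obtain \<mu>2 where 2: "realizable \<kappa> s \<epsilon> \<mu>2" "\<And>k. k \<in> {1..\<kappa>} \<Longrightarrow> i0 < k \<Longrightarrow> \<mu>2 k = \<mu>1 k"
    "(1 - fps_const (c + \<rho> / 2) * fps_X) * Qser \<kappa> s \<mu>2 i0 = (1 + fps_const (c - \<rho> / 2) * fps_X) * Qser \<kappa> s \<mu>1 i0"
    using realizable_step[OF s 1(1) i0 \<rho>, of c] by blast
  define A where "A = fps_const (\<rho> / 2)"
  define C where "C = fps_const c"
  have z: "(1 - A * fps_X) * ?z = fps_X" unfolding A_def by (rule centred_inv_eq)
  \<comment> \<open>1 - A X is z/u; multiplying by it turns 1 + D/z into a linear polynomial in X,
    the form used in \<open>realizable_step\<close>.\<close>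
  have lin: "(1 - A * fps_X) * (1 + D * ?z) = 1 - A * fps_X + D * fps_X" for D
    by (simp add: distrib_left mult.left_commute[of _ D] z)
  have "(1 - A * fps_X) * (Qser \<kappa> s \<mu>2 i0 * (1 - C * ?z)) = (1 - (C + A) * fps_X) * Qser \<kappa> s \<mu>2 i0"
    using lin[of "- C"] by (simp add: mult.left_commute[of _ "Qser \<kappa> s \<mu>2 i0"] mult.commute[of _ "Qser \<kappa> s \<mu>2 i0"] distrib_right)
  also have "\<dots> = (1 + (C - A) * fps_X) * Qser \<kappa> s \<mu>1 i0"
    using 2(3) unfolding A_def C_def by simp
  also have "\<dots> = (1 - A * fps_X) * (Qser \<kappa> s \<mu>1 i0 * (1 + C * ?z))"
    using lin[of C] by (simp add: mult.left_commute[of _ "Qser \<kappa> s \<mu>1 i0"] mult.commute[of _ "Qser \<kappa> s \<mu>1 i0"] left_diff_distrib)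
  finally have eq: "(1 - A * fps_X) * (Qser \<kappa> s \<mu>2 i0 * (1 - C * ?z)) = (1 - A * fps_X) * (Qser \<kappa> s \<mu>1 i0 * (1 + C * ?z))" .
  have "1 - A * fps_X \<noteq> 0" using fps_one_plus_nz[of "- (A * fps_X)"] by simp
  with eq have step: "Qser \<kappa> s \<mu>2 i0 * (1 - C * ?z) = Qser \<kappa> s \<mu>1 i0 * (1 + C * ?z)" by (metis mult_left_cancel)
  have "Qser \<kappa> s \<mu>2 i0 * ((1 - C * ?z) * Pm) = Qser \<kappa> s \<mu>1 i0 * Pm * (1 + C * ?z)"
    using arg_cong[OF step, of "\<lambda>q. q * Pm"] by (simp only: mult_ac)
  also have "\<dots> = Qser \<kappa> s \<mu> i0 * ((1 + C * ?z) * Pp)" unfolding 1(3) by (simp only: mult_ac)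
  finally show ?case
    using 1(2) 2(1,2) unfolding Pm_def Pp_def C_def by (intro exI[of _ \<mu>2]) simp
qed

lemma Qser_eq_upto:
  assumes "\<And>k. k \<in> {i..\<kappa>} \<Longrightarrow> fps_eq_upto N (\<mu> k) (\<tau> k)" "i \<le> \<kappa>"
  shows "fps_eq_upto N (Qser \<kappa> s \<mu> i) (Qser \<kappa> s \<tau> i)"
  unfolding Qser_def using assms by (intro fps_eq_upto_add fps_eq_upto_mult fps_eq_upto_sum fps_eq_upto_same) auto

lemma realizable_match:
  assumes s: "\<forall>i\<in>{1..\<kappa>}. s i = 1 \<or> s i = -1" and eps: "\<forall>i\<in>{1..\<kappa>}. \<epsilon> i = 1 \<or> \<epsilon> i = (-1 :: int)"
    and \<tau>0: "\<forall>i\<in>{1..\<kappa>}. \<tau> i $ 0 = of_int (\<epsilon> i)"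
    and real: "realizable \<kappa> s \<epsilon> \<mu>" and i0: "1 \<le> i0" "i0 < \<kappa>"
    and agree: "\<And>k. k \<in> {1..\<kappa>} \<Longrightarrow> i0 < k \<Longrightarrow> fps_eq_upto N (\<mu> k) (\<tau> k)"
    and cond: "Qser \<kappa> s \<tau> i0 * (Qser \<kappa> s \<tau> i0 oo shift_neg (rho \<kappa> s (i0+1)))
      = Qser \<kappa> s \<tau> (i0+1) * (Qser \<kappa> s \<tau> (i0+1) oo shift_neg (rho \<kappa> s (i0+1)))"
  shows "\<exists>\<mu>'. realizable \<kappa> s \<epsilon> \<mu>' \<and> (\<forall>k\<in>{1..\<kappa>}. i0 \<le> k \<longrightarrow> fps_eq_upto N (\<mu>' k) (\<tau> k))"
proof -
  define \<rho> where "\<rho> = rho \<kappa> s (i0 + 1)"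
  let ?\<sigma> = "shift_neg \<rho>" and ?Qc = "Qser \<kappa> s \<mu> i0" and ?Qt = "Qser \<kappa> s \<tau> i0"
  have i0': "i0 \<in> {1..\<kappa>}" using i0 by simp
  have \<mu>0: "\<forall>i\<in>{1..\<kappa>}. \<mu> i $ 0 = of_int (\<epsilon> i)" using realizable_nontrivial(2)[OF s real] by blast
  have \<sigma>_mult: "(f * g) oo ?\<sigma> = (f oo ?\<sigma>) * (g oo ?\<sigma>)" for f g :: "complex fps"
    by (rule fps_compose_mult_distrib) simp
  \<comment> \<open>The realised weight belongs to a nontrivial Verma module, so necessity supplies
    its condition. Compared with the condition on the target, it yields the reflection property of g
    up to order N.\<close>
  have nec: "?Qc * (?Qc oo ?\<sigma>) = Qser \<kappa> s \<mu> (i0+1) * (Qser \<kappa> s \<mu> (i0+1) oo ?\<sigma>)"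
    unfolding \<rho>_def by (rule necessity(2)[OF s \<mu>0 realizable_nontrivial(1)[OF s real] _ i0]) (use i0 in simp)
  have "fps_eq_upto N (Qser \<kappa> s \<mu> (i0+1)) (Qser \<kappa> s \<tau> (i0+1))"
    using i0 by (intro Qser_eq_upto agree) auto
  then have cc: "fps_eq_upto N (?Qc * (?Qc oo ?\<sigma>)) (?Qt * (?Qt oo ?\<sigma>))"
    unfolding nec cond[folded \<rho>_def] by (intro fps_eq_upto_mult fps_eq_upto_compose)
  have e: "of_int (\<epsilon> i0) \<noteq> (0 :: complex)" using bspec[OF eps i0'] by auto
  have Q0: "?Qc $ 0 = 2 * of_int (\<epsilon> i0)" "?Qt $ 0 = 2 * of_int (\<epsilon> i0)"
    using \<mu>0 \<tau>0 i0' by (simp_all add: Qser_def)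
  define G where "G = inverse ?Qc"
  have G: "?Qc * G = 1" unfolding G_def using Q0 e by (intro inverse_mult_eq_1') simp
  have G\<sigma>: "(?Qc oo ?\<sigma>) * (G oo ?\<sigma>) = 1" unfolding \<sigma>_mult[symmetric] G by simp
  \<comment> \<open>The factor by which the series at i0 still has to be multiplied. Both series
    have constant term twice the sign at i0, hence g starts with 1.\<close>
  define g where "g = ?Qt * G"
  have "(?Qc * G) $ 0 = 1" unfolding G by simp
  then have g0: "g $ 0 = 1" unfolding g_def using Q0 by simp
  have gg: "fps_eq_upto N (g * (g oo ?\<sigma>)) 1"
  proof -
    have "g * (g oo ?\<sigma>) = (?Qt * (?Qt oo ?\<sigma>)) * (G * (G oo ?\<sigma>))" unfolding g_def \<sigma>_mult by (simp only: mult_ac)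
    moreover have "(?Qc * (?Qc oo ?\<sigma>)) * (G * (G oo ?\<sigma>)) = (?Qc * G) * ((?Qc oo ?\<sigma>) * (G oo ?\<sigma>))" by (simp only: mult_ac)
    ultimately show ?thesis
      using fps_eq_upto_mult[OF fps_eq_upto_sym[OF cc] fps_eq_upto_same[of N "G * (G oo ?\<sigma>)"]] G G\<sigma> by simp
  qed
  define h :: "complex fps" where "h = fps_const (1/2)"
  define q where "q = h * (1 + g)"
  have q0: "q $ 0 = 1" unfolding q_def h_def using g0 by simp
  have gq: "fps_eq_upto N (g * (q oo ?\<sigma>)) q"
  proof -
    have "q oo ?\<sigma> = h * (1 + (g oo ?\<sigma>))"
      unfolding q_def \<sigma>_mult by (simp add: h_def fps_compose_add_distrib)
    then have "g * (q oo ?\<sigma>) = h * (g * (g oo ?\<sigma>) + g)" by (simp add: algebra_simps)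
    moreover have "fps_eq_upto N (h * (g * (g oo ?\<sigma>) + g)) (h * (1 + g))"
      by (intro fps_eq_upto_mult fps_eq_upto_add fps_eq_upto_same gg)
    ultimately show ?thesis unfolding q_def by simp
  qed
  obtain cs where q: "fps_eq_upto N q (prod_list (map (\<lambda>c. 1 + fps_const c * centred_inv \<rho>) cs))" (is "fps_eq_upto N q ?Pp")
    using centred_factors_approx[OF q0] by blast
  have "fps_eq_upto N (q oo ?\<sigma>) (?Pp oo ?\<sigma>)" by (rule fps_eq_upto_compose[OF q])
  then have q\<sigma>: "fps_eq_upto N (q oo ?\<sigma>) (prod_list (map (\<lambda>c. 1 - fps_const c * centred_inv \<rho>) cs))" (is "fps_eq_upto N _ ?Pm")
    by (simp add: fps_linear_factors_compose centred_inv_shift_neg)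
  obtain \<mu>' where real': "realizable \<kappa> s \<epsilon> \<mu>'" and gt: "\<forall>k\<in>{1..\<kappa>}. i0 < k \<longrightarrow> \<mu>' k = \<mu> k"
    and Q': "Qser \<kappa> s \<mu>' i0 * ?Pm = ?Qc * ?Pp"
    using realizable_steps[OF s real i0' \<rho>_def, of cs] by blast
  \<comment> \<open>Instead of dividing, the chain carries along q(\<rho> - u), which has constant
    term 1 and is cancelled at its end.\<close>
  have "fps_eq_upto N (Qser \<kappa> s \<mu>' i0 * (q oo ?\<sigma>)) (Qser \<kappa> s \<mu>' i0 * ?Pm)"
    by (intro fps_eq_upto_mult fps_eq_upto_same q\<sigma>)
  also have "fps_eq_upto N \<dots> (?Qc * q)" unfolding Q' by (intro fps_eq_upto_mult fps_eq_upto_same fps_eq_upto_sym[OF q])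
  also have "fps_eq_upto N \<dots> (?Qc * (g * (q oo ?\<sigma>)))" by (intro fps_eq_upto_mult fps_eq_upto_same fps_eq_upto_sym[OF gq])
  also have "?Qc * (g * (q oo ?\<sigma>)) = (?Qc * G) * (?Qt * (q oo ?\<sigma>))" unfolding g_def by (simp only: mult_ac)
  finally have "fps_eq_upto N (Qser \<kappa> s \<mu>' i0 * (q oo ?\<sigma>)) (?Qt * (q oo ?\<sigma>))" unfolding G by simp
  then have QQ: "fps_eq_upto N (Qser \<kappa> s \<mu>' i0) ?Qt" by (rule fps_eq_upto_cancel) (simp add: q0)
  have agree': "fps_eq_upto N (\<mu>' k) (\<tau> k)" if "k \<in> {1..\<kappa>}" "i0 < k" for k
    using agree[OF that] gt that by simp
  \<comment> \<open>To return from the tilde series to the weight at i0, the terms with larger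
    indices, which already agree, are subtracted, and the invertible factor 2 - \<rho> X is
    cancelled.\<close>
  have "fps_eq_upto N (fps_X * (\<Sum>a\<in>{i0+1..\<kappa>}. fps_const (of_int (s a)) * \<mu>' a)) (fps_X * (\<Sum>a\<in>{i0+1..\<kappa>}. fps_const (of_int (s a)) * \<tau> a))"
    using i0 by (intro fps_eq_upto_mult fps_eq_upto_sum fps_eq_upto_same agree') auto
  from fps_eq_upto_diff[OF QQ this]
  have "fps_eq_upto N (\<mu>' i0 * (2 - fps_const \<rho> * fps_X)) (\<tau> i0 * (2 - fps_const \<rho> * fps_X))"
    unfolding Qser_def \<rho>_def by (simp add: mult.commute)
  then have "fps_eq_upto N (\<mu>' i0) (\<tau> i0)" by (rule fps_eq_upto_cancel) simp
  then show ?thesis using real' agree' by (intro exI[of _ \<mu>']) (auto simp: le_less)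
qed

lemma fps_neg_arg_compose: "fps_neg_arg f = f oo (- fps_X :: 'a::comm_ring_1 fps)"
proof (rule fps_ext)
  fix n
  have power: "(- fps_X :: 'a fps) ^ i $ n = (if i = n then (-1) ^ n else 0)" for i
  proof -
    have "(- fps_X :: 'a fps) = fps_const (-1) * fps_X" by (simp flip: fps_const_neg)
    then have "(- fps_X :: 'a fps) ^ i = fps_const ((-1) ^ i) * fps_X ^ i"
      by (simp only: power_mult_distrib fps_const_power)
    then show ?thesis by (simp only: fps_mult_left_const_nth fps_X_power_nth) auto
  qed
  show "fps_neg_arg f $ n = (f oo (- fps_X)) $ n"
    by (simp only: fps_neg_arg_def fps_compose_nth fps_nth_Abs_fps power)
      (simp add: if_distrib[of "(*) _"] mult.commute cong: if_cong)
qed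

lemma sufficiency:
  assumes s: "\<forall>i\<in>{1..\<kappa>}. s i = 1 \<or> s i = -1" and eps: "\<forall>i\<in>{1..\<kappa>}. \<epsilon> i = 1 \<or> \<epsilon> i = (-1 :: int)"
    and \<tau>0: "\<forall>i\<in>{1..\<kappa>}. \<tau> i $ 0 = of_int (\<epsilon> i)" and \<kappa>: "1 \<le> \<kappa>"
    and top: "\<tau> \<kappa> * (\<tau> \<kappa> oo (- fps_X)) = 1"
    and cond: "\<And>i. 1 \<le> i \<Longrightarrow> i < \<kappa> \<Longrightarrow> Qser \<kappa> s \<tau> i * (Qser \<kappa> s \<tau> i oo shift_neg (rho \<kappa> s (i+1)))
      = Qser \<kappa> s \<tau> (i+1) * (Qser \<kappa> s \<tau> (i+1) oo shift_neg (rho \<kappa> s (i+1)))"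
  shows "verma_nontrivial \<kappa> s \<epsilon> \<tau>"
proof (rule verma_nontrivial_approx)
  fix N
  \<comment> \<open>Induction on j fits the weights from \<kappa> down to \<kappa> - j. Those below
    are left arbitrary and repaired later, since a step leaves all weights above its index
    untouched.\<close>
  have "\<exists>\<mu>. realizable \<kappa> s \<epsilon> \<mu> \<and> (\<forall>k\<in>{1..\<kappa>}. \<kappa> - j \<le> k \<longrightarrow> fps_eq_upto N (\<mu> k) (\<tau> k))" if "j < \<kappa>" for j
    using that
  proof (induction j)
    case 0
    \<comment> \<open>Base weights have the form \<open>\<epsilon> i\<close> times g. Taking g to be
      \<open>\<tau> \<kappa>\<close> times its sign makes g start with 1 and gives
      \<open>\<tau> \<kappa>\<close> at the top index; the condition at \<kappa> is then exactly the
      unitarity of g.\<close>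
    define c :: "complex fps" where "c = fps_const (of_int (\<epsilon> \<kappa>))"
    have cc: "c * c = 1" and c0: "c $ 0 * \<tau> \<kappa> $ 0 = 1"
      using bspec[OF eps, of \<kappa>] bspec[OF \<tau>0, of \<kappa>] \<kappa> by (auto simp: c_def)
    have "c * \<tau> \<kappa> * fps_neg_arg (c * \<tau> \<kappa>) = (c * c) * (\<tau> \<kappa> * (\<tau> \<kappa> oo (- fps_X)))"
      unfolding fps_neg_arg_compose by (subst fps_compose_mult_distrib) (simp_all add: c_def mult_ac)
    then have "c * \<tau> \<kappa> * fps_neg_arg (c * \<tau> \<kappa>) = 1" using cc top by simp
    from realizable_base[OF eps this] c0
    have "realizable \<kappa> s \<epsilon> (\<lambda>i. fps_const (of_int (\<epsilon> i)) * (c * \<tau> \<kappa>))" by simp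
    moreover have "fps_const (of_int (\<epsilon> \<kappa>)) * (c * \<tau> \<kappa>) = \<tau> \<kappa>"
      using cc unfolding c_def[symmetric] by (simp flip: mult.assoc)
    then have "\<forall>k\<in>{1..\<kappa>}. \<kappa> - 0 \<le> k \<longrightarrow> fps_eq_upto N (fps_const (of_int (\<epsilon> k)) * (c * \<tau> \<kappa>)) (\<tau> k)"
      by (metis atLeastAtMost_iff diff_zero fps_eq_upto_same le_antisym)
    ultimately show ?case by (intro exI[of _ "\<lambda>i. fps_const (of_int (\<epsilon> i)) * (c * \<tau> \<kappa>)"] conjI)
  next
    case (Suc j)
    then obtain \<mu> where \<mu>: "realizable \<kappa> s \<epsilon> \<mu>" "\<And>k. k \<in> {1..\<kappa>} \<Longrightarrow> \<kappa> - j \<le> k \<Longrightarrow> fps_eq_upto N (\<mu> k) (\<tau> k)"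
      by auto
    have i0: "1 \<le> \<kappa> - Suc j" "\<kappa> - Suc j < \<kappa>" using Suc.prems by auto
    have "fps_eq_upto N (\<mu> k) (\<tau> k)" if "k \<in> {1..\<kappa>}" "\<kappa> - Suc j < k" for k
      using \<mu>(2) that by auto
    then show ?case by (rule realizable_match[OF s eps \<tau>0 \<mu>(1) i0 _ cond[OF i0]])
  qed
  from this[of "\<kappa> - 1"] \<kappa> obtain \<mu> where "realizable \<kappa> s \<epsilon> \<mu>" "\<forall>k\<in>{1..\<kappa>}. fps_eq_upto N (\<mu> k) (\<tau> k)" by auto
  then show "\<exists>\<mu>'. (\<forall>i\<in>{1..\<kappa>}. \<forall>r\<le>N. \<mu>' i $ r = \<tau> i $ r) \<and> verma_nontrivial \<kappa> s \<epsilon> \<mu>'"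
    using realizable_nontrivial(1)[OF s] unfolding fps_eq_upto_def by blast
qed

section \<open>From power series in 1/u to the Laurent series of the statement\<close>

lemma mu_tilde_eq_Qser: "fls_X * mu_tilde \<kappa> s \<mu> i = fps_to_fls (Qser \<kappa> s \<mu> i)"
proof -
  have X: "fls_X * fls_X_inv = (1 :: complex fls)" by (simp flip: fls_inverse_X)
  have S: "fps_to_fls (\<Sum>a\<in>A. fps_const (of_int (s a)) * \<mu> a) = (\<Sum>a\<in>A. fls_const (of_int (s a)) * fps_to_fls (\<mu> a))" for A
    by (induction A rule: infinite_finite_induct) (simp_all add: fls_times_fps_to_fls)
  have "fls_X * mu_tilde \<kappa> s \<mu> i = (2 * (fls_X * fls_X_inv) - fls_const (rho \<kappa> s (i+1)) * fls_X) * fps_to_fls (\<mu> i)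
      + fls_X * (\<Sum>a\<in>{i+1..\<kappa>}. fls_const (of_int (s a)) * fps_to_fls (\<mu> a))"
    unfolding mu_tilde_def by (simp add: algebra_simps)
  then show ?thesis
    unfolding X Qser_def by (simp add: fls_times_fps_to_fls S)
qed

lemma mu_tilde_refl_eq_Qser:
  "fps_to_fls (shift_neg c) * mu_tilde_refl \<kappa> s \<mu> i c = fps_to_fls (Qser \<kappa> s \<mu> i oo shift_neg c)"
proof -
  have S: "fps_to_fls (\<Sum>a\<in>A. fps_const (of_int (s a)) * (\<mu> a oo shift_neg c)) = (\<Sum>a\<in>A. fls_const (of_int (s a)) * fps_to_fls (\<mu> a oo shift_neg c))" for A
    by (induction A rule: infinite_finite_induct) (simp_all add: fls_times_fps_to_fls)
  have X: "fls_X_inv * fls_X = (1 :: complex fls)" by (simp flip: fls_inverse_X)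
  define T where "T = fps_to_fls (shift_neg c)"
  have "fps_to_fls ((1 - fps_const c * fps_X) * shift_neg c) = fps_to_fls (- fps_X)" unfolding shift_neg_eq ..
  then have "(1 - fls_const c * fls_X) * T = - fls_X" unfolding T_def by (simp add: fls_times_fps_to_fls)
  then have "fls_X_inv * ((1 - fls_const c * fls_X) * T) = - (fls_X_inv * fls_X)" by simp
  moreover have "fls_X_inv * ((1 - fls_const c * fls_X) * T) = (fls_X_inv - fls_const c * (fls_X_inv * fls_X)) * T"
    by (simp add: algebra_simps)
  \<comment> \<open>T is 1/(c - u): multiplying by it clears the pole of the reflected series, as X
    does for the original one.\<close>
  ultimately have T: "T * (fls_const c - fls_X_inv) = 1" unfolding X by (simp add: algebra_simps)
  have "T * mu_tilde_refl \<kappa> s \<mu> i c = (2 * (T * (fls_const c - fls_X_inv)) - fls_const (rho \<kappa> s (i+1)) * T) * fps_to_fls (\<mu> i oo shift_neg c)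
      + T * (\<Sum>a\<in>{i+1..\<kappa>}. fls_const (of_int (s a)) * fps_to_fls (\<mu> a oo shift_neg c))"
    unfolding mu_tilde_refl_def by (simp add: algebra_simps)
  also have "\<dots> = fps_to_fls ((2 - fps_const (rho \<kappa> s (i+1)) * shift_neg c) * (\<mu> i oo shift_neg c)
      + shift_neg c * (\<Sum>a\<in>{i+1..\<kappa>}. fps_const (of_int (s a)) * (\<mu> a oo shift_neg c)))"
    unfolding T unfolding T_def by (simp add: fls_times_fps_to_fls S)
  also have "(2 - fps_const (rho \<kappa> s (i+1)) * shift_neg c) * (\<mu> i oo shift_neg c)
      + shift_neg c * (\<Sum>a\<in>{i+1..\<kappa>}. fps_const (of_int (s a)) * (\<mu> a oo shift_neg c)) = Qser \<kappa> s \<mu> i oo shift_neg c"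
    unfolding Qser_def by (simp add: fps_compose_add_distrib fps_compose_sub_distrib fps_compose_mult_distrib fps_compose_sum_distrib)
  finally show ?thesis unfolding T_def .
qed

text \<open>Both conditions differ by the same nonzero factor 1/(u (c - u)), which can be
  cancelled.\<close>

lemma mu_tilde_condition_iff:
  "mu_tilde \<kappa> s \<mu> i * mu_tilde_refl \<kappa> s \<mu> i c = mu_tilde \<kappa> s \<mu> j * mu_tilde_refl \<kappa> s \<mu> j c \<longleftrightarrow>
   Qser \<kappa> s \<mu> i * (Qser \<kappa> s \<mu> i oo shift_neg c) = Qser \<kappa> s \<mu> j * (Qser \<kappa> s \<mu> j oo shift_neg c)"
proof -
  define T where "T = fls_X * fps_to_fls (shift_neg c)"
  have "T \<noteq> 0" unfolding T_def using shift_neg_nz[of c] by simp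
  moreover have "T * (mu_tilde \<kappa> s \<mu> i * mu_tilde_refl \<kappa> s \<mu> i c) = fps_to_fls (Qser \<kappa> s \<mu> i * (Qser \<kappa> s \<mu> i oo shift_neg c))" for i
    unfolding fls_times_fps_to_fls mu_tilde_eq_Qser[symmetric] mu_tilde_refl_eq_Qser[symmetric] T_def by (simp only: mult_ac)
  ultimately show ?thesis by (metis fps_to_fls_eq_iff mult_left_cancel)
qed

theorem theorem4p11:
  fixes m n \<kappa> :: nat and s \<epsilon> :: "nat \<Rightarrow> int" and \<mu> :: "nat \<Rightarrow> complex fps"
  assumes "\<kappa> = m + n" and "1 \<le> \<kappa>"
    and "\<forall>i\<in>{1..\<kappa>}. s i = 1 \<or> s i = -1"
    and "card {i\<in>{1..\<kappa>}. s i = 1} = m"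
    and "\<forall>i\<in>{1..\<kappa>}. \<epsilon> i = 1 \<or> \<epsilon> i = -1"
    and "\<forall>i\<in>{1..\<kappa>}. \<mu> i $ 0 = of_int (\<epsilon> i)"
  shows "verma_nontrivial \<kappa> s \<epsilon> \<mu> \<longleftrightarrow>
           (\<mu> \<kappa> * (\<mu> \<kappa> oo (- fps_X)) = 1 \<and>
            (\<forall>i. 1 \<le> i \<and> i < \<kappa> \<longrightarrow>
               mu_tilde \<kappa> s \<mu> i * mu_tilde_refl \<kappa> s \<mu> i (rho \<kappa> s (i+1))
             = mu_tilde \<kappa> s \<mu> (i+1) * mu_tilde_refl \<kappa> s \<mu> (i+1) (rho \<kappa> s (i+1))))"
  unfolding mu_tilde_condition_iff
  using necessity[OF assms(3,6) _ assms(2)] sufficiency[OF assms(3,5,6,2)] by blast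


end
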